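(* Let $n>1$ be an integer, and let $a,b$ be integers such that $\gcd(a,b)=1$, $a$ is odd with $a\equiv 1\pmod 3$, and $b$ is odd with $b\equiv 0\pmod 3$. Then $3$ divides the class number of the quadratic field $\mathbb{Q}\left(\sqrt{3(4a^{3n}-b^{2n})}\right)$. *)

theory Defs
  imports "HOL-Algebra.Algebraic_Closure_Type" "HOL-Algebra.Ideal_Product" "HOL-Number_Theory.Cong"
begin

definition quadratic_field :: "int \<Rightarrow> complex set" where
  "quadratic_field d = {of_rat x + of_rat y * csqrt (of_int d) | x y. True}"

definition ring_of_integers :: "complex set \<Rightarrow> complex ring" where
  "ring_of_integers K = ring_of_type_algebra \<lparr>carrier := {z \<in> K. algebraic_int z}\<rparr>"

definition nonzero_ideals :: "('a, 'b) ring_scheme \<Rightarrow> 'a set set" where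
  "nonzero_ideals R = {I. ideal I R \<and> I \<noteq> {\<zero>\<^bsub>R\<^esub>}}"

definition ideal_class_rel :: "('a, 'b) ring_scheme \<Rightarrow> ('a set \<times> 'a set) set" where
  "ideal_class_rel R =
     {(I, J). I \<in> nonzero_ideals R \<and> J \<in> nonzero_ideals R \<and>
        (\<exists>\<alpha> \<in> carrier R - {\<zero>\<^bsub>R\<^esub>}. \<exists>\<beta> \<in> carrier R - {\<zero>\<^bsub>R\<^esub>}.
           (\<lambda>x. \<alpha> \<otimes>\<^bsub>R\<^esub> x) ` I = (\<lambda>x. \<beta> \<otimes>\<^bsub>R\<^esub> x) ` J)}"

text \<open>The class group, with the product of two classes induced by the product of ideals: as the
  class of \<open>I \<cdot> J\<close> depends only on the classes of \<open>I\<close> and \<open>J\<close>, the union below is over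
  one and the same class.\<close>

definition class_group :: "('a, 'b) ring_scheme \<Rightarrow> 'a set set monoid" where
  "class_group R =
     \<lparr>carrier = nonzero_ideals R // ideal_class_rel R,
      monoid.mult = (\<lambda>A B. \<Union>I\<in>A. \<Union>J\<in>B. ideal_class_rel R `` {ideal_prod R I J}),
      one = ideal_class_rel R `` {carrier R}\<rparr>"

definition class_number :: "complex set \<Rightarrow> nat" where
  "class_number K = Coset.order (class_group (ring_of_integers K))"


text \<open>Since \<open>order\<close> is \<open>0\<close> for an infinite carrier, the rest of this theory proves that the class
  group of a quadratic field is finite and the class number positive, and that the radicands
  \<open>3 (4 a^(3n) - b^(2n))\<close> in question are not squares.\<close>

lemma ring_of_integers_simps [simp]:
  "carrier (ring_of_integers K) = {z \<in> K. algebraic_int z}"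
  "x \<otimes>\<^bsub>ring_of_integers K\<^esub> y = x * y"
  "\<one>\<^bsub>ring_of_integers K\<^esub> = 1"
  "\<zero>\<^bsub>ring_of_integers K\<^esub> = 0"
  "x \<oplus>\<^bsub>ring_of_integers K\<^esub> y = x + y"
  by (simp_all add: ring_of_integers_def ring_of_type_algebra_def)

lemma algebraic_int_of_rat_imp_Ints:
  assumes "algebraic_int (of_rat r :: complex)"
  shows "r \<in> \<int>"
proof -
  have "(of_rat r :: complex) \<in> \<int>"
    using assms by (intro rational_algebraic_int_is_int) auto
  then obtain k where "(of_rat r :: complex) = of_int k" by (auto elim: Ints_cases)
  hence "(of_rat r :: complex) = of_rat (of_int k)" by simp
  hence "r = of_int k" by (simp only: of_rat_eq_iff)
  thus ?thesis by simp
qed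

lemma rat_square_Ints:
  assumes "(r::rat)^2 \<in> \<int>"
  shows "r \<in> \<int>"
proof -
  have "algebraic_int r"
  proof (rule algebraic_int_root)
    show "algebraic_int (r^2)" using assms by (rule int_imp_algebraic_int)
    show "poly (monom 1 2) r = r^2" by (simp add: poly_monom)
  qed (auto simp: degree_monom_eq)
  thus ?thesis by (intro rational_algebraic_int_is_int) (auto simp: Rats_def intro!: image_eqI[of _ _ r])
qed

lemma rat_cases:
  fixes r :: rat
  obtains a b :: int where "b > 0" "coprime a b" "r = of_int a / of_int b"
proof -
  obtain a b where "quotient_of r = (a, b)" by force
  thus ?thesis
    using that quotient_of_denom_pos quotient_of_coprime quotient_of_div by blast
qed

locale nonsquare =
  fixes d :: int
  assumes nonsquare: "\<nexists>k. d = k\<^sup>2"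
begin

definition s :: complex where "s = csqrt (of_int d)"
definition qel :: "rat \<Rightarrow> rat \<Rightarrow> complex" where "qel x y = of_rat x + of_rat y * s"
abbreviation "OK \<equiv> {z \<in> quadratic_field d. algebraic_int z}"
abbreviation "R \<equiv> ring_of_integers (quadratic_field d)"

lemma s_sq: "s * s = of_int d"
  using power2_csqrt[of "of_int d"] by (simp add: s_def power2_eq_square)

lemma d_nz: "d \<noteq> 0" using nonsquare[unfolded not_ex, THEN spec, of 0] by simp

lemma s_not_rat: "s \<noteq> of_rat r"
proof
  assume "s = of_rat r"
  hence "(of_rat (r^2) :: complex) = of_rat (of_int d)"
    using s_sq by (simp add: of_rat_mult power2_eq_square)
  hence e: "r^2 = of_int d" by (simp only: of_rat_eq_iff)
  have "r \<in> \<int>" by (rule rat_square_Ints) (simp only: e Ints_of_int)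
  then obtain k where "r = of_int k" by (auto elim: Ints_cases)
  with e have "(of_int (k^2) :: rat) = of_int d" by simp
  hence "d = k^2" by (simp only: of_int_eq_iff)
  with nonsquare show False by blast
qed

lemma qel_0_iff: "qel x y = 0 \<longleftrightarrow> x = 0 \<and> y = 0"
proof
  assume e: "qel x y = 0"
  have "y = 0"
  proof (rule ccontr)
    assume "y \<noteq> 0"
    hence "s = of_rat (- x / y)"
      using e by (simp add: qel_def of_rat_divide of_rat_minus field_simps add_eq_0_iff)
    with s_not_rat show False by blast
  qed
  with e show "x = 0 \<and> y = 0" by (simp add: qel_def)
qed (simp add: qel_def)

lemma qel_add: "qel x y + qel x' y' = qel (x + x') (y + y')"
  by (simp add: qel_def of_rat_add algebra_simps)

lemma qel_minus: "- qel x y = qel (- x) (- y)"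
  by (simp add: qel_def of_rat_minus algebra_simps)

lemma qel_diff: "qel x y - qel x' y' = qel (x - x') (y - y')"
  by (simp add: qel_def of_rat_diff algebra_simps)

lemma qel_mult: "qel x y * qel x' y' = qel (x * x' + of_int d * y * y') (x * y' + y * x')"
proof -
  have ring_id: "(a + b * s) * (c + e * s) = (a * c + (s * s) * b * e) + (a * e + b * c) * s" for a b c e
    by (simp add: algebra_simps)
  show ?thesis
    unfolding qel_def ring_id s_sq of_rat_add of_rat_mult of_rat_of_int_eq ..
qed

lemma qel_eq_iff: "qel x y = qel x' y' \<longleftrightarrow> x = x' \<and> y = y'"
  using qel_0_iff[of "x - x'" "y - y'"] by (simp add: qel_diff[symmetric])

lemma quadratic_field_eq: "quadratic_field d = {qel x y | x y. True}"
  by (simp add: quadratic_field_def qel_def s_def)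

lemma poly_conj:
  assumes "\<forall>i. coeff p i \<in> \<int>"
  shows "\<exists>u v. poly p (qel x y) = qel u v \<and> poly p (qel x (- y)) = qel u (- v)"
  using assms
proof (induction p)
  case 0
  show ?case by (rule exI[of _ 0], rule exI[of _ 0]) (simp add: qel_def)
next
  case (pCons a p)
  have "\<forall>i. coeff p i \<in> \<int>"
    using pCons.prems by (metis coeff_pCons_Suc)
  then obtain u v where uv: "poly p (qel x y) = qel u v" "poly p (qel x (- y)) = qel u (- v)"
    using pCons.IH by blast
  have "a \<in> \<int>" using pCons.prems by (metis coeff_pCons_0)
  then obtain k where "a = of_int k" by (auto elim: Ints_cases)
  hence a: "a = qel (of_int k) 0" by (simp add: qel_def)
  show ?case
    by (rule exI[of _ "of_int k + (x * u + of_int d * y * v)"], rule exI[of _ "x * v + y * u"])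
       (simp add: uv a qel_mult qel_add)
qed

lemma algebraic_int_conj:
  assumes "algebraic_int (qel x y)"
  shows "algebraic_int (qel x (- y))"
proof -
  obtain p where p: "lead_coeff p = 1" "\<forall>i. coeff p i \<in> \<int>" "poly p (qel x y) = 0"
    using assms by (auto simp: algebraic_int.simps)
  obtain u v where "poly p (qel x y) = qel u v" "poly p (qel x (- y)) = qel u (- v)"
    using poly_conj[OF p(2)] by blast
  hence "poly p (qel x (- y)) = 0" using p(3) by (simp add: qel_0_iff)
  thus ?thesis using p by (auto simp: algebraic_int.simps)
qed

definition L :: "int \<Rightarrow> complex set" where
  "L M = {qel (of_int i / of_int M) (of_int j / of_int M) | i j. True}"

lemma L_add: "x \<in> L M \<Longrightarrow> y \<in> L M \<Longrightarrow> x + y \<in> L M"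
  unfolding L_def by (auto simp: qel_add simp flip: add_divide_distrib of_int_add) blast

lemma L_int: 
  assumes "x \<in> L M" shows "of_int k * x \<in> L M"
proof -
  obtain i j where x: "x = qel (of_int i / of_int M) (of_int j / of_int M)"
    using assms by (auto simp: L_def)
  have "of_int k = qel (of_int k) 0" by (simp add: qel_def)
  hence "of_int k * x = qel (of_int (k * i) / of_int M) (of_int (k * j) / of_int M)"
    by (simp add: x qel_mult)
  thus ?thesis unfolding L_def by blast
qed

lemma L_sum:
  assumes "\<And>k. k \<in> A \<Longrightarrow> f k \<in> L M"
  shows "sum f A \<in> L M"
proof -
  have "qel (of_int 0 / of_int M) (of_int 0 / of_int M) \<in> L M" unfolding L_def by blast
  hence z: "0 \<in> L M" by (simp add: qel_def)
  show ?thesis using assms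
    by (induction A rule: infinite_finite_induct) (auto simp: z intro: L_add)
qed

lemma L_mult:
  assumes "x \<in> L A" "y \<in> L B"
  shows "x * y \<in> L (A * B)"
proof -
  obtain i j i' j' where xy: "x = qel (of_int i / of_int A) (of_int j / of_int A)"
     "y = qel (of_int i' / of_int B) (of_int j' / of_int B)"
    using assms by (auto simp: L_def)
  have "x * y = qel (of_int (i * i' + d * j * j') / of_int (A * B)) 
                    (of_int (i * j' + j * i') / of_int (A * B))"
    by (simp add: xy qel_mult add_divide_distrib)
  thus ?thesis unfolding L_def by blast
qed

lemma L_mono: 
  assumes "x \<in> L A" "B \<noteq> 0"
  shows "x \<in> L (A * B)"
proof -
  have "1 = qel (of_int B / of_int B) (of_int 0 / of_int B)" using assms by (simp add: qel_def)
  hence "1 \<in> L B" unfolding L_def by blast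
  from L_mult[OF assms(1) this] show ?thesis by simp
qed

lemma bounded_powers:
  assumes "algebraic_int \<alpha>" and \<alpha>: "\<alpha> = qel x y"
  shows "\<exists>M>0. \<forall>n. \<alpha> ^ n \<in> L M"
proof -
  obtain p where p: "lead_coeff p = 1" "\<forall>i. coeff p i \<in> \<int>" "poly p \<alpha> = 0"
    using assms by (auto simp: algebraic_int.simps)
  define m where "m = degree p"
  obtain a b where ab: "b > 0" "coprime a b" "x = of_int a / of_int b" by (rule rat_cases)
  obtain a' b' where ab': "b' > 0" "coprime a' b'" "y = of_int a' / of_int b'" by (rule rat_cases)
  define B where "B = b * b'"
  have B: "B > 0" using ab ab' by (simp add: B_def)
  have "\<alpha> = qel (of_int (a * b') / of_int B) (of_int (a' * b) / of_int B)"
    using ab ab' by (simp add: \<alpha> B_def)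
  hence \<alpha>L: "\<alpha> \<in> L B" unfolding L_def by blast
  have "1 = qel (of_int 1 / of_int 1) (of_int 0 / of_int 1)" by (simp add: qel_def)
  hence one: "1 \<in> L 1" unfolding L_def by blast
  have pow: "\<alpha> ^ k \<in> L (B ^ k)" for k
    by (induction k) (use L_mult[OF \<alpha>L] one in auto)
  have small: "\<alpha> ^ k \<in> L (B ^ m)" if "k \<le> m" for k
    using L_mono[OF pow[of k], of "B ^ (m - k)"] B that by (simp flip: power_add)
  have "\<alpha> ^ n \<in> L (B ^ m)" for n
  proof (induction n rule: less_induct)
    case (less n)
    show ?case
    proof (cases "n \<le> m")
      case False
      have "0 = (\<Sum>i\<le>m. coeff p i * \<alpha> ^ i)" using p by (simp add: poly_altdef m_def)
      also have "\<dots> = (\<Sum>i<m. coeff p i * \<alpha> ^ i) + \<alpha> ^ m"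
        using p(1) by (simp add: m_def flip: lessThan_Suc_atMost)
      finally have "\<alpha> ^ m = - (\<Sum>i<m. coeff p i * \<alpha> ^ i)" by (simp add: add_eq_0_iff)
      hence "\<alpha> ^ (n - m) * \<alpha> ^ m = (\<Sum>i<m. - coeff p i * \<alpha> ^ (n - m + i))"
        by (simp add: sum_distrib_left sum_negf power_add algebra_simps)
      hence "\<alpha> ^ n = (\<Sum>i<m. - coeff p i * \<alpha> ^ (n - m + i))"
        using False by (simp flip: power_add)
      also have "\<dots> \<in> L (B ^ m)"
      proof (rule L_sum)
        fix i assume i: "i \<in> {..<m}"
        have "- coeff p i \<in> \<int>" using p by auto
        then obtain k where k: "- coeff p i = of_int k" by (blast elim: Ints_cases)
        have "\<alpha> ^ (n - m + i) \<in> L (B ^ m)" using i False by (intro less) auto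
        thus "- coeff p i * \<alpha> ^ (n - m + i) \<in> L (B ^ m)" unfolding k by (rule L_int)
      qed
      finally show ?thesis .
    qed (rule small)
  qed
  thus ?thesis using B by (intro exI[of _ "B ^ m"]) auto
qed

lemma bounded_denominators_imp_Ints:
  fixes r :: rat
  assumes "M > 0" and "\<And>n. of_int M * r ^ n \<in> \<int>"
  shows "r \<in> \<int>"
proof -
  obtain a b where ab: "b > 0" "coprime a b" "r = of_int a / of_int b"
    by (rule rat_cases)
  have dv: "b ^ n dvd M" for n
  proof -
    obtain k where "of_int M * r ^ n = of_int k" using assms(2)[of n] by (auto elim: Ints_cases)
    hence "of_int M * of_int a ^ n = (of_int k * of_int b ^ n :: rat)"
      using ab by (simp add: power_divide field_simps)
    hence "of_int (M * a ^ n) = (of_int (k * b ^ n) :: rat)" by simp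
    hence "M * a ^ n = k * b ^ n" by (simp only: of_int_eq_iff)
    hence "b ^ n dvd M * a ^ n" by simp
    moreover have "coprime (b ^ n) (a ^ n)" using ab by (simp add: coprime_commute)
    ultimately show ?thesis by (simp add: coprime_dvd_mult_left_iff)
  qed
  have "b = 1"
  proof (rule ccontr)
    assume "b \<noteq> 1"
    hence "b \<ge> 2" using ab by simp
    have "int (nat M) < 2 ^ nat M" by (rule of_nat_less_two_power)
    also have "\<dots> \<le> b ^ nat M" using \<open>b \<ge> 2\<close> by (intro power_mono) auto
    also have "\<dots> \<le> M" using dv[of "nat M"] assms(1) by (intro zdvd_imp_le)
    finally show False using assms(1) by simp
  qed
  thus ?thesis using ab by simp
qed

lemma L_rat:
  assumes "qel r 0 \<in> L M" "M > 0"
  shows "of_int M * r \<in> \<int>"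
  using assms by (auto simp: L_def qel_eq_iff)

lemma qel_pow0: "qel r 0 ^ n = qel (r ^ n) 0"
  by (simp add: qel_def of_rat_power)

lemma algebraic_int_iff:
  "algebraic_int (qel x y) \<longleftrightarrow> 2 * x \<in> \<int> \<and> x\<^sup>2 - of_int d * y\<^sup>2 \<in> \<int>"
proof
  assume a: "algebraic_int (qel x y)"
  define \<alpha> \<beta> where "\<alpha> = qel x y" and "\<beta> = qel x (- y)"
  obtain M where M: "M > 0" "\<And>n. \<alpha> ^ n \<in> L M" using bounded_powers[OF a refl] by (auto simp: \<alpha>_def)
  obtain M' where M': "M' > 0" "\<And>n. \<beta> ^ n \<in> L M'"
    using bounded_powers[OF algebraic_int_conj[OF a] refl] by (auto simp: \<beta>_def)
  have MM: "M * M' > 0" using M M' by simp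
  have prod: "\<alpha> ^ k * \<beta> ^ l \<in> L (M * M')" for k l using M M' by (intro L_mult)
  have tr: "qel (2 * x) 0 = \<alpha> + \<beta>" by (simp add: \<alpha>_def \<beta>_def qel_add)
  have nm: "qel (x\<^sup>2 - of_int d * y\<^sup>2) 0 = \<alpha> * \<beta>"
    by (simp add: \<alpha>_def \<beta>_def qel_mult power2_eq_square mult.assoc)
  have "of_int (M * M') * (2 * x) ^ n \<in> \<int>" for n
  proof (rule L_rat[OF _ MM])
    have "qel ((2 * x) ^ n) 0 = (\<Sum>k\<le>n. of_int (int (n choose k)) * (\<alpha> ^ k * \<beta> ^ (n - k)))"
      by (simp only: qel_pow0[symmetric] tr) (simp add: binomial_ring mult.assoc)
    also have "\<dots> \<in> L (M * M')" by (intro L_sum L_int prod)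
    finally show "qel ((2 * x) ^ n) 0 \<in> L (M * M')" .
  qed
  moreover have "of_int (M * M') * (x\<^sup>2 - of_int d * y\<^sup>2) ^ n \<in> \<int>" for n
  proof (rule L_rat[OF _ MM])
    show "qel ((x\<^sup>2 - of_int d * y\<^sup>2) ^ n) 0 \<in> L (M * M')"
      by (simp only: qel_pow0[symmetric] nm power_mult_distrib prod)
  qed
  ultimately show "2 * x \<in> \<int> \<and> x\<^sup>2 - of_int d * y\<^sup>2 \<in> \<int>"
    using bounded_denominators_imp_Ints[OF MM] by blast
next
  assume "2 * x \<in> \<int> \<and> x\<^sup>2 - of_int d * y\<^sup>2 \<in> \<int>"
  then obtain t n where tn: "2 * x = of_int t" "x\<^sup>2 - of_int d * y\<^sup>2 = of_int n"
    by (auto elim!: Ints_cases)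
  have k: "of_int k = qel (of_int k) 0" for k by (simp add: qel_def)
  have "poly [:of_int n, - of_int t, 1:] (qel x y) = 0"
    unfolding k tn[symmetric]
    by (simp add: k tn[symmetric] qel_minus qel_mult qel_add qel_0_iff power2_eq_square algebra_simps)
  moreover have "\<forall>i. coeff [:of_int n, - of_int t, 1 :: complex:] i \<in> \<int>"
    by (auto simp: coeff_pCons split: nat.splits)
  ultimately show "algebraic_int (qel x y)"
    by (intro algebraic_int.intros[of "[:of_int n, - of_int t, 1:]"]) auto
qed

lemma OK_iff: "qel x y \<in> OK \<longleftrightarrow> 2 * x \<in> \<int> \<and> x\<^sup>2 - of_int d * y\<^sup>2 \<in> \<int>"
  unfolding algebraic_int_iff[symmetric] by (auto simp: quadratic_field_eq)

lemma OK_cases: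
  assumes "z \<in> OK"
  obtains x y where "z = qel x y" "2 * x \<in> \<int>" "x\<^sup>2 - of_int d * y\<^sup>2 \<in> \<int>"
  using assms algebraic_int_iff by (auto simp: quadratic_field_eq)

lemma OK_aux:
  fixes x y x' y' :: rat
  assumes "2 * x \<in> \<int>" "x\<^sup>2 - of_int d * y\<^sup>2 \<in> \<int>" "2 * x' \<in> \<int>" "x'\<^sup>2 - of_int d * y'\<^sup>2 \<in> \<int>"
  shows "2 * (x * x' - of_int d * y * y') \<in> \<int>" "2 * (x * x' + of_int d * y * y') \<in> \<int>"
proof -
  obtain a n a' n' where e: "2 * x = of_int a" "x\<^sup>2 - of_int d * y\<^sup>2 = of_int n"
    "2 * x' = of_int a'" "x'\<^sup>2 - of_int d * y'\<^sup>2 = of_int n'"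
    using assms by (auto elim!: Ints_cases)
  define w where "w = 4 * of_int d * y * y'"
  have 1: "4 * of_int d * y\<^sup>2 = of_int (a\<^sup>2 - 4 * n)"
  proof -
    have "4 * of_int d * y\<^sup>2 = (2 * x)\<^sup>2 - 4 * (x\<^sup>2 - of_int d * y\<^sup>2)" by (simp add: power2_eq_square algebra_simps)
    thus ?thesis by (simp add: e)
  qed
  have 2: "4 * of_int d * y'\<^sup>2 = of_int (a'\<^sup>2 - 4 * n')"
  proof -
    have "4 * of_int d * y'\<^sup>2 = (2 * x')\<^sup>2 - 4 * (x'\<^sup>2 - of_int d * y'\<^sup>2)" by (simp add: power2_eq_square algebra_simps)
    thus ?thesis by (simp add: e)
  qed
  have "w\<^sup>2 = (4 * of_int d * y\<^sup>2) * (4 * of_int d * y'\<^sup>2)"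
    by (simp add: w_def power2_eq_square)
  hence w2: "w\<^sup>2 = of_int ((a\<^sup>2 - 4 * n) * (a'\<^sup>2 - 4 * n'))" unfolding 1 2 by simp
  have "w \<in> \<int>" by (rule rat_square_Ints) (simp only: w2 Ints_of_int)
  then obtain k where k: "w = of_int k" by (auto elim: Ints_cases)
  have "(of_int (k\<^sup>2) :: rat) = of_int ((a\<^sup>2 - 4 * n) * (a'\<^sup>2 - 4 * n'))"
    using w2 k by simp
  hence k2: "k\<^sup>2 = (a\<^sup>2 - 4 * n) * (a'\<^sup>2 - 4 * n')" by (simp only: of_int_eq_iff)
  have "even (k\<^sup>2) \<longleftrightarrow> even (a * a')" unfolding k2 by simp
  hence "even k \<longleftrightarrow> even (a * a')" by simp
  hence ev: "even (a * a' - k)" "even (a * a' + k)" by auto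
  have even_half: "(of_int m / 2 :: rat) \<in> \<int>" if "even m" for m :: int
    using that by (auto elim!: evenE)
  have f: "2 * (x * x' - of_int d * y * y') = of_int (a * a' - k) / 2"
          "2 * (x * x' + of_int d * y * y') = of_int (a * a' + k) / 2"
    using e(1)[symmetric] e(3)[symmetric] k[symmetric] by (simp_all add: w_def field_simps)
  show "2 * (x * x' - of_int d * y * y') \<in> \<int>" "2 * (x * x' + of_int d * y * y') \<in> \<int>"
    unfolding f using even_half[OF ev(1)] even_half[OF ev(2)] by blast+
qed

lemma OK_add:
  assumes "u \<in> OK" "v \<in> OK" shows "u + v \<in> OK"
proof -
  obtain x y where u: "u = qel x y" "2 * x \<in> \<int>" "x\<^sup>2 - of_int d * y\<^sup>2 \<in> \<int>"
    using assms(1) by (rule OK_cases)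
  obtain x' y' where v: "v = qel x' y'" "2 * x' \<in> \<int>" "x'\<^sup>2 - of_int d * y'\<^sup>2 \<in> \<int>"
    using assms(2) by (rule OK_cases)
  have "2 * (x + x') = 2 * x + 2 * x'" by simp
  also have "\<dots> \<in> \<int>" using u v by (intro Ints_add)
  moreover have "(x + x')\<^sup>2 - of_int d * (y + y')\<^sup>2 = (x\<^sup>2 - of_int d * y\<^sup>2) + (x'\<^sup>2 - of_int d * y'\<^sup>2)
      + 2 * (x * x' - of_int d * y * y')" by (simp add: power2_eq_square algebra_simps)
  moreover have "\<dots> \<in> \<int>" using u v OK_aux(1)[of x y x' y'] by (intro Ints_add)
  ultimately show ?thesis unfolding u v qel_add OK_iff by simp
qed

lemma OK_mult:
  assumes "u \<in> OK" "v \<in> OK" shows "u * v \<in> OK"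
proof -
  obtain x y where u: "u = qel x y" "2 * x \<in> \<int>" "x\<^sup>2 - of_int d * y\<^sup>2 \<in> \<int>"
    using assms(1) by (rule OK_cases)
  obtain x' y' where v: "v = qel x' y'" "2 * x' \<in> \<int>" "x'\<^sup>2 - of_int d * y'\<^sup>2 \<in> \<int>"
    using assms(2) by (rule OK_cases)
  have "(x * x' + of_int d * y * y')\<^sup>2 - of_int d * (x * y' + y * x')\<^sup>2
      = (x\<^sup>2 - of_int d * y\<^sup>2) * (x'\<^sup>2 - of_int d * y'\<^sup>2)" by (simp add: power2_eq_square algebra_simps)
  moreover have "\<dots> \<in> \<int>" using u v by (intro Ints_mult)
  ultimately show ?thesis using OK_aux(2)[of x y x' y'] u v unfolding u(1) v(1) qel_mult OK_iff by simp
qed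

lemma OK_minus: "u \<in> OK \<Longrightarrow> - u \<in> OK"
  by (erule OK_cases) (simp only: qel_minus OK_iff, simp)

lemma OK_diff: "u \<in> OK \<Longrightarrow> v \<in> OK \<Longrightarrow> u - v \<in> OK"
  using OK_add[OF _ OK_minus] by fastforce

lemma OK_ints: "qel (of_int i) (of_int j) \<in> OK"
  unfolding OK_iff by simp

lemma OK_of_int: "of_int i \<in> OK"
  using OK_ints[of i 0] by (simp add: qel_def)

lemma OK_01: "0 \<in> OK" "1 \<in> OK"
  using OK_of_int[of 0] OK_of_int[of 1] by simp_all

lemma cring_OK: "cring R"
proof (rule cringI)
  show "abelian_group R"
  proof (rule abelian_groupI)
    fix x assume "x \<in> carrier R"
    thus "\<exists>y\<in>carrier R. y \<oplus>\<^bsub>R\<^esub> x = \<zero>\<^bsub>R\<^esub>"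
      using OK_minus[of x] by (intro bexI[of _ "- x"]) simp_all
  qed (use OK_add OK_01 in \<open>simp_all add: algebra_simps\<close>)
  show "comm_monoid R"
    by (rule comm_monoidI) (use OK_mult OK_01 in \<open>simp_all add: algebra_simps\<close>)
qed (simp add: algebra_simps)

lemma a_inv_R:
  assumes "x \<in> OK" shows "\<ominus>\<^bsub>R\<^esub> x = - x"
proof -
  interpret cring R by (rule cring_OK)
  show ?thesis by (rule minus_equality) (use assms OK_minus[OF assms] in simp_all)
qed

lemma idealR:
  assumes Jsub: "J \<subseteq> OK" and Jzero: "0 \<in> J" and Jadd: "\<And>x y. x \<in> J \<Longrightarrow> y \<in> J \<Longrightarrow> x + y \<in> J"
    and Jmult: "\<And>x y. x \<in> OK \<Longrightarrow> y \<in> J \<Longrightarrow> x * y \<in> J"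
  shows "ideal J R"
proof -
  interpret cring R by (rule cring_OK)
  show ?thesis
  proof (rule idealI)
    show "ring R" by (rule ring_axioms)
    show "subgroup J (add_monoid R)"
    proof (rule add.subgroupI)
      show "J \<subseteq> carrier R" using Jsub by simp
      show "J \<noteq> {}" using Jzero by blast
      fix x assume x: "x \<in> J"
      have "\<ominus>\<^bsub>R\<^esub> x = (- 1) * x" using a_inv_R[of x] x Jsub by auto
      also have "\<dots> \<in> J" using OK_minus[OF OK_01(2)] x by (rule Jmult)
      finally show "\<ominus>\<^bsub>R\<^esub> x \<in> J" .
    qed (simp add: Jadd)
    fix a x assume "a \<in> J" "x \<in> carrier R"
    thus "x \<otimes>\<^bsub>R\<^esub> a \<in> J" "a \<otimes>\<^bsub>R\<^esub> x \<in> J" using Jmult[of x a] by (simp_all add: mult.commute)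
  qed
qed

lemma idealD:
  assumes "ideal J R"
  shows "x \<in> J \<Longrightarrow> x \<in> OK" "0 \<in> J" "x \<in> J \<Longrightarrow> y \<in> J \<Longrightarrow> x + y \<in> J"
    "z \<in> OK \<Longrightarrow> y \<in> J \<Longrightarrow> z * y \<in> J"
proof -
  interpret ideal J R by (rule assms)
  show "x \<in> J \<Longrightarrow> x \<in> OK" using Icarr by simp
  show "0 \<in> J" using additive_subgroup.zero_closed[OF is_additive_subgroup] by simp
  show "x \<in> J \<Longrightarrow> y \<in> J \<Longrightarrow> x + y \<in> J" using additive_subgroup.a_closed[OF is_additive_subgroup, of x y] by simp
  show "z \<in> OK \<Longrightarrow> y \<in> J \<Longrightarrow> z * y \<in> J" using I_l_closed[of y z] by simp
qed

lemma ideal_diff: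
  assumes "ideal J R" "x \<in> J" "y \<in> J"
  shows "x - y \<in> J"
proof -
  have "(- 1) * y \<in> J" using OK_minus[OF OK_01(2)] assms(3) by (rule idealD(4)[OF assms(1)])
  from idealD(3)[OF assms(1,2) this] show ?thesis by simp
qed

lemma approx:
  fixes x y :: rat
  shows "\<exists>t\<in>{1..(\<bar>d\<bar> + 2)\<^sup>2}. \<exists>p q :: int.
    \<bar>(of_int t * x - of_int p)\<^sup>2 - of_int d * (of_int t * y - of_int q)\<^sup>2\<bar> < 1"
proof -
  define m where "m = \<bar>d\<bar> + 2"
  have "m * 1 \<le> m * m" by (intro mult_left_mono) (simp_all add: m_def)
  hence m: "m > 0" "1 + \<bar>d\<bar> < m\<^sup>2" by (simp_all add: m_def power2_eq_square)
  define f where "f t = (\<lfloor>of_int m * frac (of_int t * x)\<rfloor>, \<lfloor>of_int m * frac (of_int t * y)\<rfloor>)"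
    for t :: int
  have fl: "\<lfloor>of_int m * frac z\<rfloor> \<in> {0..<m}" for z :: rat
  proof -
    have "0 \<le> of_int m * frac z" using m by simp
    moreover have "of_int m * frac z < of_int m * 1"
      using m by (intro mult_strict_left_mono frac_lt_1) simp
    ultimately show ?thesis by (simp add: floor_less_iff)
  qed
  have "f ` {0..m\<^sup>2} \<subseteq> {0..<m} \<times> {0..<m}" using fl by (auto simp: f_def)
  hence "card (f ` {0..m\<^sup>2}) \<le> card ({0..<m} \<times> {0..<m})" by (intro card_mono) auto
  also have "\<dots> = nat (m\<^sup>2)" using m by (simp add: card_cartesian_product power2_eq_square nat_mult_distrib)
  also have "\<dots> < card {0..m\<^sup>2}" by (simp add: nat_add_distrib)
  finally have "\<not> inj_on f {0..m\<^sup>2}" by (rule pigeonhole)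
  then obtain t1' t2' where "t1' \<in> {0..m\<^sup>2}" "t2' \<in> {0..m\<^sup>2}" "t1' \<noteq> t2'" "f t1' = f t2'"
    by (auto simp: inj_on_def)
  then obtain t1 t2 where t: "t1 \<in> {0..m\<^sup>2}" "t2 \<in> {0..m\<^sup>2}" "t1 < t2" "f t1 = f t2"
    by (metis linorder_neqE)
  have bd: "of_int m ^ 2 * (of_int (t2 - t1) * z - of_int (\<lfloor>of_int t2 * z\<rfloor> - \<lfloor>of_int t1 * z\<rfloor>))\<^sup>2 < 1"
    if "\<lfloor>of_int m * frac (of_int t1 * z)\<rfloor> = \<lfloor>of_int m * frac (of_int t2 * z)\<rfloor>" for z :: rat
  proof -
    have "\<bar>of_int m * frac (of_int t2 * z) - of_int m * frac (of_int t1 * z)\<bar> < 1"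
      using that by linarith
    hence "(of_int m * frac (of_int t2 * z) - of_int m * frac (of_int t1 * z))\<^sup>2 < 1"
      by (simp add: abs_square_less_1)
    also have "(of_int m * frac (of_int t2 * z) - of_int m * frac (of_int t1 * z))\<^sup>2 =
      of_int m ^ 2 * (of_int (t2 - t1) * z - of_int (\<lfloor>of_int t2 * z\<rfloor> - \<lfloor>of_int t1 * z\<rfloor>))\<^sup>2"
      by (simp add: frac_def power2_eq_square algebra_simps)
    finally show ?thesis .
  qed
  define u where "u = of_int (t2 - t1) * x - of_int (\<lfloor>of_int t2 * x\<rfloor> - \<lfloor>of_int t1 * x\<rfloor>)"
  define v where "v = of_int (t2 - t1) * y - of_int (\<lfloor>of_int t2 * y\<rfloor> - \<lfloor>of_int t1 * y\<rfloor>)"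
  have uv: "of_int m ^ 2 * u\<^sup>2 < 1" "of_int m ^ 2 * v\<^sup>2 < 1"
    using t(4) bd[of x] bd[of y] by (simp_all add: f_def u_def v_def)
  have "\<bar>u\<^sup>2 - of_int d * v\<^sup>2\<bar> \<le> u\<^sup>2 + of_int \<bar>d\<bar> * v\<^sup>2"
    using abs_triangle_ineq4[of "u\<^sup>2" "of_int d * v\<^sup>2"] by (simp add: abs_mult)
  hence "of_int m ^ 2 * \<bar>u\<^sup>2 - of_int d * v\<^sup>2\<bar> \<le> of_int m ^ 2 * (u\<^sup>2 + of_int \<bar>d\<bar> * v\<^sup>2)"
    by (intro mult_left_mono) auto
  also have "\<dots> = of_int m ^ 2 * u\<^sup>2 + of_int \<bar>d\<bar> * (of_int m ^ 2 * v\<^sup>2)" by (simp add: algebra_simps)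
  also have "\<dots> \<le> 1 + of_int \<bar>d\<bar> * 1"
    using uv by (intro add_mono mult_left_mono) auto
  also have "\<dots> = of_int (1 + \<bar>d\<bar>)" by simp
  also have "\<dots> < (of_int (m\<^sup>2) :: rat)" using m(2) by (simp only: of_int_less_iff)
  also have "\<dots> = of_int m ^ 2 * 1" by simp
  finally have "\<bar>u\<^sup>2 - of_int d * v\<^sup>2\<bar> < 1"
    using m(1) by (subst (asm) mult_less_cancel_left_pos) auto
  moreover have "t2 - t1 \<in> {1..(\<bar>d\<bar> + 2)\<^sup>2}" using t by (auto simp: m_def)
  ultimately show ?thesis unfolding u_def v_def by blast
qed

definition c :: int where "c = fact (nat ((\<bar>d\<bar> + 2)\<^sup>2))"

lemma c_pos: "c > 0" by (simp add: c_def)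

lemma dvd_c:
  assumes "t \<in> {1..(\<bar>d\<bar> + 2)\<^sup>2}"
  shows "t dvd c"
proof -
  have "1 \<le> nat t" "nat t \<le> nat ((\<bar>d\<bar> + 2)\<^sup>2)" using assms by (simp_all add: nat_mono Suc_le_eq)
  hence "nat t dvd fact (nat ((\<bar>d\<bar> + 2)\<^sup>2))" by (rule dvd_fact)
  hence "int (nat t) dvd int (fact (nat ((\<bar>d\<bar> + 2)\<^sup>2)))" by (simp only: int_dvd_int_iff)
  thus ?thesis using assms unfolding c_def of_nat_fact by simp
qed

definition nrm :: "rat \<Rightarrow> rat \<Rightarrow> rat" where "nrm x y = x\<^sup>2 - of_int d * y\<^sup>2"

lemma qel_conj: "qel x y * qel x (- y) = qel (nrm x y) 0"
  by (simp add: qel_mult nrm_def power2_eq_square mult.assoc)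

lemma nrm_0_iff: "nrm x y = 0 \<longleftrightarrow> qel x y = 0"
proof -
  have "nrm x y = 0 \<longleftrightarrow> qel x y * qel x (- y) = 0"
    unfolding qel_conj by (simp add: qel_0_iff)
  thus ?thesis by (simp add: qel_0_iff)
qed

lemma nrm_mult: "nrm (x * x' + of_int d * y * y') (x * y' + y * x') = nrm x y * nrm x' y'"
  by (simp add: nrm_def power2_eq_square algebra_simps)

lemma exists_generator_approx:
  assumes I: "ideal I R" "I \<noteq> {0}"
  shows "\<exists>\<beta>\<in>I. \<beta> \<noteq> 0 \<and> (\<forall>\<alpha>\<in>I. \<exists>\<gamma>\<in>OK. of_int c * \<alpha> = \<beta> * \<gamma>)"
proof -
  define P where "P k \<longleftrightarrow> (\<exists>x y. qel x y \<in> I \<and> qel x y \<noteq> 0 \<and> of_nat k = \<bar>nrm x y\<bar>)" for k :: nat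
  have P: "\<exists>k. of_nat k = \<bar>nrm x y\<bar> \<and> P k" if "qel x y \<in> I" "qel x y \<noteq> 0" for x y
  proof -
    have "nrm x y \<in> \<int>" using idealD(1)[OF I(1) that(1)] unfolding OK_iff nrm_def by blast
    then obtain n where "nrm x y = of_int n" by (auto elim: Ints_cases)
    hence "of_nat (nat \<bar>n\<bar>) = \<bar>nrm x y\<bar>" by simp
    thus ?thesis using that unfolding P_def by blast
  qed
  obtain z where z: "z \<in> I" "z \<noteq> 0" using I idealD(2)[OF I(1)] by blast
  obtain x' y' where "z = qel x' y'" using idealD(1)[OF I(1) z(1)] by (rule OK_cases)
  hence "\<exists>k. P k" using P z by blast
  define k where "k = (LEAST k. P k)"
  have "P k" unfolding k_def using \<open>\<exists>k. P k\<close> by (rule LeastI_ex)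
  then obtain x y where xy: "qel x y \<in> I" "qel x y \<noteq> 0" "of_nat k = \<bar>nrm x y\<bar>"
    by (auto simp: P_def)
  have n0: "nrm x y \<noteq> 0" using xy nrm_0_iff by simp
  show ?thesis
  proof (rule bexI[of _ "qel x y"], intro conjI ballI)
    fix \<alpha> assume \<alpha>: "\<alpha> \<in> I"
    obtain a b where ab: "\<alpha> = qel a b" using idealD(1)[OF I(1) \<alpha>] by (rule OK_cases)
    define x1 where "x1 = (a * x - of_int d * b * y) / nrm x y"
    define y1 where "y1 = (b * x - a * y) / nrm x y"
    have x1y1: "x * x1 + of_int d * y * y1 = a" "x * y1 + y * x1 = b"
    proof -
      have nX: "nrm x y * x1 = a * x - of_int d * b * y" and nY: "nrm x y * y1 = b * x - a * y"
        using n0 by (simp_all add: x1_def y1_def)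
      have "nrm x y * (x * x1 + of_int d * y * y1) = x * (nrm x y * x1) + of_int d * y * (nrm x y * y1)"
        by (simp only: distrib_left mult_ac)
      also have "\<dots> = x * (a * x - of_int d * b * y) + of_int d * y * (b * x - a * y)"
        unfolding nX nY ..
      also have "\<dots> = nrm x y * a" by (simp add: nrm_def power2_eq_square algebra_simps)
      finally show "x * x1 + of_int d * y * y1 = a" using n0 by simp
      have "nrm x y * (x * y1 + y * x1) = x * (nrm x y * y1) + y * (nrm x y * x1)"
        by (simp only: distrib_left mult_ac)
      also have "\<dots> = x * (b * x - a * y) + y * (a * x - of_int d * b * y)"
        unfolding nX nY ..
      also have "\<dots> = nrm x y * b" by (simp add: nrm_def power2_eq_square algebra_simps)
      finally show "x * y1 + y * x1 = b" using n0 by simp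
    qed
    have \<alpha>eq: "\<alpha> = qel x y * qel x1 y1" by (simp add: ab qel_mult x1y1)
    obtain t p q where t: "t \<in> {1..(\<bar>d\<bar> + 2)\<^sup>2}"
      and less: "\<bar>nrm (of_int t * x1 - of_int p) (of_int t * y1 - of_int q)\<bar> < 1"
      using approx[of x1 y1] unfolding nrm_def by blast
    define \<omega> where "\<omega> = qel (of_int p) (of_int q)"
    have \<omega>: "\<omega> \<in> OK" unfolding \<omega>_def by (rule OK_ints)
    have tq: "of_int t = qel (of_int t) 0" by (simp add: qel_def)
    define \<delta> where "\<delta> = of_int t * \<alpha> - \<omega> * qel x y"
    have \<delta>I: "\<delta> \<in> I" unfolding \<delta>_def
      by (intro ideal_diff[OF I(1)] idealD(4)[OF I(1)] OK_of_int \<omega> \<alpha> xy)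
    have "\<delta> = qel x y * (of_int t * qel x1 y1 - \<omega>)" by (simp add: \<delta>_def \<alpha>eq algebra_simps)
    also have "of_int t * qel x1 y1 - \<omega> = qel (of_int t * x1 - of_int p) (of_int t * y1 - of_int q)"
      by (simp add: tq \<omega>_def qel_mult qel_diff)
    finally obtain x2 y2 where xy2: "\<delta> = qel x2 y2"
      "nrm x2 y2 = nrm x y * nrm (of_int t * x1 - of_int p) (of_int t * y1 - of_int q)"
      unfolding qel_mult nrm_mult[symmetric] by blast
    have "\<delta> = 0"
    proof (rule ccontr)
      assume "\<delta> \<noteq> 0"
      then obtain k' where k': "of_nat k' = \<bar>nrm x2 y2\<bar>" "P k'" using P \<delta>I xy2 by blast
      have "k \<le> k'" unfolding k_def using k'(2) by (rule Least_le)
      moreover have "\<bar>nrm x2 y2\<bar> < \<bar>nrm x y\<bar> * 1"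
        unfolding xy2 abs_mult using less n0 by (intro mult_strict_left_mono) auto
      hence "(of_nat k' :: rat) < of_nat k" using k' xy by simp
      ultimately show False by simp
    qed
    hence e: "of_int t * \<alpha> = \<omega> * qel x y" by (simp add: \<delta>_def)
    obtain r where r: "c = t * r" using dvd_c[OF t] by blast
    have "of_int c * \<alpha> = of_int r * (of_int t * \<alpha>)" by (simp add: r)
    also have "\<dots> = qel x y * (of_int r * \<omega>)" by (simp add: e)
    finally show "\<exists>\<gamma>\<in>OK. of_int c * \<alpha> = qel x y * \<gamma>" using OK_mult[OF OK_of_int \<omega>] by blast
  qed (use xy in auto)
qed

lemma nonzero_ideals_R: "I \<in> nonzero_ideals R \<longleftrightarrow> ideal I R \<and> I \<noteq> {0}"
  by (simp add: nonzero_ideals_def)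

lemma rel_iff: "(I, J) \<in> ideal_class_rel R \<longleftrightarrow> I \<in> nonzero_ideals R \<and> J \<in> nonzero_ideals R \<and>
   (\<exists>\<alpha> \<beta>. \<alpha> \<in> OK \<and> \<alpha> \<noteq> 0 \<and> \<beta> \<in> OK \<and> \<beta> \<noteq> 0 \<and> (\<lambda>x. \<alpha> * x) ` I = (\<lambda>x. \<beta> * x) ` J)"
  by (simp only: ideal_class_rel_def mem_Collect_eq split ring_of_integers_simps Bex_def Diff_iff
        singleton_iff conj_assoc ex_simps)

lemma relI:
  assumes "I \<in> nonzero_ideals R" "J \<in> nonzero_ideals R" "\<alpha> \<in> OK" "\<alpha> \<noteq> 0" "\<beta> \<in> OK" "\<beta> \<noteq> 0"
    "(\<lambda>x. \<alpha> * x) ` I = (\<lambda>x. \<beta> * x) ` J"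
  shows "(I, J) \<in> ideal_class_rel R"
  unfolding rel_iff by (intro conjI exI[of _ \<alpha>] exI[of _ \<beta>] assms)

lemma relE:
  assumes "(I, J) \<in> ideal_class_rel R"
  obtains \<alpha> \<beta> where "I \<in> nonzero_ideals R" "J \<in> nonzero_ideals R"
    "\<alpha> \<in> OK" "\<alpha> \<noteq> 0" "\<beta> \<in> OK" "\<beta> \<noteq> 0" "(\<lambda>x. \<alpha> * x) ` I = (\<lambda>x. \<beta> * x) ` J"
  using assms unfolding rel_iff by (elim conjE exE) (rule that)

lemma equiv_rel: "equiv (nonzero_ideals R) (ideal_class_rel R)"
proof (rule equivI)
  show "ideal_class_rel R \<subseteq> nonzero_ideals R \<times> nonzero_ideals R"
    by (auto elim: relE)
  show "refl_on (nonzero_ideals R) (ideal_class_rel R)"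
  proof (rule refl_onI)
    fix I assume "I \<in> nonzero_ideals R"
    thus "(I, I) \<in> ideal_class_rel R"
      by (intro relI[of I I 1 1] OK_01 refl one_neq_zero)
  qed
  show "sym (ideal_class_rel R)"
    by (rule symI, erule relE, rule relI) (assumption | erule sym)+
  show "trans (ideal_class_rel R)"
  proof (rule transI)
    fix I J K assume IJ: "(I, J) \<in> ideal_class_rel R" and JK: "(J, K) \<in> ideal_class_rel R"
    obtain \<alpha> \<beta> where 1: "I \<in> nonzero_ideals R" "\<alpha> \<in> OK" "\<alpha> \<noteq> 0" "\<beta> \<in> OK" "\<beta> \<noteq> 0"
      "(\<lambda>x. \<alpha> * x) ` I = (\<lambda>x. \<beta> * x) ` J" using IJ by (rule relE)
    obtain \<alpha>' \<beta>' where 2: "K \<in> nonzero_ideals R" "\<alpha>' \<in> OK" "\<alpha>' \<noteq> 0" "\<beta>' \<in> OK" "\<beta>' \<noteq> 0"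
      "(\<lambda>x. \<alpha>' * x) ` J = (\<lambda>x. \<beta>' * x) ` K" using JK by (rule relE)
    have "(\<lambda>x. (\<alpha>' * \<alpha>) * x) ` I = (\<lambda>x. \<alpha>' * x) ` (\<lambda>x. \<alpha> * x) ` I"
      by (simp add: image_image mult.assoc)
    also have "\<dots> = (\<lambda>x. \<beta> * x) ` (\<lambda>x. \<alpha>' * x) ` J"
      unfolding 1(6) by (simp add: image_image mult.left_commute)
    also have "\<dots> = (\<lambda>x. (\<beta> * \<beta>') * x) ` K"
      unfolding 2(6) by (simp add: image_image mult.assoc)
    finally show "(I, K) \<in> ideal_class_rel R"
      using 1 2 by (intro relI[of I K "\<alpha>' * \<alpha>" "\<beta> * \<beta>'"] OK_mult) simp_all
  qed
qed

lemma finite_ideals: "finite {J. ideal J R \<and> of_int c \<in> J}"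
proof -
  define D where "D = 2 * \<bar>d\<bar>"
  have D: "D > 0" using d_nz by (simp add: D_def)
  define T where "T = (\<lambda>(i :: int, j :: int). qel (of_int i / 2) (of_int j / of_int D)) ` ({0..<2 * c} \<times> {0..<c * D})"
  have T: "finite T" by (simp add: T_def)
  have red: "\<exists>w\<in>OK. z - w * of_int c \<in> T" if zOK: "z \<in> OK" for z
  proof -
    obtain x y where xy: "z = qel x y" "2 * x \<in> \<int>" "x\<^sup>2 - of_int d * y\<^sup>2 \<in> \<int>"
      using zOK by (rule OK_cases)
    have "D * D = 4 * d * d" by (simp add: D_def)
    hence "(of_int (D * D) :: rat) * y\<^sup>2 = of_int (4 * d * d) * y\<^sup>2" by (simp only:)
    hence "(of_int D * y)\<^sup>2 = of_int d * ((2 * x) * (2 * x) - of_int 4 * (x\<^sup>2 - of_int d * y\<^sup>2))"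
      by (simp add: power2_eq_square algebra_simps)
    also have "\<dots> \<in> \<int>" 
      by (rule Ints_mult[OF Ints_of_int Ints_diff[OF Ints_mult[OF xy(2,2)] Ints_mult[OF Ints_of_int xy(3)]]])
    finally have "of_int D * y \<in> \<int>" by (rule rat_square_Ints)
    then obtain j where j: "of_int D * y = of_int j" by (rule Ints_cases)
    obtain i where i: "2 * x = of_int i" using xy(2) by (rule Ints_cases)
    define w where "w = qel (of_int (i div (2 * c))) (of_int (j div (c * D)))"
    have w: "w \<in> OK" unfolding w_def by (rule OK_ints)
    have ci: "(of_int c :: complex) = qel (of_int c) 0" by (simp add: qel_def)
    have "z - w * of_int c = qel (x - of_int (i div (2 * c)) * of_int c) (y - of_int (j div (c * D)) * of_int c)"
      unfolding xy(1) w_def ci qel_mult qel_diff by simp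
    also have "x - of_int (i div (2 * c)) * of_int c = of_int (i mod (2 * c)) / 2"
    proof -
      have "x - of_int q * of_int c = of_int r / 2" if "i = 2 * c * q + r" for q r
        using i unfolding that by (simp add: field_simps)
      thus ?thesis using mult_div_mod_eq[of "2 * c" i] by metis
    qed
    also have "y - of_int (j div (c * D)) * of_int c = of_int (j mod (c * D)) / of_int D"
    proof -
      have "y - of_int q * of_int c = of_int r / of_int D" if "j = c * D * q + r" for q r
      proof -
        have "of_int D * (y - of_int q * of_int c) = of_int r"
          using j unfolding that by (simp add: algebra_simps)
        thus ?thesis using D by (simp add: nonzero_eq_divide_eq mult.commute)
      qed
      thus ?thesis using mult_div_mod_eq[of "c * D" j] by metis
    qed
    also have "qel (of_int (i mod (2 * c)) / 2) (of_int (j mod (c * D)) / of_int D) \<in> T"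
      unfolding T_def using c_pos D by (intro image_eqI[of _ _ "(i mod (2 * c), j mod (c * D))"]) auto
    finally show ?thesis using w by blast
  qed
  have sub: "J1 \<subseteq> J2" if J1: "ideal J1 R" "of_int c \<in> J1" and J2: "ideal J2 R" "of_int c \<in> J2"
      and eq: "J1 \<inter> T = J2 \<inter> T" for J1 J2
  proof
    fix z assume z: "z \<in> J1"
    obtain w where w: "w \<in> OK" "z - w * of_int c \<in> T" using red[OF idealD(1)[OF J1(1) z]] by blast
    have "z - w * of_int c \<in> J1" by (intro ideal_diff[OF J1(1)] idealD(4)[OF J1(1)] z w J1)
    hence "z - w * of_int c \<in> J2" using eq w by blast
    from idealD(3)[OF J2(1) this idealD(4)[OF J2(1) w(1) J2(2)]] show "z \<in> J2" by simp
  qed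
  have "inj_on (\<lambda>J. J \<inter> T) {J. ideal J R \<and> of_int c \<in> J}"
    by (rule inj_onI) (use sub in blast)
  moreover have "finite ((\<lambda>J. J \<inter> T) ` {J. ideal J R \<and> of_int c \<in> J})"
    by (rule finite_subset[of _ "Pow T"]) (use T in auto)
  ultimately show ?thesis by (rule finite_imageD[rotated])
qed

lemma ideal_class_rep:
  assumes "I \<in> nonzero_ideals R"
  shows "\<exists>J. ideal J R \<and> of_int c \<in> J \<and> (I, J) \<in> ideal_class_rel R"
proof -
  have I: "ideal I R" "I \<noteq> {0}" using assms by (simp_all add: nonzero_ideals_R)
  obtain \<beta> where \<beta>: "\<beta> \<in> I" "\<beta> \<noteq> 0" "\<And>\<alpha>. \<alpha> \<in> I \<Longrightarrow> \<exists>\<gamma>\<in>OK. of_int c * \<alpha> = \<beta> * \<gamma>"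
    using exists_generator_approx[OF I] by blast
  have \<beta>OK: "\<beta> \<in> OK" using idealD(1)[OF I(1) \<beta>(1)] .
  define J where "J = {\<gamma> \<in> OK. \<exists>\<alpha>\<in>I. of_int c * \<alpha> = \<beta> * \<gamma>}"
  have "ideal J R"
  proof (rule idealR)
    show "J \<subseteq> OK" by (auto simp: J_def)
    show "0 \<in> J" using OK_01 idealD(2)[OF I(1)] unfolding J_def by force
  next
    fix x y assume "x \<in> J" "y \<in> J"
    then obtain u v where h: "x \<in> OK" "y \<in> OK" "u \<in> I" "v \<in> I" "of_int c * u = \<beta> * x" "of_int c * v = \<beta> * y"
      unfolding J_def by blast
    have "of_int c * (u + v) = \<beta> * (x + y)" using h by (simp add: distrib_left)
    thus "x + y \<in> J" using OK_add[OF h(1,2)] idealD(3)[OF I(1) h(3,4)] unfolding J_def by blast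
  next
    fix x y assume x: "x \<in> OK" and "y \<in> J"
    then obtain v where h: "y \<in> OK" "v \<in> I" "of_int c * v = \<beta> * y"
      unfolding J_def by blast
    have "of_int c * (x * v) = \<beta> * (x * y)" using h by (simp add: mult.left_commute)
    thus "x * y \<in> J" using OK_mult[OF x h(1)] idealD(4)[OF I(1) x h(2)] unfolding J_def by blast
  qed
  moreover have cJ: "of_int c \<in> J" unfolding J_def using OK_of_int \<beta>(1) by (auto simp: mult.commute)
  moreover have c0: "of_int c \<noteq> (0 :: complex)" using c_pos by simp
  moreover have "(\<lambda>x. of_int c * x) ` I = (\<lambda>x. \<beta> * x) ` J"
  proof (intro equalityI subsetI)
    fix z assume "z \<in> (\<lambda>x. of_int c * x) ` I"
    then obtain \<alpha> where a: "\<alpha> \<in> I" "z = of_int c * \<alpha>" by blast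
    then obtain \<gamma> where "\<gamma> \<in> OK" "of_int c * \<alpha> = \<beta> * \<gamma>" using \<beta>(3) by blast
    thus "z \<in> (\<lambda>x. \<beta> * x) ` J" using a unfolding J_def by blast
  next
    fix z assume "z \<in> (\<lambda>x. \<beta> * x) ` J"
    then obtain \<gamma> \<alpha> where "z = \<beta> * \<gamma>" "\<alpha> \<in> I" "of_int c * \<alpha> = \<beta> * \<gamma>" unfolding J_def by blast
    hence "z = of_int c * \<alpha>" by simp
    thus "z \<in> (\<lambda>x. of_int c * x) ` I" using \<open>\<alpha> \<in> I\<close> by blast
  qed
  moreover have "J \<in> nonzero_ideals R" using calculation(1-3) by (auto simp: nonzero_ideals_R)
  ultimately show ?thesis using assms OK_of_int \<beta>OK \<beta>(2) by (intro exI[of _ J] conjI relI[of I J "of_int c" \<beta>])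
qed

lemma finite_class_group: "finite (carrier (class_group R))"
proof -
  have "carrier (class_group R) \<subseteq> (\<lambda>J. ideal_class_rel R `` {J}) ` {J. ideal J R \<and> of_int c \<in> J}"
  proof
    fix A assume "A \<in> carrier (class_group R)"
    then obtain I where I: "I \<in> nonzero_ideals R" "A = ideal_class_rel R `` {I}"
      by (auto simp: class_group_def elim: quotientE)
    obtain J where J: "ideal J R" "of_int c \<in> J" "(I, J) \<in> ideal_class_rel R"
      using ideal_class_rep[OF I(1)] by blast
    have "A = ideal_class_rel R `` {J}" using equiv_class_eq[OF equiv_rel J(3)] I(2) by simp
    thus "A \<in> (\<lambda>J. ideal_class_rel R `` {J}) ` {J. ideal J R \<and> of_int c \<in> J}" using J by blast
  qed
  thus ?thesis using finite_ideals by (blast intro: finite_subset)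
qed

lemma class_number_pos: "class_number (quadratic_field d) > 0"
proof -
  have "ideal OK R" by (rule idealR) (use OK_01 OK_add OK_mult in blast)+
  moreover have "OK \<noteq> {0}" using OK_01(2) by (metis singletonD zero_neq_one)
  ultimately have "OK \<in> nonzero_ideals R" unfolding nonzero_ideals_R by blast
  hence "ideal_class_rel R `` {OK} \<in> carrier (class_group R)"
    by (simp only: class_group_def partial_object.select_convs quotientI)
  thus ?thesis using finite_class_group unfolding class_number_def Coset.order_def
    by (auto simp: card_gt_0_iff)
qed

end

lemma radicand_nonsquare:
  fixes a b :: int and n :: nat
  assumes "n > 1" "[a = 1] (mod 3)" "[b = 0] (mod 3)"
  shows "nonsquare (3 * (4 * a ^ (3 * n) - b ^ (2 * n)))"
proof
  have p: "prime (3 :: int)" by simp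
  show "\<nexists>k. 3 * (4 * a ^ (3 * n) - b ^ (2 * n)) = k\<^sup>2"
  proof
    assume "\<exists>k. 3 * (4 * a ^ (3 * n) - b ^ (2 * n)) = k\<^sup>2"
    then obtain k where k: "3 * (4 * a ^ (3 * n) - b ^ (2 * n)) = k\<^sup>2" by blast
    have "3 dvd k\<^sup>2" unfolding k[symmetric] by simp
    hence "3 dvd k" using p prime_dvd_power by blast
    then obtain l where "k = 3 * l" by blast
    with k have e: "4 * a ^ (3 * n) - b ^ (2 * n) = 3 * l\<^sup>2" by (simp add: power2_eq_square)
    have "3 dvd b" using assms(3) by (simp add: cong_0_iff)
    hence "3 dvd b ^ (2 * n)" using assms(1) by (intro dvd_power_le[of 3 b 1 "2 * n", simplified]) auto
    moreover have "4 * a ^ (3 * n) = 3 * l\<^sup>2 + b ^ (2 * n)" using e by simp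
    ultimately have "3 dvd 4 * a ^ (3 * n)" by simp
    hence "3 dvd a ^ (3 * n)" using p prime_dvd_mult_iff[OF p, of 4] by auto
    hence "3 dvd a" using p prime_dvd_power by blast
    thus False using assms(2) by (auto simp: cong_def)
  qed
qed

end

theory Submission
  imports Defs "HOL-Number_Theory.Residue_Primitive_Roots"
begin

text \<open>
Let \<open>A = a ^ n\<close>, \<open>B = b ^ n\<close> and \<open>D = 3 * (4 * A ^ 3 - B\<^sup>2)\<close>. As \<open>D\<close> is \<open>1\<close> modulo \<open>8\<close>, the prime \<open>2\<close> splits
in the quadratic field \<open>K\<close> of \<open>D\<close>. The polynomial \<open>X ^ 3 - 3 * A * X - B\<close> of discriminant \<open>9 * D\<close> generates an
unramified cyclic cubic extension of \<open>K\<close> and is irreducible modulo \<open>2\<close>, so the primes above \<open>2\<close> should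
have order divisible by \<open>3\<close> in the class group. Class field theory is avoided as follows.

Multiplication by a prime above \<open>2\<close> permutes the ideal classes. A cycle of length \<open>j\<close> makes the \<open>j\<close>-th
power of the prime principal, hence gives an odd \<open>x\<close> and a rational \<open>y = u / m\<close> with \<open>x\<^sup>2 - D * y\<^sup>2 = \<plusminus> 4 * 2 ^ j\<close>.
The Eisenstein integer \<open>\<mu> = (m * x + B * u * sqrt (- 3)) / 2\<close> then has norm \<open>\<plusminus> 2 ^ j * m\<^sup>2 + 3 * A ^ 3 * u\<^sup>2\<close>, so
that \<open>2 ^ j * m\<^sup>2\<close> and \<open>3 * u\<^sup>2\<close> agree modulo \<open>\<mu>\<close> up to cubes. By cubic reciprocity the cubic residue symbols
modulo \<open>\<mu>\<close> of \<open>u\<close>, \<open>m\<close> and \<open>3\<close> are trivial (for \<open>3\<close> because \<open>9\<close> divides \<open>B\<close>), but that of \<open>2\<close> is not (because \<open>B * u\<close> is odd).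
Hence \<open>3\<close> divides \<open>j\<close>, that is, every cycle length, and so the number of classes.
\<close>

section \<open>Congruences\<close>

text \<open>Reading the divisibility off cycle lengths confines all ideal multiplication to the two
  primes above 2; each undoes the other up to the factor 2, which is why multiplication by one of
  them is injective on classes. As \<open>D\<close> may have square factors, an integer of
  \<open>K\<close> can have a rational coefficient at sqrt \<open>D\<close>; the square of its
  denominator \<open>m\<close> divides \<open>D\<close>. As \<open>D\<close> may be positive, a
  generator can have negative norm, hence the sign. The symbols of \<open>u\<close> and
  \<open>m\<close> are trivial because a prime dividing one of them removes one of the two terms of
  \<mu>. What remains of \<mu> is, up to a rational factor, rational or a multiple of sqrt (- 3),
  and Fermat's theorem evaluates its power in the reciprocity formula. The condition
  \<open>n > 1\<close> gives 9 as a divisor of \<open>B\<close>. This brings \<mu> modulo 9 into the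
  shape for which the supplementary law yields the value 1 at 3.\<close>

text \<open>The library's \<open>cong\<close> needs a euclidean structure, which polynomials over the Eisenstein
  integers do not have.\<close>

definition dcong :: "'a::comm_ring_1 \<Rightarrow> 'a \<Rightarrow> 'a \<Rightarrow> bool" where
  "dcong m x y \<longleftrightarrow> m dvd x - y"

lemma dcong_refl [simp]: "dcong m x x"
  by (simp add: dcong_def)

lemma dcong_sym: "dcong m x y \<Longrightarrow> dcong m y x"
  unfolding dcong_def by (metis dvd_minus_iff minus_diff_eq)

lemma dcong_trans [trans]: "dcong m x y \<Longrightarrow> dcong m y z \<Longrightarrow> dcong m x z"
  unfolding dcong_def by (metis diff_add_cancel add_diff_eq dvd_add)

lemma dcong_add: "dcong m x y \<Longrightarrow> dcong m x' y' \<Longrightarrow> dcong m (x + x') (y + y')"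
  unfolding dcong_def by (metis add_diff_add dvd_add)

lemma dcong_uminus: "dcong m x y \<Longrightarrow> dcong m (- x) (- y)"
  unfolding dcong_def by (metis minus_diff_minus dvd_minus_iff)

lemma dcong_diff: "dcong m x y \<Longrightarrow> dcong m x' y' \<Longrightarrow> dcong m (x - x') (y - y')"
  using dcong_add[OF _ dcong_uminus] by fastforce

lemma dcong_mult:
  assumes "dcong m x y" "dcong m x' y'"
  shows "dcong m (x * x') (y * y')"
proof -
  have "x * x' - y * y' = (x - y) * x' + y * (x' - y')" by (simp add: algebra_simps)
  thus ?thesis using assms by (simp add: dcong_def)
qed

lemma dcong_scale: "dcong m x y \<Longrightarrow> dcong m (z * x) (z * y)"
  by (rule dcong_mult) auto

lemma dcong_power: "dcong m x y \<Longrightarrow> dcong m (x ^ k) (y ^ k)"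
  by (induction k) (auto intro: dcong_mult)

lemma dcong_sum: "(\<And>i. i \<in> S \<Longrightarrow> dcong m (f i) (g i)) \<Longrightarrow> dcong m (sum f S) (sum g S)"
  by (induction S rule: infinite_finite_induct) (auto intro: dcong_add)

lemma dcong_0_iff: "dcong m x 0 \<longleftrightarrow> m dvd x"
  by (simp add: dcong_def)

lemma dcong_int_iff: "dcong m x y \<longleftrightarrow> [x = y] (mod m)" for m :: int
  by (simp add: dcong_def cong_iff_dvd_diff)

lemma dcong_add_power_prime:
  fixes x y :: "'a::comm_ring_1"
  assumes q: "prime (q::nat)"
  shows "dcong (of_nat q) ((x + y) ^ q) (x ^ q + y ^ q)"
proof -
  have q0: "q > 0" using q prime_gt_0_nat by blast
  have "(x + y) ^ q = (\<Sum>k\<le>q. of_nat (q choose k) * x ^ k * y ^ (q - k))"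
    by (rule binomial_ring)
  also have "{..q} = insert 0 (insert q {1..<q})" using q0 by auto
  also have "(\<Sum>k\<in>\<dots>. of_nat (q choose k) * x ^ k * y ^ (q - k))
     = x ^ q + y ^ q + (\<Sum>k\<in>{1..<q}. of_nat (q choose k) * x ^ k * y ^ (q - k))"
    using q0 by (simp add: algebra_simps)
  also have "dcong (of_nat q) \<dots> (x ^ q + y ^ q + (\<Sum>k\<in>{1..<q}. 0))"
  proof (intro dcong_add dcong_refl dcong_sum)
    fix k assume "k \<in> {1..<q}"
    hence "q dvd (q choose k)" using q by (intro dvd_choose_prime) auto
    hence "of_nat q dvd (of_nat (q choose k) :: 'a)" by (metis dvd_def of_nat_mult)
    thus "dcong (of_nat q) (of_nat (q choose k) * x ^ k * y ^ (q - k)) 0"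
      by (simp add: dcong_0_iff)
  qed
  finally show ?thesis by simp
qed

lemma dcong_sum_power_prime:
  fixes f :: "'b \<Rightarrow> 'a::comm_ring_1"
  assumes q: "prime (q::nat)"
  shows "dcong (of_nat q) (sum f S ^ q) (\<Sum>i\<in>S. f i ^ q)"
proof (induction S rule: infinite_finite_induct)
  case (insert i S)
  have "dcong (of_nat q) ((f i + sum f S) ^ q) (f i ^ q + sum f S ^ q)"
    by (rule dcong_add_power_prime[OF q])
  also have "dcong (of_nat q) \<dots> (f i ^ q + (\<Sum>i\<in>S. f i ^ q))"
    by (intro dcong_add dcong_refl insert)
  finally show ?case using insert by simp
qed (use prime_gt_0_nat[OF q] in \<open>simp_all add: power_0_left\<close>)

text \<open>The square of a prime \<open>q\<close> other than 3 is 1 modulo 3, so two rounds of the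
  Frobenius map fix cube roots of unity, whether \<open>q\<close> is 1 or 2 modulo 3.\<close>

lemma dcong_sum_power_prime_square:
  fixes f :: "'b \<Rightarrow> 'a::comm_ring_1"
  assumes q: "prime (q::nat)"
  shows "dcong (of_nat q) (sum f S ^ q\<^sup>2) (\<Sum>i\<in>S. f i ^ q\<^sup>2)"
proof -
  have "dcong (of_nat q) ((sum f S ^ q) ^ q) ((\<Sum>i\<in>S. f i ^ q) ^ q)"
    by (intro dcong_power dcong_sum_power_prime q)
  also have "dcong (of_nat q) \<dots> (\<Sum>i\<in>S. (f i ^ q) ^ q)"
    by (rule dcong_sum_power_prime[OF q])
  finally show ?thesis by (simp add: power2_eq_square power_mult)
qed

lemma fermat_int:
  assumes "prime q" "\<not> int q dvd a" "k = (q - 1) * l"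
  shows "dcong (int q) (a ^ k) 1"
proof -
  define b where "b = nat (a mod int q)"
  have b: "int b = a mod int q" using prime_gt_0_nat[OF assms(1)] by (simp add: b_def)
  hence ab: "[a = int b] (mod int q)" by (simp add: cong_def)
  have "\<not> q dvd b"
    using assms(2) b by (metis dvd_mod_iff int_dvd_int_iff dvd_refl)
  hence "[b ^ (q - 1) = 1] (mod q)" by (rule fermat_theorem[OF assms(1)])
  hence "[int (b ^ (q - 1)) = int 1] (mod int q)" by (simp only: cong_int_iff)
  hence "[int b ^ (q - 1) = 1] (mod int q)" by simp
  hence "[a ^ (q - 1) = 1] (mod int q)" using cong_trans[OF cong_pow[OF ab]] by blast
  hence "dcong (int q) ((a ^ (q - 1)) ^ l) (1 ^ l)" by (intro dcong_power) (simp add: dcong_int_iff)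
  thus ?thesis by (simp add: assms(3) power_mult)
qed

lemma square_minus_1_div_3:
  assumes "prime (q::nat)" "q \<noteq> 3"
  shows "q\<^sup>2 - 1 = 3 * ((q\<^sup>2 - 1) div 3)"
proof -
  have "\<not> 3 dvd q" using assms primes_dvd_imp_eq[of 3 q] by auto
  hence "q mod 3 = 1 \<or> q mod 3 = 2" by presburger
  hence "q\<^sup>2 mod 3 = 1" by (auto simp: power2_eq_square mod_mult_eq[of q 3 q, symmetric])
  thus ?thesis by (metis div_mult_mod_eq add_diff_cancel_right' nonzero_mult_div_cancel_left zero_neq_numeral mult.commute)
qed

section \<open>Eisenstein integers\<close>

text \<open>\<open>Eis a b\<close> stands for \<open>a + b \<omega>\<close> with \<open>\<omega>\<close> a primitive cube root of unity.\<close>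

datatype eisenstein = Eis (re: int) (om: int)

lemma eisenstein_eq_iff: "x = y \<longleftrightarrow> re x = re y \<and> om x = om y"
  by (cases x; cases y) auto

definition eis_norm :: "eisenstein \<Rightarrow> int" where
  "eis_norm z = (re z)\<^sup>2 - re z * om z + (om z)\<^sup>2"

instantiation eisenstein :: comm_ring_1
begin
definition "0 = Eis 0 0"
definition "1 = Eis 1 0"
definition "x + y = Eis (re x + re y) (om x + om y)"
definition "- x = Eis (- re x) (- om x)"
definition "x - y = Eis (re x - re y) (om x - om y)"
definition "x * y = Eis (re x * re y - om x * om y) (re x * om y + om x * re y - om x * om y)"
instance
  by standard (simp_all add: zero_eisenstein_def one_eisenstein_def plus_eisenstein_def
    uminus_eisenstein_def minus_eisenstein_def times_eisenstein_def algebra_simps)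
end

lemma eisenstein_simps [simp]:
  "re 0 = 0" "om 0 = 0" "re 1 = 1" "om 1 = 0"
  "re (x + y) = re x + re y" "om (x + y) = om x + om y"
  "re (- x) = - re x" "om (- x) = - om x"
  "re (x - y) = re x - re y" "om (x - y) = om x - om y"
  "re (x * y) = re x * re y - om x * om y"
  "om (x * y) = re x * om y + om x * re y - om x * om y"
  by (simp_all add: zero_eisenstein_def one_eisenstein_def plus_eisenstein_def
    uminus_eisenstein_def minus_eisenstein_def times_eisenstein_def)

lemma eis_norm_mult: "eis_norm (x * y) = eis_norm x * eis_norm y"
  by (simp add: eis_norm_def power2_eq_square algebra_simps)

lemma eis_norm_4: "4 * eis_norm z = (2 * re z - om z)\<^sup>2 + 3 * (om z)\<^sup>2"
  by (simp add: eis_norm_def power2_eq_square algebra_simps)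

lemma eis_norm_nonneg: "eis_norm z \<ge> 0"
  using eis_norm_4[of z] by (smt (verit) zero_le_power2)

lemma eis_norm_eq_0_iff [simp]: "eis_norm z = 0 \<longleftrightarrow> z = 0"
proof
  assume "eis_norm z = 0"
  with eis_norm_4[of z] have "(2 * re z - om z)\<^sup>2 + 3 * (om z)\<^sup>2 = 0" by simp
  hence "(2 * re z - om z)\<^sup>2 = 0" "(om z)\<^sup>2 = 0"
    by (smt (verit) zero_le_power2)+
  thus "z = 0" by (simp add: eisenstein_eq_iff)
qed (simp add: eis_norm_def)

instance eisenstein :: idom
proof
  fix x y :: eisenstein
  assume "x \<noteq> 0" "y \<noteq> 0"
  hence "eis_norm (x * y) \<noteq> 0" unfolding eis_norm_mult by simp
  thus "x * y \<noteq> 0" by simp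
qed

lemma of_nat_eisenstein [simp]: "re (of_nat n) = int n" "om (of_nat n) = 0"
  by (induction n) auto

lemma of_int_eisenstein [simp]: "re (of_int n) = n" "om (of_int n) = 0"
  by (cases n; simp)+

lemma numeral_eisenstein [simp]: "re (numeral n) = numeral n" "om (numeral n) = 0"
  using of_int_eisenstein[of "numeral n"] by simp_all

instance eisenstein :: ring_char_0
  by standard (metis (mono_tags) injI of_nat_eisenstein(1) of_nat_eq_iff)

lemma of_int_dvd_eisenstein_iff: "of_int n dvd z \<longleftrightarrow> n dvd re z \<and> n dvd om z"
proof
  assume "n dvd re z \<and> n dvd om z"
  then obtain k l where "re z = n * k" "om z = n * l" by (auto simp: dvd_def)
  hence "z = of_int n * Eis k l" by (simp add: eisenstein_eq_iff)
  thus "of_int n dvd z" by simp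
qed (auto simp: dvd_def)

lemma of_int_dvd_of_int_eisenstein_iff:
  "(of_int m :: eisenstein) dvd of_int n \<longleftrightarrow> m dvd n"
  by (simp add: of_int_dvd_eisenstein_iff)

definition \<omega> :: eisenstein where "\<omega> = Eis 0 1"

lemma \<omega>_simps [simp]: "re \<omega> = 0" "om \<omega> = 1"
  by (simp_all add: \<omega>_def)

lemma \<omega>_square: "\<omega> * \<omega> = - 1 - \<omega>"
  by (simp add: eisenstein_eq_iff)

definition eis_cnj :: "eisenstein \<Rightarrow> eisenstein" where
  "eis_cnj z = Eis (re z - om z) (- om z)"

lemma eis_cnj_sel [simp]: "re (eis_cnj z) = re z - om z" "om (eis_cnj z) = - om z"
  by (simp_all add: eis_cnj_def)

lemma eis_cnj_simps [simp]:
  "eis_cnj (x + y) = eis_cnj x + eis_cnj y"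
  "eis_cnj (x - y) = eis_cnj x - eis_cnj y"
  "eis_cnj (- x) = - eis_cnj x"
  "eis_cnj (x * y) = eis_cnj x * eis_cnj y"
  "eis_cnj (eis_cnj x) = x"
  "eis_cnj 0 = 0" "eis_cnj 1 = 1" "eis_cnj (of_int n) = of_int n"
  "eis_cnj \<omega> = - 1 - \<omega>"
  by (simp_all add: eisenstein_eq_iff algebra_simps)

lemma eis_cnj_sum: "eis_cnj (sum f S) = (\<Sum>i\<in>S. eis_cnj (f i))"
  by (induction S rule: infinite_finite_induct) auto

lemma mult_eis_cnj: "z * eis_cnj z = of_int (eis_norm z)"
  by (simp add: eisenstein_eq_iff eis_norm_def power2_eq_square algebra_simps)

definition cubic_units :: "eisenstein set" where
  "cubic_units = {1, \<omega>, - 1 - \<omega>}"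

lemma cubic_units_mult: "x \<in> cubic_units \<Longrightarrow> y \<in> cubic_units \<Longrightarrow> x * y \<in> cubic_units"
  by (auto simp: cubic_units_def eisenstein_eq_iff)

lemma cubic_units_cube: "x \<in> cubic_units \<Longrightarrow> x ^ 3 = 1"
  by (auto simp: cubic_units_def eisenstein_eq_iff power3_eq_cube)

lemma cubic_units_cnj: "x \<in> cubic_units \<Longrightarrow> eis_cnj x = x * x"
  by (auto simp: cubic_units_def eisenstein_eq_iff)

text \<open>For the other two units, \<open>1 - x\<close> has a coordinate 1 or -1. This turns
  congruences between symbol values into equalities.\<close>

lemma cubic_units_dvd_1_diff:
  assumes "x \<in> cubic_units" "of_int q dvd 1 - x" "\<bar>q\<bar> > 1"
  shows "x = 1"
  using assms by (auto simp: cubic_units_def of_int_dvd_eisenstein_iff zdvd1_eq)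

section \<open>Cubic residue characters\<close>

text \<open>The choice of \<open>w\<close> selects one of the two primes above \<open>p\<close>, namely the kernel of the reduction
  map \<open>red\<close> below, which sends \<open>\<omega>\<close> to \<open>w\<close>.\<close>

locale eisenstein_prime =
  fixes p :: nat and w :: int
  assumes prime_p: "prime p" and p_neq_3: "p \<noteq> 3" and w_root: "int p dvd w\<^sup>2 + w + 1"
begin

lemma prime_int_p: "prime (int p)" using prime_p by simp

lemma p_gt_1: "p > 1" using prime_gt_1_nat[OF prime_p] .

lemma not_p_dvd_1: "\<not> int p dvd 1" using p_gt_1 by auto

lemma not_p_dvd_3: "\<not> int p dvd 3"
proof
  assume "int p dvd 3"
  hence "p dvd 3" using int_dvd_int_iff[of p 3] by simp
  thus False using prime_p p_neq_3 primes_dvd_imp_eq[of p 3] by simp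
qed

lemma not_p_dvd_w: "\<not> int p dvd w"
proof
  assume a: "int p dvd w"
  have "1 = (w\<^sup>2 + w + 1) - w * (w + 1)" by (simp add: power2_eq_square algebra_simps)
  also have "int p dvd \<dots>" using a w_root by (intro dvd_diff) auto
  finally show False using not_p_dvd_1 by simp
qed

lemma not_p_dvd_w1: "\<not> int p dvd w + 1"
proof
  assume a: "int p dvd w + 1"
  have "1 = (w\<^sup>2 + w + 1) - w * (w + 1)" by (simp add: power2_eq_square algebra_simps)
  also have "int p dvd \<dots>" using a w_root by (intro dvd_diff) auto
  finally show False using not_p_dvd_1 by simp
qed

lemma not_p_dvd_w_minus_1: "\<not> int p dvd w - 1"
proof
  assume a: "int p dvd w - 1"
  have "3 = (w\<^sup>2 + w + 1) - (w - 1) * (w + 2)" by (simp add: power2_eq_square algebra_simps)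
  also have "int p dvd \<dots>" using a w_root by (intro dvd_diff) auto
  finally show False using not_p_dvd_3 by simp
qed

lemma not_p_dvd_w2: "\<not> int p dvd w + 2"
proof
  assume a: "int p dvd w + 2"
  have "3 = (w\<^sup>2 + w + 1) - (w - 1) * (w + 2)" by (simp add: power2_eq_square algebra_simps)
  also have "int p dvd \<dots>" using a w_root by (intro dvd_diff) auto
  finally show False using not_p_dvd_3 by simp
qed

lemma not_p_dvd_2w1: "\<not> int p dvd 2 * w + 1"
proof
  assume a: "int p dvd 2 * w + 1"
  have "3 = 4 * (w\<^sup>2 + w + 1) - (2 * w + 1) * (2 * w + 1)" by (simp add: power2_eq_square algebra_simps)
  also have "int p dvd \<dots>" using a w_root by (intro dvd_diff dvd_mult)
  finally show False using not_p_dvd_3 by simp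
qed

definition e :: nat where "e = (p - 1) div 3"

text \<open>A root \<open>w\<close> of \<open>X^2 + X + 1\<close> modulo \<open>p\<close> has order
  exactly 3, as it is not 1 when \<open>p\<close> differs from 3; this order divides
  \<open>p - 1\<close>.\<close>

lemma p_eq: "p = 3 * e + 1"
proof -
  have "[w ^ 3 = 1] (mod int p)"
  proof -
    have "w ^ 3 - 1 = (w - 1) * (w\<^sup>2 + w + 1)"
      by (simp add: power2_eq_square power3_eq_cube algebra_simps)
    thus ?thesis using w_root by (simp add: cong_iff_dvd_diff)
  qed
  define v where "v = nat (w mod int p)"
  have v: "int v = w mod int p" using p_gt_1 by (simp add: v_def)
  have "[int v = w] (mod int p)" by (simp add: v cong_def)
  hence "[int (v ^ 3) = 1] (mod int p)"
    using \<open>[w ^ 3 = 1] (mod int p)\<close> cong_pow[of "int v" w "int p" 3] cong_trans by simp blast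
  hence v3: "[v ^ 3 = 1] (mod p)" using cong_int_iff[of "v ^ 3" 1 p] by simp
  have v1: "\<not> [v ^ 1 = 1] (mod p)"
  proof
    assume "[v ^ 1 = 1] (mod p)"
    hence "[int v = 1] (mod int p)" using cong_int_iff[of v 1 p] by simp
    hence "[w = 1] (mod int p)" using \<open>[int v = w] (mod int p)\<close> cong_sym cong_trans by blast
    thus False using not_p_dvd_w_minus_1 by (simp add: cong_iff_dvd_diff)
  qed
  have "\<not> p dvd v"
    using not_p_dvd_w v by (metis dvd_mod_iff int_dvd_int_iff dvd_refl)
  hence cop: "coprime p v" using prime_p prime_imp_coprime by blast
  have "ord p v dvd 3" using v3 by (simp only: ord_divides)
  moreover have "ord p v \<noteq> 1" using v1 by (metis ord_divides dvd_refl)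
  moreover have "prime (3::nat)" by simp
  ultimately have "ord p v = 3" by (metis prime_nat_iff)
  moreover have "ord p v dvd p - 1"
    using order_divides_totient[OF cop] totient_prime[OF prime_p] by simp
  ultimately have "3 dvd p - 1" by simp
  thus ?thesis using p_gt_1 by (simp add: e_def)
qed

lemma p_minus_1: "p - 1 = 3 * e" using p_eq by linarith

lemma e_pos: "e > 0" using p_eq p_gt_1 by linarith

definition red :: "eisenstein \<Rightarrow> int" where "red z = re z + om z * w"

lemma red_mult: "dcong (int p) (red (x * y)) (red x * red y)"
proof -
  have "red (x * y) - red x * red y = - (om x * om y) * (w\<^sup>2 + w + 1)"
    by (simp add: red_def power2_eq_square algebra_simps)
  thus ?thesis using w_root by (simp add: dcong_def)
qed

lemma red_sum: "red (sum f S) = (\<Sum>i\<in>S. red (f i))"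
  by (induction S rule: infinite_finite_induct) (auto simp: red_def algebra_simps)

text \<open>The pairwise differences of 0, 1, \<open>w\<close> and \<open>- 1 - w\<close> are, up to
  sign, the six numbers shown above to be prime to \<open>p\<close>. A character value is therefore
  determined by its reduction.\<close>

lemma red_inj:
  assumes "x \<in> insert 0 cubic_units" "y \<in> insert 0 cubic_units" "dcong (int p) (red x) (red y)"
  shows "x = y"
proof -
  have 1: "int p dvd - 1 - w \<longleftrightarrow> int p dvd w + 1"
    using dvd_minus_iff[of "int p" "w + 1"] by (simp add: algebra_simps)
  have 2: "int p dvd 1 - w \<longleftrightarrow> int p dvd w - 1" by (rule dvd_diff_commute)
  have 3: "int p dvd - 2 - w \<longleftrightarrow> int p dvd w + 2"
  proof -
    have "- 2 - w = - (w + 2)" by simp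
    thus ?thesis by (simp only: dvd_minus_iff)
  qed
  have 4: "int p dvd - 1 - w - w \<longleftrightarrow> int p dvd 2 * w + 1"
    using dvd_minus_iff[of "int p" "2 * w + 1"] by (simp add: algebra_simps)
  have "x = 0 \<or> x = 1 \<or> x = \<omega> \<or> x = - 1 - \<omega>" "y = 0 \<or> y = 1 \<or> y = \<omega> \<or> y = - 1 - \<omega>"
    using assms by (simp_all add: cubic_units_def)
  moreover have "int p dvd red x - red y" "int p dvd red y - red x"
    using assms(3) dcong_sym unfolding dcong_def by blast+
  ultimately show ?thesis
    using not_p_dvd_1 not_p_dvd_w not_p_dvd_w1 not_p_dvd_w_minus_1 not_p_dvd_w2 not_p_dvd_2w1 1 2 3 4
    by (elim disjE; hypsubst; simp add: red_def algebra_simps)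
qed

text \<open>If \<open>p\<close> does not divide \<open>a\<close>, Fermat makes \<open>a ^ e\<close>
  a root of \<open>X^3 - 1\<close>, which modulo \<open>p\<close> has just the roots 1,
  \<open>w\<close> and \<open>- 1 - w\<close>, the images of the cubic units. Multiples of
  \<open>p\<close> get the value 0.\<close>

lemma chi_exists: "\<exists>z\<in>insert 0 cubic_units. dcong (int p) (red z) (a ^ e)"
proof (cases "int p dvd a")
  case True
  hence "int p dvd a ^ e" by (rule dvd_trans) (use e_pos in \<open>simp add: dvd_power\<close>)
  thus ?thesis by (intro bexI[of _ 0]) (auto simp: red_def dcong_def)
next
  case False
  define t where "t = a ^ e"
  have "dcong (int p) (a ^ (p - 1)) 1" by (rule fermat_int[OF prime_p False, of _ 1]) simp
  also have "a ^ (p - 1) = t ^ 3" unfolding p_minus_1 t_def by (simp add: mult.commute flip: power_mult)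
  finally have "int p dvd t ^ 3 - 1" by (simp add: dcong_def)
  moreover have "t ^ 3 - 1 = (t - 1) * ((t - w) * (t + 1 + w)) + (t - 1) * (w\<^sup>2 + w + 1)"
    by (simp add: power2_eq_square power3_eq_cube algebra_simps)
  ultimately have "int p dvd (t - 1) * ((t - w) * (t + 1 + w))"
    using w_root by (simp add: dvd_add_left_iff)
  hence "int p dvd t - 1 \<or> int p dvd t - w \<or> int p dvd t + 1 + w"
    using prime_dvd_mult_iff[OF prime_int_p] by blast
  thus ?thesis
  proof (elim disjE)
    assume "int p dvd t - 1"
    thus ?thesis unfolding t_def[symmetric]
      by (intro bexI[of _ 1] dcong_sym[of _ t]) (auto simp: red_def dcong_def cubic_units_def)
  next
    assume "int p dvd t - w"
    thus ?thesis unfolding t_def[symmetric]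
      by (intro bexI[of _ \<omega>] dcong_sym[of _ t]) (auto simp: red_def dcong_def cubic_units_def)
  next
    assume "int p dvd t + 1 + w"
    thus ?thesis unfolding t_def[symmetric]
      by (intro bexI[of _ "- 1 - \<omega>"] dcong_sym[of _ t])
         (auto simp: red_def dcong_def cubic_units_def algebra_simps)
  qed
qed

definition chi :: "int \<Rightarrow> eisenstein" where
  "chi a = (SOME z. z \<in> insert 0 cubic_units \<and> dcong (int p) (red z) (a ^ e))"

lemma chi_in: "chi a \<in> insert 0 cubic_units" and red_chi: "dcong (int p) (red (chi a)) (a ^ e)"
proof -
  have "\<exists>z. z \<in> insert 0 cubic_units \<and> dcong (int p) (red z) (a ^ e)"
    using chi_exists by blast
  from someI_ex[OF this] show "chi a \<in> insert 0 cubic_units" "dcong (int p) (red (chi a)) (a ^ e)"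
    unfolding chi_def by auto
qed

lemma chi_eqI:
  assumes "z \<in> insert 0 cubic_units" "dcong (int p) (red z) (a ^ e)"
  shows "chi a = z"
  by (rule red_inj[OF chi_in assms(1)])
     (rule dcong_trans[OF red_chi dcong_sym[OF assms(2)]])

lemma chi_mult: "chi (a * b) = chi a * chi b"
proof (rule chi_eqI)
  show "chi a * chi b \<in> insert 0 cubic_units"
    using chi_in[of a] chi_in[of b] cubic_units_mult by auto
  have "dcong (int p) (red (chi a * chi b)) (red (chi a) * red (chi b))" by (rule red_mult)
  also have "dcong (int p) \<dots> (a ^ e * b ^ e)" by (intro dcong_mult red_chi)
  finally show "dcong (int p) (red (chi a * chi b)) ((a * b) ^ e)" by (simp add: power_mult_distrib)
qed

lemma chi_cong: "dcong (int p) a b \<Longrightarrow> chi a = chi b"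
  by (rule chi_eqI[OF chi_in dcong_trans[OF red_chi dcong_power[OF dcong_sym]]])

lemma chi_mod [simp]: "chi (a mod int p) = chi a"
  by (rule chi_cong) (simp add: dcong_int_iff cong_def)

lemma chi_1 [simp]: "chi 1 = 1"
  by (rule chi_eqI) (auto simp: cubic_units_def red_def)

lemma chi_eq_0_iff: "chi a = 0 \<longleftrightarrow> int p dvd a"
proof
  assume "chi a = 0"
  hence "int p dvd a ^ e" using red_chi[of a] by (simp add: red_def dcong_def)
  thus "int p dvd a" using prime_int_p prime_dvd_power by blast
next
  assume "int p dvd a"
  hence "int p dvd a ^ e" by (rule dvd_trans) (use e_pos in \<open>simp add: dvd_power\<close>)
  thus "chi a = 0" by (intro chi_eqI) (auto simp: red_def dcong_def)
qed

lemma chi_0 [simp]: "chi 0 = 0" by (simp add: chi_eq_0_iff)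

lemma chi_unit: "\<not> int p dvd a \<Longrightarrow> chi a \<in> cubic_units"
  using chi_in[of a] chi_eq_0_iff[of a] by auto

lemma chi_minus [simp]: "chi (- a) = chi a"
proof -
  have "chi (- 1) \<in> cubic_units" using not_p_dvd_1 by (intro chi_unit) auto
  moreover have "chi (- 1) * chi (- 1) = 1" by (simp flip: chi_mult)
  ultimately have "chi (- 1) = 1" by (auto simp: cubic_units_def eisenstein_eq_iff)
  thus ?thesis using chi_mult[of "- 1" a] by simp
qed

definition chib :: "int \<Rightarrow> eisenstein" where "chib a = eis_cnj (chi a)"

lemma chib_eq: "chib a = chi a * chi a"
  using chi_in[of a] cubic_units_cnj by (auto simp: chib_def)

lemma chi_chib: "\<not> int p dvd a \<Longrightarrow> chi a * chib a = 1"
  using cubic_units_cube[OF chi_unit[of a]] by (simp add: chib_eq power3_eq_cube mult.assoc)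

lemma chib_mult: "chib (a * b) = chib a * chib b"
  by (simp add: chib_def chi_mult)

lemma chib_minus [simp]: "chib (- a) = chib a"
  by (simp add: chib_def)

lemma chib_mod [simp]: "chib (a mod int p) = chib a"
  by (simp add: chib_def)

section \<open>Sums over the residues modulo \<open>p\<close>\<close>

lemma sum_shift:
  assumes "\<And>a. f (a mod int p) = f a"
  shows "(\<Sum>a\<in>{0..<int p}. f (a + c)) = (\<Sum>a\<in>{0..<int p}. f a)"
proof -
  have "(\<Sum>a\<in>{0..<int p}. f (a + c)) = (\<Sum>a\<in>{0..<int p}. f ((a + c) mod int p))"
    by (simp add: assms)
  also have "\<dots> = (\<Sum>a\<in>{0..<int p}. f a)"
  proof (rule sum.reindex_bij_witness[of _ "\<lambda>a. (a - c) mod int p" "\<lambda>a. (a + c) mod int p"])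
  qed (use p_gt_1 in \<open>auto simp: mod_simps\<close>)
  finally show ?thesis .
qed

lemma sum_scale:
  assumes "\<And>a. f (a mod int p) = f a" "\<not> int p dvd c"
  shows "(\<Sum>a\<in>{0..<int p}. f (c * a)) = (\<Sum>a\<in>{0..<int p}. f a)"
proof -
  have "coprime c (int p)" using assms prime_int_p prime_imp_coprime coprime_commute by blast
  then obtain d where "[c * d = 1] (mod int p)" using cong_solve_coprime_int by blast
  hence d: "(c * d) mod int p = 1" using p_gt_1 by (simp add: cong_def)
  have d1: "(c * (d * a)) mod int p = a mod int p" for a
    using d by (metis mod_mult_left_eq mult.assoc mult.left_neutral)
  have d2: "(d * (c * a)) mod int p = a mod int p" for a
    using d1 by (simp add: mult.left_commute)
  have "(\<Sum>a\<in>{0..<int p}. f (c * a)) = (\<Sum>a\<in>{0..<int p}. f ((c * a) mod int p))"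
    by (simp add: assms)
  also have "\<dots> = (\<Sum>a\<in>{0..<int p}. f a)"
  proof (rule sum.reindex_bij_witness[of _ "\<lambda>a. (d * a) mod int p" "\<lambda>a. (c * a) mod int p"])
  qed (use p_gt_1 in \<open>auto simp: mod_simps d1 d2\<close>)
  finally show ?thesis .
qed

lemma primroot_exists: "\<exists>g::int. \<not> int p dvd g \<and> (\<forall>k. 0 < k \<and> k < p - 1 \<longrightarrow> \<not> int p dvd g ^ k - 1)"
proof -
  obtain g where g: "residue_primroot p g"
    using prime_primitive_root_exists[OF p_gt_1] prime_p by blast
  hence "coprime p g" and o: "ord p g = p - 1"
    using totient_prime[OF prime_p] by (auto simp: residue_primroot_def)
  have "\<not> int p dvd int g ^ k - 1" if "0 < k" "k < p - 1" for k
  proof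
    assume "int p dvd int g ^ k - 1"
    hence "[int (g ^ k) = int 1] (mod int p)" by (simp add: cong_iff_dvd_diff)
    hence "[g ^ k = 1] (mod p)" by (simp only: cong_int_iff)
    hence "ord p g dvd k" by (simp only: ord_divides)
    thus False using that o by (auto dest: dvd_imp_le)
  qed
  moreover have "\<not> int p dvd int g"
    using \<open>coprime p g\<close> p_gt_1 by (metis coprime_absorb_left int_dvd_int_iff nat_dvd_1_iff_1 less_irrefl)
  ultimately show ?thesis by blast
qed

text \<open>Scaling by a primitive root \<open>g\<close> multiplies the sum by \<open>chi g\<close>,
  which is not 1 because the order of \<open>g\<close> exceeds \<open>e\<close>.\<close>

lemma sum_chi: "(\<Sum>a\<in>{0..<int p}. chi a) = 0"
proof -
  obtain g where g: "\<not> int p dvd g" "\<And>k. 0 < k \<and> k < p - 1 \<Longrightarrow> \<not> int p dvd g ^ k - 1"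
    using primroot_exists by blast
  have "chi g \<noteq> 1"
  proof
    assume "chi g = 1"
    hence "dcong (int p) 1 (g ^ e)" using red_chi[of g] by (simp add: red_def)
    hence "int p dvd g ^ e - 1" using dcong_sym dcong_def by blast
    thus False using g(2)[of e] e_pos p_minus_1 by simp
  qed
  moreover have "(\<Sum>a\<in>{0..<int p}. chi (g * a)) = (\<Sum>a\<in>{0..<int p}. chi a)"
    by (rule sum_scale) (use g in auto)
  hence "(chi g - 1) * (\<Sum>a\<in>{0..<int p}. chi a) = 0"
    unfolding chi_mult sum_distrib_left[symmetric] by (simp add: left_diff_distrib)
  ultimately show ?thesis by simp
qed

lemma sum_chib: "(\<Sum>a\<in>{0..<int p}. chib a) = 0"
  unfolding chib_def using sum_chi by (simp flip: eis_cnj_sum)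

lemma power_sum_dvd:
  assumes "0 < k" "k < p - 1"
  shows "int p dvd (\<Sum>a\<in>{0..<int p}. a ^ k)"
proof -
  obtain g where g: "\<not> int p dvd g" "\<And>k. 0 < k \<and> k < p - 1 \<Longrightarrow> \<not> int p dvd g ^ k - 1"
    using primroot_exists by blast
  define f where "f a = (a ^ k) mod int p" for a :: int
  have f: "dcong (int p) (f a) (a ^ k)" for a
    by (simp add: f_def dcong_int_iff cong_def)
  have "dcong (int p) (\<Sum>a\<in>{0..<int p}. (g * a) ^ k) (\<Sum>a\<in>{0..<int p}. f (g * a))"
    by (intro dcong_sum dcong_sym[OF f])
  also have "(\<Sum>a\<in>{0..<int p}. f (g * a)) = (\<Sum>a\<in>{0..<int p}. f a)"
    by (rule sum_scale) (use g in \<open>auto simp: f_def power_mod\<close>)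
  also have "dcong (int p) \<dots> (\<Sum>a\<in>{0..<int p}. a ^ k)"
    by (intro dcong_sum f)
  finally have "int p dvd (g ^ k - 1) * (\<Sum>a\<in>{0..<int p}. a ^ k)"
    by (simp add: dcong_def power_mult_distrib left_diff_distrib flip: sum_distrib_left)
  thus ?thesis using g(2)[of k] assms prime_dvd_mult_iff[OF prime_int_p] by blast
qed

text \<open>The Jacobi sum of \<open>chi\<close> with itself. Its norm turns out to be
  \<open>p\<close>, so it serves as an explicit generator of the prime selected by
  \<open>w\<close>.\<close>

definition J :: eisenstein where "J = (\<Sum>a\<in>{0..<int p}. chi a * chi (1 - a))"

text \<open>Under \<open>red\<close> the summands become \<open>a ^ e * (1 - a) ^ e\<close>, a
  polynomial whose exponents lie between \<open>e\<close> and \<open>2 * e\<close>, strictly between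
  0 and \<open>p - 1\<close>; such power sums vanish modulo \<open>p\<close>.\<close>

lemma red_J: "int p dvd red J"
proof -
  have "dcong (int p) (red J) (\<Sum>a\<in>{0..<int p}. a ^ e * (1 - a) ^ e)"
    unfolding J_def red_sum
    by (intro dcong_sum dcong_trans[OF red_mult] dcong_mult red_chi)
  also have "(\<Sum>a\<in>{0..<int p}. a ^ e * (1 - a) ^ e)
     = (\<Sum>a\<in>{0..<int p}. \<Sum>k\<le>e. of_nat (e choose k) * (-1) ^ k * a ^ (e + k))"
  proof (rule sum.cong[OF refl])
    fix a :: int
    have "(1 - a) ^ e = (- a + 1) ^ e" by simp
    also have "\<dots> = (\<Sum>k\<le>e. of_nat (e choose k) * (- a) ^ k * 1 ^ (e - k))" by (rule binomial_ring)
    finally show "a ^ e * (1 - a) ^ e = (\<Sum>k\<le>e. of_nat (e choose k) * (-1) ^ k * a ^ (e + k))"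
      by (simp add: sum_distrib_left power_minus[of a] power_add algebra_simps)
  qed
  also have "\<dots> = (\<Sum>k\<le>e. of_nat (e choose k) * (-1) ^ k * (\<Sum>a\<in>{0..<int p}. a ^ (e + k)))"
    by (subst sum.swap) (simp add: sum_distrib_left)
  also have "dcong (int p) \<dots> (\<Sum>k\<le>e. 0)"
    by (intro dcong_sum) (use power_sum_dvd e_pos p_minus_1 in \<open>auto simp: dcong_0_iff intro!: dvd_mult\<close>)
  finally show ?thesis by (simp add: dcong_0_iff)
qed

end

section \<open>Gauss and Jacobi sums\<close>

lemma monom_sum: "monom (sum f S) k = (\<Sum>i\<in>S. monom (f i) k)"
  by (induction S rule: infinite_finite_induct) (auto simp flip: add_monom)

lemma smult_sum_right: "smult c (sum f S) = (\<Sum>i\<in>S. smult c (f i))"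
  by (induction S rule: infinite_finite_induct) (auto simp: smult_add_right)

context eisenstein_prime
begin

text \<open>Gauss sums live in the group ring of the integers modulo \<open>p\<close>, realised as polynomials modulo
  \<open>\<Phi> = X^p - 1\<close>; \<open>coset_coeff\<close> is the coefficient of the group element \<open>1\<close>.\<close>

definition \<Phi> :: "eisenstein poly" where "\<Phi> = monom 1 p - 1"

definition coset_coeff :: "eisenstein poly \<Rightarrow> eisenstein" where
  "coset_coeff f = (\<Sum>i\<in>{i. i \<le> degree f \<and> i mod p = 1}. coeff f i)"

lemma coset_coeff_eq:
  assumes "degree f \<le> N"
  shows "coset_coeff f = (\<Sum>i\<in>{i. i \<le> N \<and> i mod p = 1}. coeff f i)"
  unfolding coset_coeff_def
  by (rule sum.mono_neutral_left) (use assms in \<open>auto intro: le_degree\<close>)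

lemma coset_coeff_add: "coset_coeff (f + g) = coset_coeff f + coset_coeff g"
proof -
  define N where "N = max (degree f) (degree g)"
  have "degree (f + g) \<le> N" "degree f \<le> N" "degree g \<le> N"
    by (auto simp: N_def degree_add_le_max)
  thus ?thesis by (simp add: coset_coeff_eq sum.distrib)
qed

lemma coset_coeff_0 [simp]: "coset_coeff 0 = 0"
  by (simp add: coset_coeff_def)

lemma coset_coeff_smult: "coset_coeff (smult c f) = c * coset_coeff f"
  using degree_smult_le[of c f] by (simp add: coset_coeff_eq[of _ "degree f"] sum_distrib_left)

lemma coset_coeff_minus: "coset_coeff (- f) = - coset_coeff f"
  using coset_coeff_smult[of "- 1" f] by simp

lemma coset_coeff_diff: "coset_coeff (f - g) = coset_coeff f - coset_coeff g"
  using coset_coeff_add[of f "- g"] by (simp add: coset_coeff_minus)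

lemma coset_coeff_sum: "coset_coeff (sum f S) = (\<Sum>i\<in>S. coset_coeff (f i))"
  by (induction S rule: infinite_finite_induct) (auto simp: coset_coeff_add)

lemma coset_coeff_monom: "coset_coeff (monom c k) = (if k mod p = 1 then c else 0)"
proof -
  have "coset_coeff (monom c k) = (\<Sum>i\<in>{i. i \<le> k \<and> i mod p = 1}. if k = i then c else 0)"
    by (subst coset_coeff_eq[OF degree_monom_le]) simp
  thus ?thesis by (simp add: sum.delta)
qed

lemma coset_coeff_cong:
  assumes "dcong \<Phi> f g"
  shows "coset_coeff f = coset_coeff g"
proof -
  obtain h where h: "f - g = \<Phi> * h" using assms by (auto simp: dcong_def)
  have "coset_coeff (\<Phi> * h) = 0"
  proof -
    have "\<Phi> * h = \<Phi> * (\<Sum>i\<le>degree h. monom (coeff h i) i)" by (simp add: poly_as_sum_of_monoms)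
    also have "\<dots> = (\<Sum>i\<le>degree h. monom (coeff h i) (p + i) - monom (coeff h i) i)"
      by (simp add: \<Phi>_def sum_distrib_left left_diff_distrib mult_monom)
    finally show ?thesis by (simp add: coset_coeff_sum coset_coeff_diff coset_coeff_monom)
  qed
  thus ?thesis using h coset_coeff_diff[of f g] by simp
qed

lemma coset_coeff_dcong_of_nat:
  assumes "dcong (of_nat q) f g"
  shows "dcong (of_nat q) (coset_coeff f) (coset_coeff g)"
proof -
  obtain h where h: "f - g = of_nat q * h" using assms by (auto simp: dcong_def)
  hence "f - g = smult (of_nat q) h" by (simp add: of_nat_poly)
  hence "coset_coeff f - coset_coeff g = of_nat q * coset_coeff h"
    by (simp add: coset_coeff_smult flip: coset_coeff_diff)
  thus ?thesis by (simp add: dcong_def)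
qed

lemma monom_dcong_mod: "dcong \<Phi> (monom c k) (monom c (k mod p))"
proof -
  have "dcong \<Phi> (monom c (p * m + r)) (monom c r)" for m r
  proof (induction m)
    case (Suc m)
    have "monom c (p * Suc m + r) - monom c (p * m + r) = \<Phi> * monom c (p * m + r)"
      by (simp add: \<Phi>_def left_diff_distrib mult_monom algebra_simps)
    hence "dcong \<Phi> (monom c (p * Suc m + r)) (monom c (p * m + r))" by (simp add: dcong_def)
    thus ?case using Suc dcong_trans by blast
  qed simp
  from this[of "k div p" "k mod p"] show ?thesis by simp
qed

definition gs :: "(int \<Rightarrow> eisenstein) \<Rightarrow> eisenstein poly" where
  "gs f = (\<Sum>a\<in>{0..<int p}. monom (f a) (nat a))"

definition conv :: "(int \<Rightarrow> eisenstein) \<Rightarrow> (int \<Rightarrow> eisenstein) \<Rightarrow> int \<Rightarrow> eisenstein" where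
  "conv f g c = (\<Sum>a\<in>{0..<int p}. f a * g (c - a))"

lemma gs_cong: "(\<And>a. f a = g a) \<Longrightarrow> gs f = gs g"
  by (simp add: gs_def)

lemma gs_smult: "gs (\<lambda>a. c * f a) = smult c (gs f)"
  by (simp add: gs_def smult_sum_right smult_monom)

lemma gs_add: "gs (\<lambda>a. f a + g a) = gs f + gs g"
  by (simp add: gs_def sum.distrib flip: add_monom)

lemma gs_mult:
  assumes g: "\<And>a. g (a mod int p) = g a"
  shows "dcong \<Phi> (gs f * gs g) (gs (conv f g))"
proof -
  have "gs f * gs g = (\<Sum>a\<in>{0..<int p}. \<Sum>b\<in>{0..<int p}. monom (f a * g b) (nat a + nat b))"
    by (simp add: gs_def sum_product mult_monom)
  also have "dcong \<Phi> \<dots> (\<Sum>a\<in>{0..<int p}. \<Sum>b\<in>{0..<int p}. monom (f a * g b) ((nat a + nat b) mod p))"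
    by (intro dcong_sum monom_dcong_mod)
  also have "(\<Sum>a\<in>{0..<int p}. \<Sum>b\<in>{0..<int p}. monom (f a * g b) ((nat a + nat b) mod p))
     = (\<Sum>a\<in>{0..<int p}. \<Sum>c\<in>{0..<int p}. monom (f a * g (c - a)) (nat c))"
  proof (rule sum.cong[OF refl])
    fix a assume a: "a \<in> {0..<int p}"
    define h where "h c = monom (f a * g (c - a)) (nat (c mod int p))" for c
    have "g (c mod int p - a) = g (c - a)" for c
      by (metis g mod_diff_left_eq)
    hence per: "h (c mod int p) = h c" for c by (simp add: h_def)
    have "(\<Sum>b\<in>{0..<int p}. monom (f a * g b) ((nat a + nat b) mod p)) = (\<Sum>b\<in>{0..<int p}. h (b + a))"
    proof (rule sum.cong[OF refl])
      fix b assume b: "b \<in> {0..<int p}"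
      have "nat ((b + a) mod int p) = (nat a + nat b) mod p"
        using a b by (simp add: nat_mod_distrib nat_add_distrib add.commute)
      thus "monom (f a * g b) ((nat a + nat b) mod p) = h (b + a)" by (simp add: h_def)
    qed
    also have "\<dots> = (\<Sum>c\<in>{0..<int p}. h c)" using per by (rule sum_shift)
    finally show "(\<Sum>b\<in>{0..<int p}. monom (f a * g b) ((nat a + nat b) mod p))
      = (\<Sum>c\<in>{0..<int p}. monom (f a * g (c - a)) (nat c))" by (simp add: h_def)
  qed
  also have "\<dots> = gs (conv f g)"
    by (subst sum.swap) (simp add: gs_def conv_def monom_sum)
  finally show ?thesis .
qed

text \<open>The Frobenius map moves the coefficient at \<open>a\<close> to \<open>m * a\<close>. The
  one that arrives at the group element 1 sits at the inverse of \<open>m\<close>.\<close>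

lemma coset_coeff_gs_scale:
  assumes "b \<in> {0..<int p}" "(int m * b) mod int p = 1"
  shows "coset_coeff (\<Sum>a\<in>{0..<int p}. monom (f a) (m * nat a)) = f b"
proof -
  have iff: "(m * nat a) mod p = 1 \<longleftrightarrow> a = b" if a: "a \<in> {0..<int p}" for a
  proof
    assume "(m * nat a) mod p = 1"
    hence "int ((m * nat a) mod p) = 1" by simp
    hence 1: "(int m * a) mod int p = 1" using a by (simp add: zmod_int)
    have "a mod int p = (a * ((int m * b) mod int p)) mod int p" using assms by simp
    also have "\<dots> = (((int m * a) mod int p) * b) mod int p" by (simp add: mod_simps algebra_simps)
    also have "\<dots> = b mod int p" by (simp add: 1)
    finally show "a = b" using a assms by simp
  next
    assume "a = b"
    hence "int ((m * nat a) mod p) = 1" using a assms by (simp add: zmod_int)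
    thus "(m * nat a) mod p = 1" by simp
  qed
  have "coset_coeff (\<Sum>a\<in>{0..<int p}. monom (f a) (m * nat a))
     = (\<Sum>a\<in>{0..<int p}. if (m * nat a) mod p = 1 then f a else 0)"
    by (simp add: coset_coeff_sum coset_coeff_monom)
  also have "\<dots> = (\<Sum>a\<in>{0..<int p}. if a = b then f a else 0)"
    using iff by (intro sum.cong) auto
  also have "\<dots> = f b" using assms(1) by simp
  finally show ?thesis .
qed

lemma coset_coeff_gs [simp]: "coset_coeff (gs f) = f 1"
  using coset_coeff_gs_scale[of 1 1 f] p_gt_1 by (simp add: gs_def)

lemma inverse_mod_exists:
  assumes "\<not> int p dvd m"
  obtains b where "b \<in> {0..<int p}" "(m * b) mod int p = 1"
proof -
  have "coprime m (int p)" using assms prime_int_p prime_imp_coprime coprime_commute by blast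
  then obtain d where "[m * d = 1] (mod int p)" using cong_solve_coprime_int by blast
  hence "(m * (d mod int p)) mod int p = 1" using p_gt_1 by (simp add: cong_def mod_simps)
  thus ?thesis using p_gt_1 by (intro that[of "d mod int p"]) auto
qed

section \<open>Products of the Gauss sums of the character and of its conjugate\<close>

definition gchi where "gchi = gs chi"
definition gchib where "gchib = gs chib"

text \<open>Substituting \<open>c * a\<close> for \<open>a\<close> pulls out the square of
  \<open>chi c\<close>, which is \<open>chib c\<close>. If \<open>p\<close> divides
  \<open>c\<close>, what is left is the vanishing sum of \<open>chib\<close>.\<close>

lemma conv_chi_chi: "conv chi chi c = J * chib c"
proof (cases "int p dvd c")
  case True
  have "conv chi chi c = (\<Sum>a\<in>{0..<int p}. chib a)"
  proof -
    have "chi (c - a) = chi a" for a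
    proof -
      have "chi (c - a) = chi (- a)" using True by (intro chi_cong) (simp add: dcong_def)
      thus ?thesis by simp
    qed
    thus ?thesis by (simp add: conv_def chib_eq)
  qed
  also have "\<dots> = 0" by (rule sum_chib)
  finally show ?thesis using True chi_eq_0_iff[of c] by (simp add: chib_def)
next
  case False
  define f where "f a = chi a * chi (c - a)" for a
  have per: "f (a mod int p) = f a" for a
  proof -
    have "chi (c - a mod int p) = chi (c - a)" by (metis chi_mod mod_diff_right_eq)
    thus ?thesis by (simp add: f_def)
  qed
  have "conv chi chi c = (\<Sum>a\<in>{0..<int p}. f a)" by (simp add: conv_def f_def)
  also have "\<dots> = (\<Sum>a\<in>{0..<int p}. f (c * a))" by (rule sum_scale[symmetric]) (use per False in auto)
  also have "\<dots> = (\<Sum>a\<in>{0..<int p}. chib c * (chi a * chi (1 - a)))"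
  proof (rule sum.cong[OF refl])
    fix a
    have "c - c * a = c * (1 - a)" by (simp add: right_diff_distrib)
    thus "f (c * a) = chib c * (chi a * chi (1 - a))"
      by (simp only: f_def chi_mult chib_eq mult_ac)
  qed
  finally show ?thesis by (simp add: J_def sum_distrib_left mult.commute)
qed

lemma conv_chib_chib: "conv chib chib c = eis_cnj J * chi c"
proof -
  have "conv chib chib c = eis_cnj (conv chi chi c)"
    by (simp add: conv_def chib_def eis_cnj_sum)
  thus ?thesis by (simp add: conv_chi_chi chib_def)
qed

lemma conv_one_chi: "conv (\<lambda>_. 1) chi c = 0"
proof -
  have "conv (\<lambda>_. 1) chi c = (\<Sum>a\<in>{0..<int p}. chi (a + (- c)))"
    unfolding conv_def using chi_minus[of "c - _"] by simp
  also have "\<dots> = (\<Sum>a\<in>{0..<int p}. chi a)" by (rule sum_shift) simp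
  finally show ?thesis by (simp add: sum_chi)
qed

lemma conv_one_chib: "conv (\<lambda>_. 1) chib c = 0"
proof -
  have "conv (\<lambda>_. 1) chib c = eis_cnj (conv (\<lambda>_. 1) chi c)"
    by (simp add: conv_def chib_def eis_cnj_sum)
  thus ?thesis by (simp add: conv_one_chi)
qed

text \<open>Scaling makes the convolution constant away from the multiples of \<open>p\<close>,
  where it is \<open>p - 1\<close>. Its total over all residues is 0, which forces the constant to
  be -1.\<close>

lemma conv_chi_chib: "conv chi chib c = (if int p dvd c then of_nat p else 0) - 1"
proof -
  define h where "h = conv chi chib"
  have h0: "h c = of_nat p - 1" if c: "int p dvd c" for c
  proof -
    have *: "chib (c - a) = chib a" for a
    proof -
      have "chib (c - a) = chib (- a)" unfolding chib_def
        using c by (intro arg_cong[of _ _ eis_cnj] chi_cong) (simp add: dcong_def)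
      thus ?thesis by simp
    qed
    have "h c = (\<Sum>a\<in>{0..<int p}. chi a * chib a)" by (simp add: h_def conv_def *)
    also have "\<dots> = (\<Sum>a\<in>{0..<int p}. if a = 0 then 0 else 1)"
      by (rule sum.cong[OF refl]) (auto intro!: chi_chib dest: zdvd_imp_le)
    also have "\<dots> = (\<Sum>a\<in>{0..<int p}. 1 - (if a = 0 then 1 else 0))"
      by (rule sum.cong) auto
    also have "\<dots> = of_nat p - 1"
      using p_gt_1 by (subst sum_subtractf) simp
    finally show ?thesis .
  qed
  have h1: "h c = h 1" if c: "\<not> int p dvd c" for c
  proof -
    define f where "f a = chi a * chib (c - a)" for a
    have per: "f (a mod int p) = f a" for a
    proof -
      have "chib (c - a mod int p) = chib (c - a)" by (metis chib_mod mod_diff_right_eq)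
      thus ?thesis by (simp add: f_def)
    qed
    have "h c = (\<Sum>a\<in>{0..<int p}. f a)" by (simp add: h_def conv_def f_def)
    also have "\<dots> = (\<Sum>a\<in>{0..<int p}. f (c * a))" by (rule sum_scale[symmetric]) (use per c in auto)
    also have "\<dots> = (\<Sum>a\<in>{0..<int p}. chi a * chib (1 - a))"
    proof (rule sum.cong[OF refl])
      fix a
      have "c - c * a = c * (1 - a)" by (simp add: right_diff_distrib)
      hence "f (c * a) = (chi c * chib c) * (chi a * chib (1 - a))"
        by (simp only: f_def chi_mult chib_mult mult_ac)
      thus "f (c * a) = chi a * chib (1 - a)" using chi_chib[OF c] by simp
    qed
    finally show ?thesis by (simp add: h_def conv_def)
  qed
  have total: "(\<Sum>c\<in>{0..<int p}. h c) = 0"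
  proof -
    have "(\<Sum>c\<in>{0..<int p}. h c) = (\<Sum>a\<in>{0..<int p}. chi a * (\<Sum>c\<in>{0..<int p}. chib (c + - a)))"
      unfolding h_def conv_def by (subst sum.swap) (simp add: sum_distrib_left)
    also have "\<dots> = (\<Sum>a\<in>{0..<int p}. chi a * (\<Sum>c\<in>{0..<int p}. chib c))"
      by (intro sum.cong refl arg_cong2[of _ _ _ _ "(*)"] sum_shift) simp
    finally show ?thesis by (simp add: sum_chib)
  qed
  have "{0..<int p} = insert 0 {1..<int p}" using p_gt_1 by auto
  hence "(\<Sum>c\<in>{0..<int p}. h c) = h 0 + (\<Sum>c\<in>{1..<int p}. h c)" by simp
  also have "(\<Sum>c\<in>{1..<int p}. h c) = (\<Sum>c\<in>{1..<int p}. h 1)"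
    by (intro sum.cong refl h1) (auto dest: zdvd_imp_le)
  also have "\<dots> = of_nat (nat (int p - 1)) * h 1" by simp
  also have "nat (int p - 1) = p - 1" by linarith
  finally have "of_nat p - 1 + of_nat (p - 1) * h 1 = 0" using total h0[of 0] by simp
  hence "of_nat (p - 1) * (1 + h 1) = 0" using p_gt_1 by (simp add: of_nat_diff algebra_simps)
  hence "1 + h 1 = 0" using p_gt_1 by (simp add: of_nat_diff)
  hence "h 1 = - 1" by (metis add_eq_0_iff)
  thus ?thesis using h0[of c] h1[of c] by (auto simp: h_def)
qed

lemma gchi_square: "dcong \<Phi> (gchi * gchi) (smult J gchib)"
  using gs_mult[of chi chi] gs_cong[OF conv_chi_chi] by (simp add: gchi_def gchib_def gs_smult)

lemma gchib_square: "dcong \<Phi> (gchib * gchib) (smult (eis_cnj J) gchi)"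
  using gs_mult[of chib chib] gs_cong[OF conv_chib_chib] by (simp add: gchi_def gchib_def gs_smult)

text \<open>The sum of all group elements. Modulo \<open>X^p - 1\<close> it does not vanish, as it
  would modulo the cyclotomic polynomial, and has to be carried along until a Gauss sum annihilates
  it.\<close>

definition gone where "gone = gs (\<lambda>_. 1)"

lemma gone_gchi: "dcong \<Phi> (gone * gchi) 0"
  using gs_mult[of chi "\<lambda>_. 1"] gs_cong[OF conv_one_chi] by (simp add: gchi_def gone_def gs_def)

lemma gone_gchib: "dcong \<Phi> (gone * gchib) 0"
  using gs_mult[of chib "\<lambda>_. 1"] gs_cong[OF conv_one_chib] by (simp add: gchib_def gone_def gs_def)

lemma gchi_gchib: "dcong \<Phi> (gchi * gchib) ([:of_nat p:] - gone)"
proof -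
  have "dcong \<Phi> (gchi * gchib) (gs (conv chi chib))"
    unfolding gchi_def gchib_def by (rule gs_mult) simp
  also have "gs (conv chi chib) = (\<Sum>a\<in>{0..<int p}. (if a = 0 then monom (of_nat p) 0 else 0) - monom 1 (nat a))"
    unfolding gs_def conv_chi_chib
    by (rule sum.cong[OF refl]) (auto simp flip: diff_monom dest: zdvd_imp_le)
  also have "\<dots> = [:of_nat p:] - gone"
    using p_gt_1 by (simp add: sum_subtractf gone_def gs_def monom_0)
  finally show ?thesis .
qed

text \<open>The product \<open>gchi * gchi * gchib\<close> is evaluated in two ways, pairing
  \<open>gchi\<close> first with itself or first with \<open>gchib\<close>, and the coefficients of
  the group element 1 are compared.\<close>

lemma J_cnj: "J * eis_cnj J = of_nat p"
proof -
  have "dcong \<Phi> (gchi * gchi * gchib) (smult J gchib * gchib)"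
    by (intro dcong_mult gchi_square dcong_refl)
  also have "smult J gchib * gchib = [:J:] * (gchib * gchib)" by simp
  also have "dcong \<Phi> \<dots> ([:J:] * smult (eis_cnj J) gchi)"
    by (intro dcong_mult gchib_square dcong_refl)
  finally have 1: "coset_coeff (gchi * gchi * gchib) = J * eis_cnj J"
    by (auto dest!: coset_coeff_cong simp: coset_coeff_smult gchi_def)
  have "dcong \<Phi> (gchi * (gchi * gchib)) (gchi * ([:of_nat p:] - gone))"
    by (intro dcong_mult gchi_gchib dcong_refl)
  also have "gchi * ([:of_nat p:] - gone) = smult (of_nat p) gchi - gone * gchi"
    by (simp add: algebra_simps)
  also have "dcong \<Phi> \<dots> (smult (of_nat p) gchi - 0)"
    by (intro dcong_diff gone_gchi dcong_refl)
  finally have "coset_coeff (gchi * (gchi * gchib)) = of_nat p"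
    by (auto dest!: coset_coeff_cong simp: coset_coeff_smult gchi_def)
  thus ?thesis using 1 by (simp add: mult.assoc)
qed

lemma eis_norm_J: "eis_norm J = int p"
proof -
  have "(of_int (eis_norm J) :: eisenstein) = of_int (int p)"
    using J_cnj mult_eis_cnj[of J] by simp
  thus ?thesis by (simp only: of_int_eq_iff)
qed

text \<open>The cube of \<open>gchi\<close> is \<open>J * (of_nat p - gone)\<close> in the group
  ring, and only a further factor \<open>gchi\<close> removes \<open>gone\<close>; hence the
  exponents \<open>3 * k + 1\<close> below.\<close>

lemma gchi_pow4: "dcong \<Phi> (gchi ^ 4) (smult (J * of_nat p) gchi)"
proof -
  have "gchi ^ 4 = (gchi * gchi) * (gchi * gchi)" by (simp add: power4_eq_xxxx mult.assoc)
  also have "dcong \<Phi> \<dots> (smult J gchib * smult J gchib)"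
    by (intro dcong_mult gchi_square)
  also have "smult J gchib * smult J gchib = [:J * J:] * (gchib * gchib)" by simp
  also have "dcong \<Phi> \<dots> ([:J * J:] * smult (eis_cnj J) gchi)"
    by (intro dcong_mult gchib_square dcong_refl)
  also have "\<dots> = smult (J * (J * eis_cnj J)) gchi" by (simp add: mult_ac)
  finally show ?thesis by (simp add: J_cnj)
qed

lemma gchi_power: "dcong \<Phi> (gchi ^ (3 * k + 1)) (smult ((J * of_nat p) ^ k) gchi)"
proof (induction k)
  case (Suc k)
  have "3 * Suc k + 1 = 3 + (3 * k + 1)" by simp
  hence "gchi ^ (3 * Suc k + 1) = gchi ^ 3 * gchi ^ (3 * k + 1)"
    by (simp only: power_add)
  also have "dcong \<Phi> \<dots> (gchi ^ 3 * smult ((J * of_nat p) ^ k) gchi)"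
    by (intro dcong_mult Suc dcong_refl)
  also have "gchi ^ 3 * smult ((J * of_nat p) ^ k) gchi = [:(J * of_nat p) ^ k:] * gchi ^ 4"
    by (simp add: power3_eq_cube power4_eq_xxxx mult_ac)
  also have "dcong \<Phi> \<dots> ([:(J * of_nat p) ^ k:] * smult (J * of_nat p) gchi)"
    by (intro dcong_mult gchi_pow4 dcong_refl)
  finally show ?case by (simp add: mult_ac)
qed simp

text \<open>Computes the coefficient of \<open>gchi ^ q\<^sup>2\<close> twice: with \<open>gchi ^ 4 = J * p * gchi\<close>, and with the
  Frobenius map modulo \<open>q\<close>.\<close>

lemma J_power_dcong:
  assumes q: "prime q" "q \<noteq> p" "q \<noteq> 3"
  shows "dcong (of_nat q) ((J\<^sup>2 * eis_cnj J) ^ ((q\<^sup>2 - 1) div 3)) (chi (int q))"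
proof -
  obtain k where "q\<^sup>2 - 1 = 3 * k" using square_minus_1_div_3[OF q(1,3)] by blast
  moreover have "q\<^sup>2 > 0" using prime_gt_0_nat[OF q(1)] by simp
  ultimately have k: "q\<^sup>2 = 3 * k + 1" by linarith
  have npq: "\<not> int p dvd int q" using q prime_p primes_dvd_imp_eq by auto
  hence "\<not> int p dvd int (q\<^sup>2)"
    using prime_dvd_power[OF prime_int_p, of "int q" 2] by auto
  \<comment> \<open>As \<open>b\<close> inverts \<open>q\<^sup>2\<close>, its character value is
    \<open>chi (int q)\<close> to the power -2, which is \<open>chi (int q)\<close> again.\<close>
  then obtain b where b: "b \<in> {0..<int p}" "(int (q\<^sup>2) * b) mod int p = 1"
    by (rule inverse_mod_exists)
  have "dcong (int p) (int (q\<^sup>2) * b) 1" using b(2) p_gt_1 by (simp add: dcong_int_iff cong_def)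
  hence "chi (int (q\<^sup>2) * b) = 1" using chi_cong chi_1 by metis
  hence 1: "chib (int q) * chi b = 1" by (simp add: power2_eq_square chi_mult chib_eq)
  have "chi b = (chi (int q) * chib (int q)) * chi b" using chi_chib[OF npq] by simp
  also have "\<dots> = chi (int q)" using 1 by (simp add: mult.assoc)
  finally have chib: "chi b = chi (int q)" .
  have "dcong (of_nat q) (coset_coeff (gchi ^ q\<^sup>2))
     (coset_coeff (\<Sum>a\<in>{0..<int p}. monom (chi a) (nat a) ^ q\<^sup>2))"
    unfolding gchi_def gs_def by (intro coset_coeff_dcong_of_nat dcong_sum_power_prime_square q)
  also have "(\<Sum>a\<in>{0..<int p}. monom (chi a) (nat a) ^ q\<^sup>2) = (\<Sum>a\<in>{0..<int p}. monom (chi a ^ q\<^sup>2) (q\<^sup>2 * nat a))"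
    by (simp add: monom_power mult.commute)
  also have "coset_coeff \<dots> = chi b ^ q\<^sup>2" by (rule coset_coeff_gs_scale[OF b])
  also have "\<dots> = chi b * (chi b ^ 3) ^ k" by (simp add: k power_mult)
  also have "chi b ^ 3 = 1"
    unfolding chib using npq by (intro cubic_units_cube chi_unit)
  also have "coset_coeff (gchi ^ q\<^sup>2) = (J * of_nat p) ^ k"
    unfolding k using coset_coeff_cong[OF gchi_power[of k]] by (simp add: coset_coeff_smult gchi_def)
  finally show ?thesis using k by (simp add: chib J_cnj[symmetric] power2_eq_square mult_ac)
qed

text \<open>Fourier inversion for the group of order 3. Writing \<open>x\<close>, \<open>y\<close>,
  \<open>z\<close> through the three Lagrange resolvents on the right and expanding the cubes, the
  factors \<open>u\<close> and \<open>- 1 - u\<close> select exactly these three monomials.\<close>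

lemma cubic_resolvent_identity:
  fixes x y z u :: "'a::comm_ring_1"
  assumes u: "u * u = - 1 - u"
  shows "3 * (x ^ 3 + u * y ^ 3 + (- 1 - u) * z ^ 3) = (x + y + z)\<^sup>2 * (x + u * y + (- 1 - u) * z) +
    (x + y + z) * (x + (- 1 - u) * y + u * z)\<^sup>2 +
    (x + u * y + (- 1 - u) * z)\<^sup>2 * (x + (- 1 - u) * y + u * z)"
proof -
  have u': "u * (u * t) = - t - u * t" for t
    using u by (metis left_diff_distrib mult.assoc mult_minus1)
  show ?thesis by (simp add: power2_eq_square power3_eq_cube algebra_simps u u')
qed

text \<open>With \<open>Q z\<close> the sum of the group elements of character value \<open>z\<close>, the element
  \<open>W = Q 1 ^ 3 + \<omega> * Q \<omega> ^ 3 + \<omega>\<^sup>2 * Q (\<omega>\<^sup>2) ^ 3\<close> is a third of a polynomial in Gauss sums, while its coefficient is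
  congruent to the conjugate of \<open>chi 3\<close> modulo \<open>3\<close> by the Frobenius map.\<close>

lemma J_dcong_9: "dcong 9 J (eis_cnj J * (4 - 3 * chi 3))"
  and J_dcong_3: "dcong 3 J (- 1)"
proof -
  define Q where "Q z = gs (\<lambda>a. if chi a = z then 1 else 0)" for z
  define x y z where "x = Q 1" and "y = Q \<omega>" and "z = Q (- 1 - \<omega>)"
  define o1 where "o1 = [:\<omega>:]"
  have o1: "o1 * o1 = - 1 - o1" by (simp add: o1_def \<omega>_square one_pCons)
  have sm: "smult \<omega> f = o1 * f" "smult (- 1 - \<omega>) f = (- 1 - o1) * f" for f
    by (simp_all add: o1_def left_diff_distrib smult_diff_left)
  have g1: "gchi = x + o1 * y + (- 1 - o1) * z"
  proof -
    have "gchi = gs (\<lambda>a. (if chi a = 1 then 1 else 0) + \<omega> * (if chi a = \<omega> then 1 else 0)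
        + (- 1 - \<omega>) * (if chi a = - 1 - \<omega> then 1 else 0))"
      unfolding gchi_def
    proof (rule gs_cong)
      fix a show "chi a = (if chi a = 1 then 1 else 0) + \<omega> * (if chi a = \<omega> then 1 else 0)
        + (- 1 - \<omega>) * (if chi a = - 1 - \<omega> then 1 else 0)"
        using chi_in[of a] by (auto simp: cubic_units_def eisenstein_eq_iff)
    qed
    thus ?thesis by (simp only: gs_add gs_smult Q_def x_def y_def z_def sm)
  qed
  have g2: "gchib = x + (- 1 - o1) * y + o1 * z"
  proof -
    have "gchib = gs (\<lambda>a. (if chi a = 1 then 1 else 0) + (- 1 - \<omega>) * (if chi a = \<omega> then 1 else 0)
        + \<omega> * (if chi a = - 1 - \<omega> then 1 else 0))"
      unfolding gchib_def
    proof (rule gs_cong)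
      fix a show "chib a = (if chi a = 1 then 1 else 0) + (- 1 - \<omega>) * (if chi a = \<omega> then 1 else 0)
        + \<omega> * (if chi a = - 1 - \<omega> then 1 else 0)"
        using chi_in[of a] by (auto simp: cubic_units_def chib_def eisenstein_eq_iff)
    qed
    thus ?thesis by (simp only: gs_add gs_smult Q_def x_def y_def z_def sm)
  qed
  have g0: "gone - 1 = x + y + z"
  proof -
    have "gone = gs (\<lambda>a. (if a mod int p = 0 then 1 else 0) + (if chi a = 1 then 1 else 0)
      + (if chi a = \<omega> then 1 else 0) + (if chi a = - 1 - \<omega> then 1 else 0))"
      unfolding gone_def
    proof (rule gs_cong)
      fix a show "1 = (if a mod int p = 0 then 1 else 0) + (if chi a = 1 then 1 else 0)
        + (if chi a = \<omega> then 1 else 0) + (if chi a = - 1 - \<omega> then (1::eisenstein) else 0)"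
        using chi_in[of a] chi_eq_0_iff[of a]
        by (cases "int p dvd a") (auto simp: cubic_units_def eisenstein_eq_iff dvd_eq_mod_eq_0)
    qed
    moreover have "gs (\<lambda>a. if a mod int p = 0 then 1 else 0) = 1"
    proof -
      have "gs (\<lambda>a. if a mod int p = 0 then 1 else 0) = (\<Sum>a\<in>{0..<int p}. if a = 0 then 1 else 0)"
        unfolding gs_def by (rule sum.cong) (auto simp: monom_0 one_pCons)
      thus ?thesis using p_gt_1 by simp
    qed
    ultimately show ?thesis unfolding gs_add Q_def x_def y_def z_def by simp
  qed
  define W where "W = x ^ 3 + o1 * y ^ 3 + (- 1 - o1) * z ^ 3"
  have "3 * W = (gone - 1)\<^sup>2 * gchi + (gone - 1) * gchib\<^sup>2 + gchi\<^sup>2 * gchib"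
    unfolding g0 g1 g2 W_def by (rule cubic_resolvent_identity[OF o1])
  \<comment> \<open>Each summand with a factor \<open>gone\<close> also contains \<open>gchi\<close>
    or \<open>gchib\<close> and so vanishes modulo \<Phi>.\<close>
  hence W3: "3 * W = gone * ((gone - 2) * gchi + gchib * gchib)
      + (gchi - gchib * gchib + (gchi * gchi) * gchib)"
    by (simp add: power2_eq_square algebra_simps)
  have "dcong \<Phi> (gone * ((gone - 2) * gchi + gchib * gchib)) 0"
  proof -
    have "\<Phi> dvd (gone - 2) * (gone * gchi) + gchib * (gone * gchib)"
      by (intro dvd_add dvd_mult[OF gone_gchi[unfolded dcong_0_iff]]
          dvd_mult[OF gone_gchib[unfolded dcong_0_iff]])
    thus ?thesis by (simp add: dcong_def algebra_simps)
  qed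
  moreover have "dcong \<Phi> (gchi - gchib * gchib + (gchi * gchi) * gchib)
    (gchi - smult (eis_cnj J) gchi + smult (of_nat p) gchi)"
  proof (intro dcong_add dcong_diff gchib_square dcong_refl)
    have "dcong \<Phi> ((gchi * gchi) * gchib) (smult J gchib * gchib)"
      by (intro dcong_mult gchi_square dcong_refl)
    also have "smult J gchib * gchib = [:J:] * (gchib * gchib)" by simp
    also have "dcong \<Phi> \<dots> ([:J:] * smult (eis_cnj J) gchi)"
      by (intro dcong_mult gchib_square dcong_refl)
    finally show "dcong \<Phi> ((gchi * gchi) * gchib) (smult (of_nat p) gchi)"
      by (simp add: J_cnj mult.commute[of "eis_cnj J"])
  qed
  ultimately have "dcong \<Phi> (3 * W) (0 + (gchi - smult (eis_cnj J) gchi + smult (of_nat p) gchi))"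
    unfolding W3 by (rule dcong_add)
  moreover have "3 * W = smult 3 W" by (simp add: numeral_poly)
  ultimately have "coset_coeff (smult 3 W) = 1 - eis_cnj J + of_nat p"
    by (auto dest!: coset_coeff_cong simp: coset_coeff_add coset_coeff_diff coset_coeff_smult gchi_def)
  hence W: "3 * coset_coeff W = 1 - eis_cnj J + of_nat p" by (simp add: coset_coeff_smult)
  \<comment> \<open>The cubing Frobenius brings the coefficient at the inverse \<open>b\<close> of 3
    to the group element 1, and \<open>chi b\<close> is the conjugate of
    \<open>chi 3\<close>.\<close>
  obtain b where b: "b \<in> {0..<int p}" "(int 3 * b) mod int p = 1"
    using inverse_mod_exists[of 3] not_p_dvd_3 by auto
  have "dcong (int p) (3 * b) 1" using b(2) p_gt_1 by (simp add: dcong_int_iff cong_def)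
  hence "chi (3 * b) = 1" using chi_cong chi_1 by metis
  hence b1: "chi 3 * chi b = 1" by (simp add: chi_mult)
  have "chi b = (chi 3 * chib 3) * chi b" using chi_chib[OF not_p_dvd_3] by simp
  also have "\<dots> = chib 3" using b1 by (simp add: mult_ac)
  finally have chib: "chi b = chib 3" .
  have Q3: "dcong 3 (Q u ^ 3) (\<Sum>a\<in>{0..<int p}. monom (if chi a = u then 1 else 0) (3 * nat a))" for u
  proof -
    have "dcong (of_nat 3) (Q u ^ 3) (\<Sum>a\<in>{0..<int p}. monom (if chi a = u then 1 else 0) (nat a) ^ 3)"
      unfolding Q_def gs_def by (rule dcong_sum_power_prime) simp
    also have "(\<Sum>a\<in>{0..<int p}. monom (if chi a = u then 1 else 0 :: eisenstein) (nat a) ^ 3)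
      = (\<Sum>a\<in>{0..<int p}. monom (if chi a = u then 1 else 0) (3 * nat a))"
      by (rule sum.cong) (auto simp: monom_power mult.commute)
    finally show ?thesis by simp
  qed
  have cQ: "dcong 3 (coset_coeff (Q u ^ 3)) (if chi b = u then 1 else 0)" for u
  proof -
    have "dcong (of_nat 3) (coset_coeff (Q u ^ 3))
        (coset_coeff (\<Sum>a\<in>{0..<int p}. monom (if chi a = u then 1 else 0) (3 * nat a)))"
      by (rule coset_coeff_dcong_of_nat) (use Q3[of u] in simp)
    also have "coset_coeff (\<Sum>a\<in>{0..<int p}. monom (if chi a = u then 1 else 0) (3 * nat a))
        = (if chi b = u then 1 else 0)"
      by (rule coset_coeff_gs_scale) (use b in simp_all)
    finally show ?thesis by simp
  qed
  have "coset_coeff W = coset_coeff (Q 1 ^ 3) + \<omega> * coset_coeff (Q \<omega> ^ 3)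
      + (- 1 - \<omega>) * coset_coeff (Q (- 1 - \<omega>) ^ 3)"
  proof -
    have "W = Q 1 ^ 3 + smult \<omega> (Q \<omega> ^ 3) + smult (- 1 - \<omega>) (Q (- 1 - \<omega>) ^ 3)"
      by (simp only: W_def x_def y_def z_def sm)
    thus ?thesis by (simp only: coset_coeff_add coset_coeff_smult)
  qed
  also have "dcong 3 \<dots> ((if chi b = 1 then 1 else 0) + \<omega> * (if chi b = \<omega> then 1 else 0)
      + (- 1 - \<omega>) * (if chi b = - 1 - \<omega> then 1 else 0))"
    by (intro dcong_add dcong_mult dcong_refl cQ)
  also have "\<dots> = chi b"
    using chi_in[of b] b1 by (auto simp: cubic_units_def eisenstein_eq_iff)
  finally have "dcong 3 (coset_coeff W) (chib 3)" by (simp add: chib)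
  then obtain k where k: "coset_coeff W - chib 3 = 3 * k" by (auto simp: dcong_def)
  have main: "1 - eis_cnj J + of_nat p = 3 * chib 3 + 9 * k"
    unfolding W[symmetric] using k by (simp add: algebra_simps)
  define c d where "c = re J" and "d = om J"
  have pp: "int p = 3 * int e + 1" using p_eq by simp
  \<comment> \<open>The coordinate \<open>d\<close> becomes known modulo 9, but \<open>c\<close>
    only modulo 3, as \<open>e\<close> is arbitrary. This suffices: the difference to be shown
    divisible by 9 is \<open>(J - eis_cnj J) - 3 * eis_cnj J * (1 - chi 3)\<close>, whose first part
    depends on \<open>d\<close> alone and whose second part needs \<open>eis_cnj J\<close> only
    modulo 3.\<close>
  have m1: "1 - (c - d) + int p = 3 * re (chib 3) + 9 * re k" "d = 3 * om (chib 3) + 9 * om k"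
    using arg_cong[OF main, of re] arg_cong[OF main, of om] by (simp_all add: c_def d_def)
  have 3: "3 = (of_int 3 :: eisenstein)" "9 = (of_int 9 :: eisenstein)" by simp_all
  have c3: "3 dvd d" "3 dvd c + 1" using m1 pp by presburger+
  show "dcong 3 J (- 1)"
    unfolding dcong_def 3 of_int_dvd_eisenstein_iff using c3 by (simp add: c_def d_def)
  have "chi 3 \<in> cubic_units" using not_p_dvd_3 by (rule chi_unit)
  then consider "chi 3 = 1" | "chi 3 = \<omega>" | "chi 3 = - 1 - \<omega>" by (auto simp: cubic_units_def)
  thus "dcong 9 J (eis_cnj J * (4 - 3 * chi 3))"
    unfolding dcong_def 3(2) of_int_dvd_eisenstein_iff
  proof cases
    case 1
    hence "9 dvd d" using m1(2) by (simp add: chib_def)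
    thus "9 dvd re (J - eis_cnj J * (4 - 3 * chi 3)) \<and> 9 dvd om (J - eis_cnj J * (4 - 3 * chi 3))"
      by (simp add: 1 d_def[symmetric] c_def[symmetric])
  next
    case 2
    hence "d = - 3 + 9 * om k" using m1(2) by (simp add: chib_def)
    thus "9 dvd re (J - eis_cnj J * (4 - 3 * chi 3)) \<and> 9 dvd om (J - eis_cnj J * (4 - 3 * chi 3))"
      using c3(2) by (simp add: 2 d_def[symmetric] c_def[symmetric]) presburger
  next
    case 3
    hence "d = 3 + 9 * om k" using m1(2) by (simp add: chib_def)
    thus "9 dvd re (J - eis_cnj J * (4 - 3 * chi 3)) \<and> 9 dvd om (J - eis_cnj J * (4 - 3 * chi 3))"
      using c3(2) by (simp add: 3 d_def[symmetric] c_def[symmetric]) presburger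
  qed
qed

end

section \<open>The cubic residue symbol\<close>

text \<open>Here \<open>f\<close> is the cubic residue symbol of modulus \<open>\<mu>\<close> on rational arguments. The modulus
  is \<open>1\<close> or \<open>- 1\<close> modulo \<open>3\<close>, and \<open>f\<close> vanishes on integers that are not coprime to it.\<close>

inductive cubic_symbol :: "eisenstein \<Rightarrow> (int \<Rightarrow> eisenstein) \<Rightarrow> bool" where
  one: "cubic_symbol 1 (\<lambda>_. 1)"
| minus: "cubic_symbol \<mu> f \<Longrightarrow> cubic_symbol (- \<mu>) f"
| mult: "eisenstein_prime p w \<Longrightarrow> cubic_symbol \<mu> f \<Longrightarrow>
    cubic_symbol (eisenstein_prime.J p w * \<mu>) (\<lambda>a. eisenstein_prime.chi p w a * f a)"

lemma cubic_symbol_mult: "cubic_symbol \<mu> f \<Longrightarrow> f (a * b) = f a * f b"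
  by (induction rule: cubic_symbol.induct) (auto simp: eisenstein_prime.chi_mult)

lemma cubic_symbol_1: "cubic_symbol \<mu> f \<Longrightarrow> f 1 = 1"
  by (induction rule: cubic_symbol.induct) (auto simp: eisenstein_prime.chi_1)

lemma cubic_symbol_uminus: "cubic_symbol \<mu> f \<Longrightarrow> f (- a) = f a"
  by (induction rule: cubic_symbol.induct) (auto simp: eisenstein_prime.chi_minus)

lemma cubic_symbol_power: "cubic_symbol \<mu> f \<Longrightarrow> f (a ^ k) = f a ^ k"
  by (induction k) (auto simp: cubic_symbol_mult cubic_symbol_1)

lemma cubic_symbol_unit:
  "cubic_symbol \<mu> f \<Longrightarrow> coprime a (eis_norm \<mu>) \<Longrightarrow> f a \<in> cubic_units"
proof (induction rule: cubic_symbol.induct)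
  case (mult p w \<mu> f)
  interpret eisenstein_prime p w by (rule mult)
  have "coprime a (int p)" "coprime a (eis_norm \<mu>)"
    using mult.prems by (simp_all add: eis_norm_mult eis_norm_J)
  hence "\<not> int p dvd a" using coprime_common_divisor[of a "int p" "int p"] not_p_dvd_1 by auto
  thus ?case using mult.IH[OF \<open>coprime a (eis_norm \<mu>)\<close>] chi_unit cubic_units_mult by blast
qed (auto simp: cubic_units_def eis_norm_def)

text \<open>The map \<open>red\<close> fixes rational integers and sends \<open>J\<close> to 0
  modulo \<open>p\<close>, so a congruence of integers modulo \<open>J\<close> holds modulo
  \<open>p\<close>.\<close>

lemma cubic_symbol_cong:
  "cubic_symbol \<mu> f \<Longrightarrow> dcong \<mu> (of_int a) (of_int b) \<Longrightarrow> f a = f b"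
proof (induction rule: cubic_symbol.induct)
  case (mult p w \<mu> f)
  interpret eisenstein_prime p w by (rule mult)
  have "J * \<mu> dvd of_int (a - b)" using mult.prems by (simp add: dcong_def)
  hence *: "J dvd of_int (a - b)" "\<mu> dvd of_int (a - b)" by (auto elim: dvd_mult_left dvd_mult_right)
  then obtain k where "of_int (a - b) = J * k" by blast
  moreover have "red (of_int (a - b)) = a - b" by (simp add: red_def)
  ultimately have "dcong (int p) (a - b) (red J * red k)" using red_mult[of J k] by simp
  also have "dcong (int p) \<dots> 0" using red_J by (simp add: dcong_0_iff)
  finally have "chi a = chi b" by (intro chi_cong) (simp add: dcong_def)
  moreover have "f a = f b" using * by (intro mult.IH) (simp add: dcong_def)
  ultimately show ?case by simp
qed (auto simp: dcong_def)

text \<open>Reciprocity between \<open>\<mu>\<close> and a rational prime. The factor \<open>\<mu>\<^sup>2 * eis_cnj \<mu>\<close> is the cube of the Gauss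
  sum when \<open>\<mu> = J\<close>; it takes the place of \<open>\<mu>\<close> so that primes \<open>q\<close> of both residue classes
  modulo \<open>3\<close> are covered by one formula.\<close>

lemma cubic_symbol_prime_dcong:
  "cubic_symbol \<mu> f \<Longrightarrow> prime q \<Longrightarrow> q \<noteq> 3 \<Longrightarrow> \<not> int q dvd eis_norm \<mu> \<Longrightarrow>
    dcong (of_nat q) ((\<mu>\<^sup>2 * eis_cnj \<mu>) ^ ((q\<^sup>2 - 1) div 3)) (f (int q))"
proof (induction rule: cubic_symbol.induct)
  case (minus \<mu> f)
  have IH: "dcong (of_nat q) ((\<mu>\<^sup>2 * eis_cnj \<mu>) ^ ((q\<^sup>2 - 1) div 3)) (f (int q))"
    using minus by (simp add: eis_norm_def)
  \<comment> \<open>A sign makes no difference modulo 2, and for odd \<open>q\<close> the exponent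
    is even.\<close>
  show ?case
  proof (cases "q = 2")
    case True
    have "dcong (of_nat q) ((- \<mu>)\<^sup>2 * eis_cnj (- \<mu>)) (\<mu>\<^sup>2 * eis_cnj \<mu>)"
    proof -
      have "(- \<mu>)\<^sup>2 * eis_cnj (- \<mu>) - \<mu>\<^sup>2 * eis_cnj \<mu> = of_nat q * (- (\<mu>\<^sup>2 * eis_cnj \<mu>))"
        using True by simp
      thus ?thesis unfolding dcong_def by (metis dvd_triv_left)
    qed
    from dcong_trans[OF dcong_power[OF this] IH] show ?thesis .
  next
    case False
    hence "odd q" using minus.prems prime_odd_nat[of q] prime_ge_2_nat[of q] by auto
    have "even (3 * ((q\<^sup>2 - 1) div 3))"
      unfolding square_minus_1_div_3[OF minus.prems(1,2), symmetric] using \<open>odd q\<close> by simp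
    hence "even ((q\<^sup>2 - 1) div 3)" by simp
    hence "((- \<mu>)\<^sup>2 * eis_cnj (- \<mu>)) ^ ((q\<^sup>2 - 1) div 3) = (\<mu>\<^sup>2 * eis_cnj \<mu>) ^ ((q\<^sup>2 - 1) div 3)"
      by (simp add: power_minus_even)
    thus ?thesis using IH by simp
  qed
next
  case (mult p w \<mu> f)
  interpret eisenstein_prime p w by (rule mult)
  have "\<not> int q dvd eis_norm \<mu>" "\<not> int q dvd int p"
    using mult.prems by (auto simp: eis_norm_mult eis_norm_J)
  hence IH: "dcong (of_nat q) ((\<mu>\<^sup>2 * eis_cnj \<mu>) ^ ((q\<^sup>2 - 1) div 3)) (f (int q))" and "q \<noteq> p"
    using mult by auto
  have "((J * \<mu>)\<^sup>2 * eis_cnj (J * \<mu>)) ^ ((q\<^sup>2 - 1) div 3) =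
    (J\<^sup>2 * eis_cnj J) ^ ((q\<^sup>2 - 1) div 3) * (\<mu>\<^sup>2 * eis_cnj \<mu>) ^ ((q\<^sup>2 - 1) div 3)"
    by (simp add: power_mult_distrib mult_ac)
  also have "dcong (of_nat q) \<dots> (chi (int q) * f (int q))"
    by (intro dcong_mult IH J_power_dcong mult.prems \<open>q \<noteq> p\<close>)
  finally show ?case .
qed simp

lemma cubic_symbol_not_3_dvd_norm: "cubic_symbol \<mu> f \<Longrightarrow> \<not> 3 dvd eis_norm \<mu>"
proof (induction rule: cubic_symbol.induct)
  case (mult p w \<mu> f)
  interpret eisenstein_prime p w by (rule mult)
  have "\<not> 3 dvd p" using prime_p p_neq_3 primes_dvd_imp_eq[of 3 p] by auto
  hence "\<not> 3 dvd int p" using int_dvd_int_iff[of 3 p] by simp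
  thus ?case using mult.IH by (simp add: eis_norm_mult eis_norm_J prime_dvd_mult_iff)
qed (auto simp: eis_norm_def)

text \<open>The supplementary law for \<open>3\<close>, in a form that is multiplicative in \<open>\<mu>\<close>.\<close>

lemma cubic_symbol_dcong_9:
  "cubic_symbol \<mu> f \<Longrightarrow> dcong 9 \<mu> (eis_cnj \<mu> * (4 - 3 * f 3))"
proof (induction rule: cubic_symbol.induct)
  case (minus \<mu> f)
  thus ?case using dcong_uminus by fastforce
next
  case (mult p w \<mu> f)
  interpret eisenstein_prime p w by (rule mult)
  have "\<not> 3 dvd eis_norm \<mu>" by (rule cubic_symbol_not_3_dvd_norm[OF mult.hyps(2)])
  hence "coprime 3 (eis_norm \<mu>)" by (intro prime_imp_coprime) auto
  hence f3: "f 3 \<in> cubic_units" by (rule cubic_symbol_unit[OF mult.hyps(2)])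
  \<comment> \<open>The map from \<open>u\<close> to \<open>4 - 3 * u = 1 + 3 * (1 - u)\<close> is
    multiplicative modulo 9 because 3 divides \<open>(1 - u) * (1 - v)\<close> for cube roots of
    unity.\<close>
  have "dcong 9 ((4 - 3 * u) * (4 - 3 * v)) (4 - 3 * (u * v))"
    if "u \<in> cubic_units" "v \<in> cubic_units" for u v
  proof -
    have 9: "(9::eisenstein) = of_int 9" by simp
    show ?thesis using that unfolding dcong_def 9 of_int_dvd_eisenstein_iff
      by (auto simp: cubic_units_def)
  qed
  from this[OF chi_unit[OF not_p_dvd_3] f3]
  have *: "dcong 9 ((4 - 3 * chi 3) * (4 - 3 * f 3)) (4 - 3 * (chi 3 * f 3))" .
  have "dcong 9 (J * \<mu>) ((eis_cnj J * (4 - 3 * chi 3)) * (eis_cnj \<mu> * (4 - 3 * f 3)))"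
    by (intro dcong_mult J_dcong_9 mult.IH)
  also have "\<dots> = (eis_cnj J * eis_cnj \<mu>) * ((4 - 3 * chi 3) * (4 - 3 * f 3))" by (simp add: mult_ac)
  also have "dcong 9 \<dots> ((eis_cnj J * eis_cnj \<mu>) * (4 - 3 * (chi 3 * f 3)))"
    by (intro dcong_scale *)
  finally show ?case by simp
qed auto

text \<open>Here \<mu> and its conjugate agree modulo 9, so the previous law makes
  \<open>3 * eis_cnj \<mu> * (1 - f 3)\<close> divisible by 9. The norm of \<mu> is prime to 3, and
  1 is the only cubic unit congruent to 1 modulo 3.\<close>

lemma cubic_symbol_3:
  assumes f: "cubic_symbol \<mu> f" and 9: "9 dvd om \<mu>"
  shows "f 3 = 1"
proof -
  define N where "N = eis_norm \<mu>"
  have n3: "\<not> 3 dvd N" unfolding N_def using f by (rule cubic_symbol_not_3_dvd_norm)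
  hence cop: "coprime 3 N" by (intro prime_imp_coprime) auto
  hence f3: "f 3 \<in> cubic_units" unfolding N_def by (rule cubic_symbol_unit[OF f])
  have nine: "(9::eisenstein) = of_int 9" by simp
  have "9 dvd \<mu> - eis_cnj \<mu> * (4 - 3 * f 3)"
    using cubic_symbol_dcong_9[OF f] by (simp add: dcong_def)
  moreover have "9 dvd \<mu> - eis_cnj \<mu>"
    unfolding nine of_int_dvd_eisenstein_iff using 9 by auto
  ultimately have "9 dvd (\<mu> - eis_cnj \<mu>) - (\<mu> - eis_cnj \<mu> * (4 - 3 * f 3))"
    by (rule dvd_diff[rotated])
  also have "(\<mu> - eis_cnj \<mu>) - (\<mu> - eis_cnj \<mu> * (4 - 3 * f 3)) = 3 * (eis_cnj \<mu> * (1 - f 3))"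
    by (simp add: algebra_simps)
  finally have "9 dvd \<mu> * (3 * (eis_cnj \<mu> * (1 - f 3)))" by (rule dvd_mult)
  also have "\<mu> * (3 * (eis_cnj \<mu> * (1 - f 3))) = of_int (3 * N) * (1 - f 3)"
    by (simp add: N_def mult_eis_cnj[symmetric] mult_ac)
  finally have "9 dvd 3 * (N * re (1 - f 3)) \<and> 9 dvd 3 * (N * om (1 - f 3))"
    unfolding nine of_int_dvd_eisenstein_iff by (simp add: mult.assoc)
  hence "3 dvd N * re (1 - f 3) \<and> 3 dvd N * om (1 - f 3)" by presburger
  hence "3 dvd re (1 - f 3) \<and> 3 dvd om (1 - f 3)"
    using cop by (simp add: coprime_dvd_mult_right_iff)
  hence "of_int 3 dvd 1 - f 3" unfolding of_int_dvd_eisenstein_iff by simp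
  thus ?thesis by (rule cubic_units_dvd_1_diff[OF f3]) simp
qed

lemma dcong_eis_cnj:
  assumes "dcong (of_int n) x y"
  shows "dcong (of_int n) (eis_cnj x) (eis_cnj y)"
proof -
  obtain k where "x - y = of_int n * k" using assms by (auto simp: dcong_def)
  hence "eis_cnj x - eis_cnj y = of_int n * eis_cnj k"
    by (metis eis_cnj_simps(2,4,8))
  thus ?thesis by (simp add: dcong_def)
qed

lemma dcong_of_int:
  assumes "dcong n a b"
  shows "dcong (of_int n) (of_int a) (of_int b :: eisenstein)"
  using assms unfolding dcong_def by (simp add: of_int_dvd_of_int_eisenstein_iff flip: of_int_diff)

text \<open>Such a \<open>v\<close> is rational or a rational multiple of sqrt (- 3), so
  \<open>v\<^sup>2 * eis_cnj v\<close> is \<open>v ^ 3\<close> up to a sign that the even exponent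
  \<open>k\<close> absorbs. Since \<open>3 * k = (q - 1) * (q + 1)\<close> and \<open>q + 1\<close>
  is even, \<open>v ^ (3 * k)\<close> is a power of \<open>n ^ (q - 1)\<close> and Fermat gives 1;
  likewise for \<open>t\<close>.\<close>

lemma cubic_symbol_prime_eq_1:
  assumes f: "cubic_symbol \<mu> f" and q: "prime q" "q \<noteq> 3" "odd q" "\<not> int q dvd eis_norm \<mu>"
    and t: "\<not> int q dvd t" and n: "\<not> int q dvd n"
    and v: "dcong (of_nat q) (of_int t * \<mu>) v" "v * v = of_int n" "eis_cnj v = v \<or> eis_cnj v = - v"
  shows "f (int q) = 1"
proof -
  define k where "k = (q\<^sup>2 - 1) div 3"
  have k3: "q\<^sup>2 - 1 = 3 * k" unfolding k_def by (rule square_minus_1_div_3[OF q(1,2)])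
  have "even (3 * k)" unfolding k3[symmetric] using q(3) by simp
  hence "even k" by simp
  have q1: "q\<^sup>2 - 1 = (q - 1) * (q + 1)" by (simp add: power2_eq_square algebra_simps)
  obtain l where l: "q + 1 = 2 * l" using q(3) by (metis evenE odd_even_add odd_one)
  have k2: "3 * k = 2 * ((q - 1) * l)" unfolding k3[symmetric] q1 l by simp
  have qq: "(of_nat q :: eisenstein) = of_int (int q)" by simp
  have tk: "dcong (of_nat q) (of_int (t ^ (3 * k))) (of_int 1 :: eisenstein)"
    unfolding qq by (intro dcong_of_int fermat_int[OF q(1) t, of _ "q + 1"]) (use k3 q1 in simp)
  have nk: "dcong (of_nat q) (of_int (n ^ ((q - 1) * l))) (of_int 1 :: eisenstein)"
    unfolding qq by (intro dcong_of_int fermat_int[OF q(1) n, of _ l]) simp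
  have "dcong (of_nat q) ((of_int t * \<mu>)\<^sup>2 * eis_cnj (of_int t * \<mu>)) (v\<^sup>2 * eis_cnj v)"
    using v(1) unfolding qq by (intro dcong_mult dcong_power dcong_eis_cnj)
  hence "dcong (of_nat q) (((of_int t * \<mu>)\<^sup>2 * eis_cnj (of_int t * \<mu>)) ^ k) ((v\<^sup>2 * eis_cnj v) ^ k)"
    by (rule dcong_power)
  also have "(v\<^sup>2 * eis_cnj v) ^ k = v ^ (3 * k)"
    using v(3) \<open>even k\<close> by (auto simp: power_minus_even power_mult power3_eq_cube power2_eq_square mult.assoc)
  also have "\<dots> = of_int (n ^ ((q - 1) * l))"
    unfolding k2 by (simp add: power_mult power2_eq_square v(2))
  also have "dcong (of_nat q) \<dots> (of_int 1)" by (rule nk)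
  also have "((of_int t * \<mu>)\<^sup>2 * eis_cnj (of_int t * \<mu>)) ^ k
      = of_int (t ^ (3 * k)) * (\<mu>\<^sup>2 * eis_cnj \<mu>) ^ k"
    by (simp add: power_mult power3_eq_cube power2_eq_square power_mult_distrib mult_ac)
  finally have 1: "dcong (of_nat q) (of_int (t ^ (3 * k)) * (\<mu>\<^sup>2 * eis_cnj \<mu>) ^ k) (of_int 1)" .
  have "dcong (of_nat q) (of_int (t ^ (3 * k)) * (\<mu>\<^sup>2 * eis_cnj \<mu>) ^ k) (of_int 1 * f (int q))"
    unfolding k_def by (intro dcong_mult tk[unfolded k_def] cubic_symbol_prime_dcong f q)
  with 1 have "dcong (of_nat q) 1 (f (int q))" using dcong_sym dcong_trans by fastforce
  hence "of_int (int q) dvd 1 - f (int q)" by (simp add: dcong_def)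
  moreover have "f (int q) \<in> cubic_units"
    by (rule cubic_symbol_unit[OF f]) (use q in \<open>auto intro: prime_imp_coprime\<close>)
  ultimately show ?thesis using prime_gt_1_nat[OF q(1)] by (intro cubic_units_dvd_1_diff[of _ "int q"]) auto
qed

lemma cubic_symbol_int_eq_1:
  assumes f: "cubic_symbol \<mu> f" and z: "z \<noteq> 0" "\<And>q. prime q \<Longrightarrow> int q dvd z \<Longrightarrow> f (int q) = 1"
  shows "f z = 1"
proof -
  have "n \<noteq> 0 \<longrightarrow> (\<forall>q. prime q \<longrightarrow> q dvd n \<longrightarrow> f (int q) = 1) \<longrightarrow> f (int n) = 1" for n :: nat
  proof (induction n rule: prime_divisors_induct)
    case (factor q n)
    thus ?case by (auto simp: cubic_symbol_mult[OF f])
  qed (auto simp: cubic_symbol_1[OF f])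
  from this[of "nat \<bar>z\<bar>"] have "f (int (nat \<bar>z\<bar>)) = 1" using z by (auto simp: int_dvd_int_iff[symmetric])
  thus ?thesis by (cases "z \<ge> 0") (auto simp: cubic_symbol_uminus[OF f])
qed

text \<open>Descent on the norm. Coprime coordinates keep a prime factor \<open>p\<close> of the
  norm from dividing \<open>om \<mu>\<close>, so \<mu> determines a residue \<open>w\<close> of
  \<omega> modulo \<open>p\<close>, and the Jacobi sum for this \<open>w\<close> splits off.
  Divisibility of \<open>om \<mu>\<close> by 3 passes to the cofactor because \<open>J\<close> is -1
  modulo 3, and among the units it leaves only 1 and -1.\<close>

lemma cubic_symbol_exists:
  "coprime (re \<mu>) (om \<mu>) \<Longrightarrow> 3 dvd om \<mu> \<Longrightarrow> \<exists>f. cubic_symbol \<mu> f"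
proof (induction "nat (eis_norm \<mu>)" arbitrary: \<mu> rule: less_induct)
  case less
  define c d where "c = re \<mu>" and "d = om \<mu>"
  have cop: "coprime c d" and d3: "3 dvd d" using less.prems by (simp_all add: c_def d_def)
  have N: "eis_norm \<mu> = c\<^sup>2 - c * d + d\<^sup>2" by (simp add: eis_norm_def c_def d_def)
  have \<mu>0: "\<mu> \<noteq> 0" using less.prems by auto
  hence Npos: "eis_norm \<mu> > 0" using eis_norm_nonneg[of \<mu>] by (metis eis_norm_eq_0_iff order_le_less)
  show ?case
  proof (cases "eis_norm \<mu> = 1")
    case True
    have "4 = (2 * c - d)\<^sup>2 + 3 * d\<^sup>2" using eis_norm_4[of \<mu>] True by (simp add: c_def d_def)
    have "d = 0"
    proof (rule ccontr)
      assume "d \<noteq> 0"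
      hence "\<bar>3\<bar> \<le> \<bar>d\<bar>" using d3 by (intro dvd_imp_le_int)
      hence "3 * 3 \<le> \<bar>d\<bar> * \<bar>d\<bar>" by (intro mult_mono) auto
      hence "9 \<le> d\<^sup>2" by (simp add: power2_eq_square)
      with \<open>4 = _\<close> show False by (smt (verit) zero_le_power2)
    qed
    with True N have "c\<^sup>2 = 1" by simp
    hence "c = 1 \<or> c = - 1" by (simp add: power2_eq_1_iff)
    hence "\<mu> = 1 \<or> \<mu> = - 1" using \<open>d = 0\<close> by (auto simp: eisenstein_eq_iff c_def d_def)
    thus ?thesis using cubic_symbol.one cubic_symbol.minus[OF cubic_symbol.one] by blast
  next
    case False
    hence "nat (eis_norm \<mu>) \<noteq> 1" using Npos by simp
    then obtain p where p: "prime p" "p dvd nat (eis_norm \<mu>)" using prime_factor_nat by blast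
    hence pN: "int p dvd eis_norm \<mu>" using Npos by (metis int_dvd_int_iff int_nat_eq less_le)
    have pp: "prime (int p)" using p by simp
    have npd: "\<not> int p dvd d"
    proof
      assume a: "int p dvd d"
      have "c\<^sup>2 = eis_norm \<mu> + d * (c - d)" by (simp add: N power2_eq_square algebra_simps)
      hence "int p dvd c\<^sup>2" using a pN by simp
      hence "int p dvd c" using pp prime_dvd_power by blast
      with a cop pp show False by (meson coprime_common_divisor not_prime_unit)
    qed
    hence "coprime d (int p)" using pp prime_imp_coprime coprime_commute by blast
    then obtain d' where "[d * d' = 1] (mod int p)" using cong_solve_coprime_int by blast
    hence d': "dcong (int p) (d * d') 1" by (simp add: dcong_int_iff)
    \<comment> \<open>With this residue of \<omega>, \<open>red\<close> sends \<mu> to 0 modulo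
      \<open>p\<close>, just as it does \<open>J\<close>.\<close>
    define w where "w = - c * d'"
    have cw: "dcong (int p) (c + d * w) 0"
    proof -
      have "dcong (int p) (c - c * (d * d')) (c - c * 1)"
        by (intro dcong_diff dcong_mult dcong_refl d')
      thus ?thesis by (simp add: w_def algebra_simps)
    qed
    have "int p dvd d\<^sup>2 * (w\<^sup>2 + w + 1)"
    proof -
      have "d\<^sup>2 * (w\<^sup>2 + w + 1) = (c + d * w) * (d * w - c + d) + eis_norm \<mu>"
        by (simp add: N power2_eq_square algebra_simps)
      thus ?thesis using cw pN by (simp add: dcong_0_iff)
    qed
    hence "int p dvd w\<^sup>2 + w + 1"
      using npd pp prime_dvd_mult_iff[OF pp] prime_dvd_power[OF pp] by blast
    moreover have "p \<noteq> 3"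
      using npd d3 by auto
    ultimately interpret eisenstein_prime p w using p by unfold_locales
    define c1 d1 where "c1 = re J" and "d1 = om J"
    have c1: "dcong (int p) (c1 + d1 * w) 0" using red_J by (simp add: dcong_0_iff red_def c1_def d1_def)
    \<comment> \<open>Since \<open>J * eis_cnj J\<close> is \<open>p\<close>, this amounts to
      divisibility of \<mu> by \<open>J\<close>.\<close>
    have "of_int (int p) dvd \<mu> * eis_cnj J"
    proof -
      have "re (\<mu> * eis_cnj J) = c * (c1 - d1) + d * d1"
        "om (\<mu> * eis_cnj J) = d * c1 - c * d1"
        by (simp_all add: c_def d_def c1_def d1_def algebra_simps)
      moreover have "c * (c1 - d1) + d * d1 = (c + d * w) * (c1 - d1) - d * w * (c1 + d1 * w)
          + d * d1 * (w\<^sup>2 + w + 1)"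
        "d * c1 - c * d1 = d * (c1 + d1 * w) - d1 * (c + d * w)"
        by (simp_all add: power2_eq_square algebra_simps)
      ultimately show ?thesis unfolding of_int_dvd_eisenstein_iff
        using cw c1 w_root by (simp add: dcong_0_iff)
    qed
    then obtain \<nu> where "\<mu> * eis_cnj J = of_int (int p) * \<nu>" by blast
    hence "\<mu> * eis_cnj J = (J * \<nu>) * eis_cnj J" by (simp add: J_cnj[symmetric] mult_ac)
    moreover have "eis_cnj J \<noteq> 0" using J_cnj p_gt_1 by auto
    ultimately have \<mu>: "\<mu> = J * \<nu>" by simp
    have "eis_norm \<mu> = int p * eis_norm \<nu>" by (simp add: \<mu> eis_norm_mult eis_norm_J)
    moreover have "eis_norm \<nu> > 0" using calculation Npos by (simp add: zero_less_mult_iff)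
    ultimately have less: "nat (eis_norm \<nu>) < nat (eis_norm \<mu>)" using p_gt_1 by simp
    have "coprime (re \<nu>) (om \<nu>)"
    proof (rule coprimeI)
      fix r assume "r dvd re \<nu>" "r dvd om \<nu>"
      hence "of_int r dvd \<nu>" by (simp add: of_int_dvd_eisenstein_iff)
      hence "of_int r dvd \<mu>" by (simp add: \<mu>)
      hence "r dvd c" "r dvd d" by (simp_all add: of_int_dvd_eisenstein_iff c_def d_def)
      with cop show "is_unit r" by (meson coprime_common_divisor)
    qed
    moreover have "3 dvd om \<nu>"
    proof -
      have 3: "(3::eisenstein) = of_int 3" by simp
      have "dcong 3 (J * \<nu>) (- 1 * \<nu>)" by (intro dcong_mult J_dcong_3 dcong_refl)
      hence "3 dvd om \<mu> + om \<nu>" unfolding dcong_def 3 of_int_dvd_eisenstein_iff \<mu> by simp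
      thus ?thesis using d3 by (simp add: d_def dvd_add_right_iff)
    qed
    ultimately obtain f where "cubic_symbol \<nu> f" using less.hyps[OF less] by blast
    thus ?thesis unfolding \<mu> using cubic_symbol.mult[OF eisenstein_prime_axioms] by blast
  qed
qed

section \<open>Elements of norm a power of two\<close>

lemma three_dvd_exponent:
  assumes "u \<in> cubic_units" "u \<noteq> 1" "u ^ j = 1"
  shows "3 dvd j"
proof -
  have "u ^ j = (u ^ 3) ^ (j div 3) * u ^ (j mod 3)"
    by (simp flip: power_mult power_add)
  hence "u ^ (j mod 3) = 1" using assms cubic_units_cube by simp
  moreover have "j mod 3 = 0 \<or> j mod 3 = 1 \<or> j mod 3 = 2" by presburger
  moreover have "u ^ 2 \<noteq> 1"
    using assms(1,2) by (auto simp: cubic_units_def power2_eq_square eisenstein_eq_iff)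
  ultimately show ?thesis using assms(2) by (auto simp: dvd_eq_mod_eq_0)
qed

text \<open>For \<open>q = 2\<close> the exponent \<open>(q\<^sup>2 - 1) div 3\<close> is 1, so
  modulo 2 the symbol of 2 is the norm times \<mu>, whose coordinate at \<omega> is odd.\<close>

lemma cubic_symbol_2_neq_1:
  assumes f: "cubic_symbol \<mu> f" and odd: "odd (eis_norm \<mu>)" "odd (om \<mu>)"
  shows "f 2 \<noteq> 1"
proof
  assume "f 2 = 1"
  hence "dcong (of_int 2) (\<mu>\<^sup>2 * eis_cnj \<mu>) 1"
    using cubic_symbol_prime_dcong[OF f, of 2] odd by simp
  moreover have "\<mu>\<^sup>2 * eis_cnj \<mu> = of_int (eis_norm \<mu>) * \<mu>"
    by (simp add: mult_eis_cnj[symmetric] power2_eq_square mult_ac)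
  ultimately have "2 dvd eis_norm \<mu> * om \<mu>"
    unfolding dcong_def of_int_dvd_eisenstein_iff by auto
  thus False using odd by simp
qed

proposition three_dvd_exponent_of_norm_2_power:
  fixes A B m u x s :: int and j :: nat
  assumes A: "odd A" "\<not> 3 dvd A" and B: "odd B" "9 dvd B" and AB: "coprime A B"
    and x: "odd x" and m: "odd m" "\<not> 3 dvd m" and u: "odd u" and um: "coprime u m"
    and m_dvd: "m dvd 3 * (4 * A ^ 3 - B\<^sup>2)" and s: "s = 1 \<or> s = - 1"
    and eq: "m\<^sup>2 * x\<^sup>2 - 3 * (4 * A ^ 3 - B\<^sup>2) * u\<^sup>2 = s * 2 ^ (j + 2) * m\<^sup>2"
  shows "3 dvd j"
proof -
  define Y where "Y = m * x"
  define d where "d = B * u"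
  \<comment> \<open>In the basis 1, \<omega> the number \<open>(Y + d * sqrt (- 3)) / 2\<close> has
    the coordinates \<open>c\<close> and \<open>d\<close>; \<open>c\<close> is integral as
    \<open>Y\<close> and \<open>d\<close> are odd.\<close>
  define c where "c = (Y + d) div 2"
  have odd: "odd Y" "odd d" using assms by (simp_all add: Y_def d_def)
  hence c2: "2 * c = Y + d" by (simp add: c_def)
  \<comment> \<open>Adding \<open>3 * d\<^sup>2\<close> to \<open>Y\<^sup>2\<close> cancels the term
    with \<open>B\<^sup>2\<close> in \<open>eq\<close>, so that \<open>A\<close> enters the norm
    only as a cube.\<close>
  define N0 where "N0 = s * 2 ^ j * m\<^sup>2 + 3 * A ^ 3 * u\<^sup>2"
  have eis: "eis_norm (Eis c d) = N0"
  proof -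
    have "4 * eis_norm (Eis c d) = (2 * c - d)\<^sup>2 + 3 * d\<^sup>2" by (simp add: eis_norm_4)
    also have "\<dots> = Y\<^sup>2 + 3 * d\<^sup>2" by (simp add: c2)
    also have "\<dots> = 4 * N0"
      using eq by (simp add: N0_def Y_def d_def power_mult_distrib algebra_simps)
    finally show ?thesis by simp
  qed
  note pd = prime_dvd_mult_iff prime_dvd_power_iff
  have s_dvd: "\<not> q dvd s" if "prime q" for q
    using s that not_prime_unit by auto
  \<comment> \<open>A prime factor of \<open>m\<close> divides \<open>4 * A ^ 3 - B\<^sup>2\<close>;
    if it divided \<open>A\<close> or \<open>B\<close>, it would divide both.\<close>
  have m_coprime: "\<not> q dvd A" "\<not> q dvd B" "\<not> q dvd u" "\<not> q dvd 2" "\<not> q dvd 3" if q: "prime q" "q dvd m" for q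
  proof -
    show q2: "\<not> q dvd 2" and q3: "\<not> q dvd 3"
      using m q primes_dvd_imp_eq[of q 2] primes_dvd_imp_eq[of q 3] by auto
    have q4: "\<not> q dvd 4"
    proof
      assume "q dvd 4"
      hence "q dvd 2 * 2" by simp
      thus False using q2 q(1) by (simp only: pd) auto
    qed
    have "q dvd 3 * (4 * A ^ 3 - B\<^sup>2)" using q m_dvd dvd_trans by blast
    hence qq: "q dvd 4 * A ^ 3 - B\<^sup>2" using q3 prime_dvd_mult_iff[OF q(1)] by blast
    have iff: "q dvd A \<longleftrightarrow> q dvd B"
    proof
      assume "q dvd A"
      hence "q dvd 4 * A ^ 3" by (simp add: power3_eq_cube)
      hence "q dvd B\<^sup>2" using qq by (metis dvd_diff_right_iff)
      thus "q dvd B" using q(1) prime_dvd_power by blast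
    next
      assume "q dvd B"
      hence "q dvd B\<^sup>2" by (simp add: power2_eq_square)
      hence "q dvd 4 * A ^ 3" using qq by (metis dvd_diff_left_iff)
      hence "q dvd A ^ 3" using q4 q(1) by (simp add: pd)
      thus "q dvd A" using q(1) prime_dvd_power by blast
    qed
    show "\<not> q dvd A" "\<not> q dvd B"
      using iff AB q(1) coprime_common_divisor not_prime_unit by blast+
    show "\<not> q dvd u" using um q coprime_common_divisor not_prime_unit by blast
  qed
  have pow2: "q dvd 2 ^ k \<Longrightarrow> prime q \<Longrightarrow> q dvd 2" for q :: int and k
    using prime_dvd_power by blast
  have N0_m: "\<not> q dvd N0" if q: "prime q" "q dvd m" for q
  proof
    assume "q dvd N0"
    moreover have "q dvd s * 2 ^ j * m\<^sup>2" using q by (simp add: power2_eq_square)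
    ultimately have "q dvd 3 * A ^ 3 * u\<^sup>2" by (simp add: N0_def dvd_add_right_iff)
    hence "q dvd 3 \<or> q dvd A ^ 3 \<or> q dvd u\<^sup>2" using q(1) by (simp add: prime_dvd_mult_iff)
    thus False using m_coprime[OF q] prime_dvd_power q(1) by blast
  qed
  have N0_Au: "\<not> q dvd N0" if q: "prime q" "q dvd A * u" for q
  proof
    assume "q dvd N0"
    moreover have "q dvd A \<or> q dvd u" using q by (simp add: pd)
    hence Au: "q dvd 3 * A ^ 3 * u\<^sup>2" by (auto simp: power2_eq_square power3_eq_cube)
    ultimately have "q dvd s * 2 ^ j * m\<^sup>2" by (simp add: N0_def dvd_add_left_iff)
    hence "q dvd 2 ^ j \<or> q dvd m\<^sup>2" using q(1) s_dvd by (simp add: prime_dvd_mult_iff)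
    hence "q dvd 2 \<or> q dvd m" using pow2 prime_dvd_power q(1) by blast
    moreover have "\<not> q dvd 2"
    proof
      assume "q dvd 2"
      hence "q = 2" using q(1) primes_dvd_imp_eq[of q 2] by simp
      thus False using \<open>q dvd A \<or> q dvd u\<close> A u by auto
    qed
    ultimately show False using m_coprime[OF q(1)] \<open>q dvd A \<or> q dvd u\<close> by blast
  qed
  have N0_3: "\<not> 3 dvd N0"
  proof
    assume "3 dvd N0"
    moreover have "3 dvd 3 * A ^ 3 * u\<^sup>2" by simp
    ultimately have "3 dvd s * 2 ^ j * m\<^sup>2" by (simp add: N0_def dvd_add_left_iff)
    hence "3 dvd (2 :: int) ^ j \<or> 3 dvd m\<^sup>2" using s_dvd[of 3] by (simp add: prime_dvd_mult_iff)
    thus False using pow2[of 3 j] m prime_dvd_power[of 3 m 2] by auto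
  qed
  \<comment> \<open>The symbol is available for coprime coordinates, so the content is divided out.
    It is odd and prime to 3, hence \<open>d'\<close> stays odd and divisible by 9.\<close>
  define k where "k = gcd c d"
  obtain c' d' where cd': "c = c' * k" "d = d' * k" "coprime c' d'"
    using gcd_coprime_exists[of c d] odd(2) unfolding k_def by (metis dvd_0_right gcd_eq_0_iff)
  have kd: "k dvd c" "k dvd d" by (simp_all add: k_def)
  have kY: "k dvd Y"
  proof -
    have "Y = 2 * c - d" using c2 by simp
    thus ?thesis using kd by simp
  qed
  define \<mu> where "\<mu> = Eis c' d'"
  have k\<mu>: "of_int k * \<mu> = Eis c d" by (simp add: \<mu>_def cd' eisenstein_eq_iff)
  have N0k: "N0 = k\<^sup>2 * eis_norm \<mu>"
    unfolding eis[symmetric] k\<mu>[symmetric] eis_norm_mult by (simp add: eis_norm_def)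
  hence N_dvd: "eis_norm \<mu> dvd N0" by simp
  have k3: "\<not> 3 dvd k"
  proof
    assume "3 dvd k"
    hence "3 dvd N0" unfolding N0k by (simp add: power2_eq_square)
    with N0_3 show False ..
  qed
  have "coprime 9 k"
  proof -
    have "coprime (3 ^ 2) k" using k3 by (intro coprime_power_left_iff[THEN iffD2] disjI1 prime_imp_coprime) auto
    thus ?thesis by simp
  qed
  moreover have "9 dvd d' * k" using B(2) by (simp add: d_def flip: cd'(2))
  ultimately have d9: "9 dvd d'" by (simp add: coprime_dvd_mult_left_iff)
  have "3 dvd d'" using d9 by presburger
  then obtain f where f: "cubic_symbol \<mu> f"
    using cubic_symbol_exists[of \<mu>] cd'(3) by (auto simp: \<mu>_def)
  have f3: "f 3 = 1" using d9 by (intro cubic_symbol_3[OF f]) (simp add: \<mu>_def)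
  have "odd d'" "odd k" using odd(2) cd'(2) by auto
  have odd_N: "odd (eis_norm \<mu>)" using \<open>odd d'\<close> by (simp add: eis_norm_def \<mu>_def)
  have f2: "f 2 \<noteq> 1" by (rule cubic_symbol_2_neq_1[OF f odd_N]) (simp add: \<mu>_def \<open>odd d'\<close>)
  have f_unit: "f a \<in> cubic_units" if "\<And>q. prime q \<Longrightarrow> q dvd a \<Longrightarrow> \<not> q dvd N0" for a
  proof (rule cubic_symbol_unit[OF f])
    show "coprime a (eis_norm \<mu>)"
    proof (rule ccontr)
      assume "\<not> coprime a (eis_norm \<mu>)"
      hence "\<not> is_unit (gcd a (eis_norm \<mu>))" by (simp add: coprime_iff_gcd_eq_1)
      moreover have "gcd a (eis_norm \<mu>) \<noteq> 0" using odd_N by (metis dvd_0_right gcd_eq_0_iff)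
      ultimately obtain q where "prime q" "q dvd gcd a (eis_norm \<mu>)" using prime_divisorE by metis
      thus False using that[of q] N_dvd dvd_trans by auto
    qed
  qed
  \<comment> \<open>The right-hand side is \<open>Y + d * sqrt (- 3)\<close>, whose first term
    vanishes at primes dividing \<open>m\<close> and whose second term vanishes at primes dividing
    \<open>u\<close>.\<close>
  have two_k_\<mu>: "of_int (2 * k) * \<mu> = Eis (Y + d) (2 * d)"
  proof -
    have "of_int (2 * k) * \<mu> = 2 * (of_int k * \<mu>)" by simp
    also have "\<dots> = Eis (Y + d) (2 * d)" unfolding k\<mu> using c2 by (simp add: eisenstein_eq_iff)
    finally show ?thesis .
  qed
  have fm: "f m = 1"
  proof (rule cubic_symbol_int_eq_1[OF f])
    show "m \<noteq> 0" using m by auto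
    fix q :: nat assume q: "prime q" "int q dvd m"
    have pq: "prime (int q)" using q by simp
    note mc = m_coprime[OF pq q(2)]
    have nd: "\<not> int q dvd d" using mc pq by (simp add: d_def pd)
    have nk: "\<not> int q dvd k" using nd kd dvd_trans by blast
    \<comment> \<open>This is \<open>d * sqrt (- 3)\<close>.\<close>
    define v where "v = Eis d (2 * d)"
    show "f (int q) = 1"
    proof (rule cubic_symbol_prime_eq_1[OF f q(1)])
      show "q \<noteq> 3" using mc(5) by auto
      have "q \<noteq> 2" using mc(4) by auto
      thus "odd q" using q(1) prime_ge_2_nat[of q] prime_odd_nat[of q] by auto
      show "\<not> int q dvd eis_norm \<mu>" using N0_m[OF pq q(2)] N_dvd dvd_trans by blast
      show "\<not> int q dvd 2 * k" using nk mc pq by (simp add: pd)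
      show "\<not> int q dvd - 3 * d\<^sup>2"
        using mc nd pq prime_dvd_power[OF pq, of d 2] by (auto simp: prime_dvd_mult_iff)
      have "int q dvd Y" using q by (simp add: Y_def)
      hence "of_int (int q) dvd Eis (Y + d) (2 * d) - v"
        unfolding of_int_dvd_eisenstein_iff by (simp add: v_def)
      thus "dcong (of_nat q) (of_int (2 * k) * \<mu>) v" unfolding two_k_\<mu> dcong_def by simp
      show "v * v = of_int (- 3 * d\<^sup>2)" by (simp add: v_def eisenstein_eq_iff power2_eq_square)
      show "eis_cnj v = v \<or> eis_cnj v = - v" by (simp add: v_def eisenstein_eq_iff)
    qed
  qed
  have fu: "f u = 1"
  proof (rule cubic_symbol_int_eq_1[OF f])
    show "u \<noteq> 0" using u by auto
    fix q :: nat assume q: "prime q" "int q dvd u"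
    have pq: "prime (int q)" using q by simp
    have nN: "\<not> int q dvd N0" using N0_Au[OF pq] q by simp
    have q2: "q \<noteq> 2" using q u by auto
    have nm: "\<not> int q dvd m" using m_coprime(3)[OF pq] q(2) by blast
    have qd: "int q dvd d" using q by (simp add: d_def)
    have nY: "\<not> int q dvd Y"
    proof
      assume "int q dvd Y"
      hence "int q dvd Y\<^sup>2 + 3 * d\<^sup>2" using qd by (simp add: power2_eq_square)
      also have "Y\<^sup>2 + 3 * d\<^sup>2 = 4 * N0"
      proof -
        have "4 * eis_norm (Eis c d) = (2 * c - d)\<^sup>2 + 3 * d\<^sup>2" by (simp add: eis_norm_4)
        thus ?thesis by (simp add: c2 eis)
      qed
      finally have "int q dvd 2 ^ 2" using nN pq by (simp add: pd)
      hence "int q dvd 2" by (rule pow2[OF _ pq])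
      hence "q dvd 2" using int_dvd_int_iff[of q 2] by simp
      thus False using q2 q(1) primes_dvd_imp_eq[of q 2] by simp
    qed
    have nk: "\<not> int q dvd k" using nY kY dvd_trans by blast
    \<comment> \<open>The prime 3 may divide \<open>u\<close>; it lies outside the reciprocity
      formula and is settled by the supplementary law.\<close>
    show "f (int q) = 1"
    proof (cases "q = 3")
      case False
      show ?thesis
      proof (rule cubic_symbol_prime_eq_1[OF f q(1) False])
        show "odd q" using q2 q(1) prime_ge_2_nat[of q] prime_odd_nat[of q] by auto
        have "\<not> int q dvd 2" using q2 q(1) primes_dvd_imp_eq[of q 2] int_dvd_int_iff[of q 2] by auto
        thus "\<not> int q dvd 2 * k" using nk pq by (simp add: pd)
        show "\<not> int q dvd eis_norm \<mu>" using nN N_dvd dvd_trans by blast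
        show "\<not> int q dvd Y\<^sup>2" using nY prime_dvd_power[OF pq] by blast
        have "of_int (int q) dvd Eis (Y + d) (2 * d) - of_int Y"
          unfolding of_int_dvd_eisenstein_iff using qd by simp
        thus "dcong (of_nat q) (of_int (2 * k) * \<mu>) (of_int Y)" unfolding two_k_\<mu> dcong_def by simp
      qed (simp_all add: power2_eq_square)
    qed (simp add: f3)
  qed
  \<comment> \<open>The value at \<open>A\<close> itself stays unknown; coprimality to the modulus
    is enough for its cube.\<close>
  have fA: "f A ^ 3 = 1"
    by (rule cubic_units_cube, rule f_unit) (use N0_Au in auto)
  \<comment> \<open>The norm \<open>N0\<close> is a multiple of \<mu>, so its two summands have the
    same symbol up to the sign, which the symbol ignores.\<close>
  have "dcong \<mu> (of_int (s * 2 ^ j * m\<^sup>2)) (of_int (- (3 * A ^ 3 * u\<^sup>2)))"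
  proof -
    have "\<mu> dvd Eis c d" unfolding k\<mu>[symmetric] by simp
    hence "\<mu> dvd Eis c d * eis_cnj (Eis c d)" by simp
    hence "\<mu> dvd of_int N0" unfolding mult_eis_cnj eis .
    thus ?thesis unfolding dcong_def of_int_diff[symmetric] by (simp only: N0_def diff_minus_eq_add)
  qed
  hence "f (s * 2 ^ j * m\<^sup>2) = f (- (3 * A ^ 3 * u\<^sup>2))" by (rule cubic_symbol_cong[OF f])
  moreover have "f s = 1" using s cubic_symbol_uminus[OF f, of 1] cubic_symbol_1[OF f] by auto
  ultimately have "f 2 ^ j = 1"
    by (simp add: cubic_symbol_uminus[OF f] cubic_symbol_mult[OF f] cubic_symbol_power[OF f] fm fu fA f3)
  moreover have "f 2 \<in> cubic_units"
  proof (rule cubic_symbol_unit[OF f])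
    show "coprime 2 (eis_norm \<mu>)" using odd_N by simp
  qed
  ultimately show ?thesis using f2 three_dvd_exponent by blast
qed

section \<open>Ideal classes\<close>

text \<open>Induction on the cardinality: the cycle through one element has as many members as its
  length, and \<tau> permutes what remains.\<close>

lemma dvd_card_if_cycle_lengths_dvd:
  fixes \<tau> :: "'a \<Rightarrow> 'a"
  assumes "finite S" "\<tau> ` S \<subseteq> S" "inj_on \<tau> S"
    and "\<And>x j. x \<in> S \<Longrightarrow> j > 0 \<Longrightarrow> (\<tau> ^^ j) x = x \<Longrightarrow> m dvd j"
  shows "m dvd card S"
  using assms
proof (induction "card S" arbitrary: S rule: less_induct)
  case less
  show ?case
  proof (cases "S = {}")
    case False
    then obtain x where x: "x \<in> S" by blast
    have clos: "(\<tau> ^^ i) y \<in> S" if "y \<in> S" for i y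
      using that less.prems(2) by (induction i) auto
    have inj: "inj_on (\<tau> ^^ i) S" for i
    proof (induction i)
      case (Suc i)
      show ?case
      proof (rule inj_onI)
        fix y z assume yz: "y \<in> S" "z \<in> S" and "(\<tau> ^^ Suc i) y = (\<tau> ^^ Suc i) z"
        hence "\<tau> ((\<tau> ^^ i) y) = \<tau> ((\<tau> ^^ i) z)" by simp
        hence "(\<tau> ^^ i) y = (\<tau> ^^ i) z"
          by (rule inj_onD[OF less.prems(3) _ clos[OF yz(1)] clos[OF yz(2)]])
        thus "y = z" by (rule inj_onD[OF Suc _ yz])
      qed
    qed simp
    have "\<not> inj (\<lambda>i. (\<tau> ^^ i) x)"
    proof
      assume "inj (\<lambda>i. (\<tau> ^^ i) x)"
      moreover have "finite (range (\<lambda>i. (\<tau> ^^ i) x))"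
        by (rule finite_subset[OF _ less.prems(1)]) (use clos x in auto)
      ultimately show False using finite_imageD infinite_UNIV_nat by blast
    qed
    then obtain i' j' where "i' \<noteq> j'" "(\<tau> ^^ i') x = (\<tau> ^^ j') x" by (auto simp: inj_on_def)
    then obtain i j where ij: "i < j" "(\<tau> ^^ i) x = (\<tau> ^^ j) x" by (metis linorder_neqE_nat)
    have "(\<tau> ^^ i) ((\<tau> ^^ (j - i)) x) = (\<tau> ^^ i) x"
      using ij by (simp flip: funpow_add comp_apply[of "\<tau> ^^ i" "\<tau> ^^ (j - i)"])
    hence "(\<tau> ^^ (j - i)) x = x" using inj_onD[OF inj] clos x by blast
    hence ex: "\<exists>k>0. (\<tau> ^^ k) x = x" using ij(1) by (intro exI[of _ "j - i"]) simp
    define k where "k = (LEAST k. k > 0 \<and> (\<tau> ^^ k) x = x)"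
    have k: "k > 0" "(\<tau> ^^ k) x = x" using LeastI_ex[OF ex] by (simp_all add: k_def)
    have k_min: "k \<le> l" if "l > 0" "(\<tau> ^^ l) x = x" for l
      unfolding k_def using that by (intro Least_le) simp
    define Orb where "Orb = (\<lambda>i. (\<tau> ^^ i) x) ` {..<k}"
    have "inj_on (\<lambda>i. (\<tau> ^^ i) x) {..<k}"
    proof (rule linorder_inj_onI)
      fix r l assume rl: "r < l" "r \<in> {..<k}" "l \<in> {..<k}"
      show "(\<tau> ^^ r) x \<noteq> (\<tau> ^^ l) x"
      proof
        assume e: "(\<tau> ^^ r) x = (\<tau> ^^ l) x"
        have "(\<tau> ^^ r) ((\<tau> ^^ (l - r)) x) = (\<tau> ^^ r) x"
          using rl e by (simp flip: funpow_add comp_apply[of "\<tau> ^^ r" "\<tau> ^^ (l - r)"])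
        hence "(\<tau> ^^ (l - r)) x = x" using inj_onD[OF inj] clos x by blast
        hence "k \<le> l - r" using rl by (intro k_min) auto
        thus False using rl by auto
      qed
    qed auto
    hence card_Orb: "card Orb = k" by (simp add: Orb_def card_image)
    have sub: "Orb \<subseteq> S" using clos x by (auto simp: Orb_def)
    have fin: "finite Orb" by (simp add: Orb_def)
    have "m dvd card (S - Orb)"
    proof (rule less.hyps)
      show "card (S - Orb) < card S"
        using card_Diff_subset[OF fin sub] card_Orb k(1) card_mono[OF less.prems(1) sub] by simp
      show "\<tau> ` (S - Orb) \<subseteq> S - Orb"
      proof
        fix z assume "z \<in> \<tau> ` (S - Orb)"
        then obtain y where y: "y \<in> S" "y \<notin> Orb" "z = \<tau> y" by blast
        have "z \<notin> Orb"
        proof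
          assume "z \<in> Orb"
          then obtain i where i: "i < k" "\<tau> y = (\<tau> ^^ i) x" using y by (auto simp: Orb_def)
          \<comment> \<open>The predecessor on the cycle; for \<open>x\<close> itself it has index
            \<open>k - 1\<close>.\<close>
          obtain l where l: "l < k" "(\<tau> ^^ i) x = (\<tau> ^^ Suc l) x"
          proof (cases i)
            case 0
            thus ?thesis using k that[of "k - 1"] by simp
          next
            case (Suc l)
            thus ?thesis using i that[of l] by simp
          qed
          hence "\<tau> y = \<tau> ((\<tau> ^^ l) x)" using i by simp
          hence "y = (\<tau> ^^ l) x" using inj_onD[OF less.prems(3)] clos x y by blast
          thus False using y l by (auto simp: Orb_def)
        qed
        thus "z \<in> S - Orb" using y less.prems(2) by auto
      qed
      show "inj_on \<tau> (S - Orb)" using less.prems(3) by (rule inj_on_subset) auto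
    qed (use less.prems in auto)
    moreover have "m dvd k" using less.prems(4)[OF x k] .
    moreover have "card S = card (S - Orb) + k"
      using card_Diff_subset[OF fin sub] card_Orb card_mono[OF less.prems(1) sub] by simp
    ultimately show ?thesis by simp
  qed simp
qed

section \<open>Multipliers of ideals, and multiplication by an ideal containing 2\<close>

context nonsquare
begin

lemma OK_sum: "(\<And>i. i \<in> A \<Longrightarrow> f i \<in> OK) \<Longrightarrow> sum f A \<in> OK"
proof (induction A rule: infinite_finite_induct)
  case (insert i A)
  have "f i \<in> OK" "sum f A \<in> OK" using insert by blast+
  from OK_add[OF this] show ?case unfolding sum.insert[OF insert.hyps(1,2)] .
qed (use OK_01 in simp_all)

lemma OK_conj: "qel x y \<in> OK \<Longrightarrow> qel x (- y) \<in> OK"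
  unfolding OK_iff by simp

lemma OK_rat: "qel r 0 \<in> OK \<Longrightarrow> r \<in> \<int>"
  unfolding OK_iff by (auto intro: rat_square_Ints)

lemma of_int_qel: "of_int k = qel (of_int k) 0"
  by (simp add: qel_def)

text \<open>The norm \<open>n\<close> of an element of \<open>I\<close> lies in \<open>I\<close>,
  hence \<open>z ^ k * of_int n\<close> is integral for all \<open>k\<close>. The powers of
  \<open>z\<close>, of its conjugate, and therefore of its trace and norm have bounded denominators,
  which makes trace and norm integers.\<close>

lemma ideal_stabilizer_subset_OK:
  assumes I: "ideal I R" "I \<noteq> {0}" and z: "z = qel x y" "\<And>i. i \<in> I \<Longrightarrow> z * i \<in> I"
  shows "z \<in> OK"
proof -
  obtain i where i: "i \<in> I" "i \<noteq> 0" using I idealD(2)[OF I(1)] by blast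
  have iOK: "i \<in> OK" using idealD(1)[OF I(1) i(1)] .
  then obtain a b where ab: "i = qel a b" by (rule OK_cases)
  have "nrm a b \<in> \<int>" using iOK unfolding ab OK_iff nrm_def by blast
  then obtain n where n: "nrm a b = of_int n" by (rule Ints_cases)
  have n0: "n \<noteq> 0" using nrm_0_iff[of a b] i(2) ab n by auto
  have "qel a (- b) \<in> OK" using iOK unfolding ab by (rule OK_conj)
  hence "qel a (- b) * i \<in> I" using i(1) by (rule idealD(4)[OF I(1)])
  hence nI: "of_int n \<in> I" using qel_conj[of a b] by (simp add: ab n of_int_qel mult.commute)
  define \<beta> where "\<beta> = qel x (- y)"
  have pow_conj: "\<exists>u v. z ^ k = qel u v \<and> \<beta> ^ k = qel u (- v)" for k
  proof (induction k)
    case 0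
    show ?case by (rule exI[of _ 1], rule exI[of _ 0]) (simp add: qel_def)
  next
    case (Suc k)
    then obtain u v where uv: "z ^ k = qel u v" "\<beta> ^ k = qel u (- v)" by blast
    have "z ^ Suc k = qel (x * u + of_int d * y * v) (x * v + y * u)"
      unfolding power_Suc uv by (simp add: z(1) qel_mult)
    moreover have "\<beta> ^ Suc k = qel (x * u + of_int d * y * v) (- (x * v + y * u))"
      unfolding power_Suc uv by (simp add: \<beta>_def qel_mult)
    ultimately show ?case by blast
  qed
  have zI: "z ^ k * of_int n \<in> I" for k
    by (induction k) (use nI z(2) in \<open>auto simp: mult.assoc\<close>)
  have zOK: "z ^ k * of_int n \<in> OK" for k using idealD(1)[OF I(1) zI] .
  have \<beta>OK: "\<beta> ^ k * of_int n \<in> OK" for k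
  proof -
    obtain u v where uv: "z ^ k = qel u v" "\<beta> ^ k = qel u (- v)" using pow_conj by blast
    have "qel (u * of_int n) (v * of_int n) \<in> OK"
      using zOK[of k] by (simp add: uv of_int_qel qel_mult)
    from OK_conj[OF this] show ?thesis by (simp add: uv of_int_qel qel_mult)
  qed
  have prod: "of_int (n\<^sup>2) * (z ^ k * \<beta> ^ l) \<in> OK" for k l
  proof -
    have eq: "of_int (n\<^sup>2) * (z ^ k * \<beta> ^ l) = (z ^ k * of_int n) * (\<beta> ^ l * of_int n)"
      by (simp add: power2_eq_square)
    show ?thesis unfolding eq by (rule OK_mult[OF zOK \<beta>OK])
  qed
  have n2: "n\<^sup>2 > 0" using n0 by simp
  have sc: "of_int (n\<^sup>2) * qel r 0 = qel (of_int (n\<^sup>2) * r) 0" for r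
    unfolding of_int_qel[of "n\<^sup>2"] qel_mult by simp
  have tr: "qel (2 * x) 0 = z + \<beta>" by (simp add: z(1) \<beta>_def qel_add)
  have nm: "qel (x\<^sup>2 - of_int d * y\<^sup>2) 0 = z * \<beta>"
    by (simp add: z(1) \<beta>_def qel_mult power2_eq_square mult.assoc)
  have "of_int (n\<^sup>2) * (2 * x) ^ k \<in> \<int>" for k
  proof (rule OK_rat)
    have "qel (of_int (n\<^sup>2) * (2 * x) ^ k) 0 = of_int (n\<^sup>2) * qel (2 * x) 0 ^ k"
      unfolding qel_pow0 sc ..
    also have "\<dots> = (\<Sum>l\<le>k. of_int (int (k choose l)) * (of_int (n\<^sup>2) * (z ^ l * \<beta> ^ (k - l))))"
      by (simp only: tr binomial_ring sum_distrib_left) (simp add: mult_ac)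
    also have "\<dots> \<in> OK" by (intro OK_sum OK_mult OK_of_int prod)
    finally show "qel (of_int (n\<^sup>2) * (2 * x) ^ k) 0 \<in> OK" .
  qed
  moreover have "of_int (n\<^sup>2) * (x\<^sup>2 - of_int d * y\<^sup>2) ^ k \<in> \<int>" for k
  proof (rule OK_rat)
    have "qel (of_int (n\<^sup>2) * (x\<^sup>2 - of_int d * y\<^sup>2) ^ k) 0 = of_int (n\<^sup>2) * qel (x\<^sup>2 - of_int d * y\<^sup>2) 0 ^ k"
      unfolding qel_pow0 sc ..
    also have "\<dots> \<in> OK" by (simp only: nm power_mult_distrib prod)
    finally show "qel (of_int (n\<^sup>2) * (x\<^sup>2 - of_int d * y\<^sup>2) ^ k) 0 \<in> OK" .
  qed
  ultimately show ?thesis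
    unfolding z(1) OK_iff using bounded_denominators_imp_Ints[OF n2] by blast
qed

text \<open>The product of \<open>I\<close> with the ideal generated by \<open>2\<close> and \<open>\<alpha>\<close>.\<close>

definition two_mult :: "complex \<Rightarrow> complex set \<Rightarrow> complex set" where
  "two_mult \<alpha> I = {2 * x + \<alpha> * y | x y. x \<in> I \<and> y \<in> I}"

lemma two_multI: "x \<in> I \<Longrightarrow> y \<in> I \<Longrightarrow> 2 * x + \<alpha> * y \<in> two_mult \<alpha> I"
  by (auto simp: two_mult_def)

lemma two_multE:
  assumes "z \<in> two_mult \<alpha> I"
  obtains x y where "x \<in> I" "y \<in> I" "z = 2 * x + \<alpha> * y"
  using assms by (auto simp: two_mult_def)

lemma two_mult_mono: "I \<subseteq> I' \<Longrightarrow> two_mult \<alpha> I \<subseteq> two_mult \<alpha> I'"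
  by (auto simp: two_mult_def)

lemma two_mult_funpow_mono: "I \<subseteq> I' \<Longrightarrow> (two_mult \<alpha> ^^ j) I \<subseteq> (two_mult \<alpha> ^^ j) I'"
  by (induction j) (auto intro: two_mult_mono[THEN subsetD])

lemma two_mult_scale: "two_mult \<alpha> ((\<lambda>x. \<beta> * x) ` I) = (\<lambda>x. \<beta> * x) ` two_mult \<alpha> I"
proof (intro equalityI subsetI)
  fix z assume "z \<in> two_mult \<alpha> ((\<lambda>x. \<beta> * x) ` I)"
  then obtain x y where "x \<in> I" "y \<in> I" "z = 2 * (\<beta> * x) + \<alpha> * (\<beta> * y)" by (auto simp: two_mult_def)
  moreover have "z = \<beta> * (2 * x + \<alpha> * y)" using calculation by (simp add: algebra_simps)
  ultimately show "z \<in> (\<lambda>x. \<beta> * x) ` two_mult \<alpha> I" using two_multI by blast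
next
  fix z assume "z \<in> (\<lambda>x. \<beta> * x) ` two_mult \<alpha> I"
  then obtain x y where xy: "x \<in> I" "y \<in> I" "z = \<beta> * (2 * x + \<alpha> * y)" by (auto simp: two_mult_def)
  have z: "z = 2 * (\<beta> * x) + \<alpha> * (\<beta> * y)" using xy(3) by (simp add: algebra_simps)
  show "z \<in> two_mult \<alpha> ((\<lambda>x. \<beta> * x) ` I)"
    unfolding z by (rule two_multI; rule image_eqI[OF refl]; rule xy)
qed

lemma two_mult_funpow_scale:
  "(two_mult \<alpha> ^^ j) ((\<lambda>x. \<beta> * x) ` I) = (\<lambda>x. \<beta> * x) ` (two_mult \<alpha> ^^ j) I"
  by (induction j) (auto simp: two_mult_scale)

lemma two_mult_nonzero_ideal:
  assumes "\<alpha> \<in> OK" "I \<in> nonzero_ideals R"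
  shows "two_mult \<alpha> I \<in> nonzero_ideals R"
proof -
  have I: "ideal I R" "I \<noteq> {0}" using assms(2) by (simp_all add: nonzero_ideals_R)
  have two: "2 \<in> OK" using OK_of_int[of 2] by simp
  have "ideal (two_mult \<alpha> I) R"
  proof (rule idealR)
    show "two_mult \<alpha> I \<subseteq> OK"
    proof
      fix z assume "z \<in> two_mult \<alpha> I"
      then obtain x y where "x \<in> I" "y \<in> I" "z = 2 * x + \<alpha> * y" by (auto simp: two_mult_def)
      thus "z \<in> OK" using OK_add[OF OK_mult[OF two idealD(1)[OF I(1)]] OK_mult[OF assms(1) idealD(1)[OF I(1)]]]
        by blast
    qed
    show "0 \<in> two_mult \<alpha> I" using two_multI[OF idealD(2)[OF I(1)] idealD(2)[OF I(1)]] by simp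
  next
    fix u v assume "u \<in> two_mult \<alpha> I" "v \<in> two_mult \<alpha> I"
    then obtain x y x' y' where h: "x \<in> I" "y \<in> I" "u = 2 * x + \<alpha> * y"
      "x' \<in> I" "y' \<in> I" "v = 2 * x' + \<alpha> * y'" by (auto simp: two_mult_def)
    have uv: "u + v = 2 * (x + x') + \<alpha> * (y + y')" using h by (simp add: algebra_simps)
    show "u + v \<in> two_mult \<alpha> I" unfolding uv by (intro two_multI idealD(3)[OF I(1)] h)
  next
    fix u v assume u: "u \<in> OK" and "v \<in> two_mult \<alpha> I"
    then obtain x y where h: "x \<in> I" "y \<in> I" "v = 2 * x + \<alpha> * y" by (auto simp: two_mult_def)
    have uv: "u * v = 2 * (u * x) + \<alpha> * (u * y)" using h by (simp add: algebra_simps)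
    show "u * v \<in> two_mult \<alpha> I" unfolding uv by (intro two_multI idealD(4)[OF I(1) u] h)
  qed
  moreover have "two_mult \<alpha> I \<noteq> {0}"
  proof -
    obtain i where i: "i \<in> I" "i \<noteq> 0" using I idealD(2)[OF I(1)] by blast
    have "2 * i + \<alpha> * 0 \<in> two_mult \<alpha> I" by (intro two_multI i idealD(2)[OF I(1)])
    moreover have "2 * i + \<alpha> * 0 \<noteq> 0" using i(2) by simp
    ultimately show ?thesis by (metis singletonD)
  qed
  ultimately show ?thesis by (simp add: nonzero_ideals_R)
qed

lemma two_mult_rel:
  assumes "\<alpha> \<in> OK" "(I, J) \<in> ideal_class_rel R"
  shows "(two_mult \<alpha> I, two_mult \<alpha> J) \<in> ideal_class_rel R"
proof -
  obtain u v where h: "I \<in> nonzero_ideals R" "J \<in> nonzero_ideals R"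
    "u \<in> OK" "u \<noteq> 0" "v \<in> OK" "v \<noteq> 0" "(\<lambda>x. u * x) ` I = (\<lambda>x. v * x) ` J"
    using assms(2) by (rule relE)
  show ?thesis
    by (rule relI[OF two_mult_nonzero_ideal[OF assms(1) h(1)] two_mult_nonzero_ideal[OF assms(1) h(2)] h(3-6)])
       (simp only: two_mult_scale[symmetric] h(7))
qed

lemma scale_nonzero_ideal_rel:
  assumes "I \<in> nonzero_ideals R" "(\<lambda>x. \<beta> * x) ` I \<in> nonzero_ideals R" "\<beta> \<in> OK" "\<beta> \<noteq> 0"
  shows "((\<lambda>x. \<beta> * x) ` I, I) \<in> ideal_class_rel R"
  by (rule relI[OF assms(2,1) OK_01(2) one_neq_zero assms(3,4)]) simp

lemma OK_nonzero_ideal: "OK \<in> nonzero_ideals R"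
proof -
  have "ideal OK R" by (rule idealR) (use OK_01 OK_add OK_mult in blast)+
  moreover have "OK \<noteq> {0}" using OK_01(2) by (metis singletonD zero_neq_one)
  ultimately show ?thesis unfolding nonzero_ideals_R by blast
qed

end

section \<open>The two primes above 2 and the generators of their powers\<close>

locale nonsquare_1_mod_8 = nonsquare +
  assumes d_1_mod_8: "8 dvd d - 1"
begin

text \<open>Half of \<open>1 + s\<close>. Its norm \<open>(1 - d) / 4\<close> is even because
  \<open>d\<close> is 1 modulo 8, so 2 together with \<theta>, or with its conjugate, generates the
  two primes above 2.\<close>

definition \<theta> where "\<theta> = qel (1 / 2) (1 / 2)"
definition \<theta>' where "\<theta>' = qel (1 / 2) (- 1 / 2)"

abbreviation "T \<equiv> two_mult \<theta>"
abbreviation "T' \<equiv> two_mult \<theta>'"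

lemma \<theta>_add: "\<theta> + \<theta>' = 1"
  by (simp add: \<theta>_def \<theta>'_def qel_add) (simp add: qel_def)

lemma of_int_d: obtains t where "of_int d = (8 * of_int t + 1 :: rat)"
proof -
  obtain t where t: "d - 1 = 8 * t" using d_1_mod_8 by blast
  have "(of_int (d - 1) :: rat) = of_int (8 * t)" by (simp only: t)
  thus ?thesis using that[of t] by (simp add: algebra_simps)
qed

lemma \<theta>_mult: obtains t :: int where "\<theta> * \<theta>' = 2 * of_int t"
proof -
  obtain t where t: "of_int d = (8 * of_int t + 1 :: rat)" by (rule of_int_d)
  have "\<theta> * \<theta>' = qel (of_int (2 * - t)) 0"
    by (simp add: \<theta>_def \<theta>'_def qel_mult qel_eq_iff t field_simps)
  also have "\<dots> = 2 * of_int (- t)" unfolding of_int_qel[symmetric] by simp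
  finally show ?thesis by (rule that)
qed

lemma \<theta>_OK: "\<theta> \<in> OK" "\<theta>' \<in> OK"
proof -
  obtain t where t: "of_int d = (8 * of_int t + 1 :: rat)" by (rule of_int_d)
  have "(1 / 2)\<^sup>2 - of_int d * (1 / 2)\<^sup>2 = (of_int (- 2 * t) :: rat)"
    by (simp add: t power2_eq_square field_simps)
  hence "(1 / 2)\<^sup>2 - of_int d * (1 / 2)\<^sup>2 \<in> (\<int> :: rat set)" by (metis Ints_of_int)
  thus "\<theta> \<in> OK" unfolding \<theta>_def OK_iff by simp
  thus "\<theta>' \<in> OK" unfolding \<theta>_def \<theta>'_def using OK_conj by fastforce
qed

lemma two_OK: "2 \<in> OK" using OK_of_int[of 2] by simp

text \<open>The product of the ideals \<open>(2, \<alpha>)\<close> and \<open>(2, \<beta>)\<close>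
  is generated by 4, \<open>2 * \<alpha>\<close>, \<open>2 * \<beta>\<close> and
  \<open>\<alpha> * \<beta>\<close>, all multiples of 2, and the second and third add up to
  2.\<close>

lemma T_inverse_aux:
  assumes I: "ideal I R" and a: "\<alpha> \<in> OK" "\<beta> \<in> OK" "\<alpha> + \<beta> = 1" "\<alpha> * \<beta> = 2 * of_int t"
  shows "two_mult \<beta> (two_mult \<alpha> I) = (\<lambda>x. 2 * x) ` I"
proof (intro equalityI subsetI)
  fix z assume "z \<in> two_mult \<beta> (two_mult \<alpha> I)"
  then obtain x y u v where h: "x \<in> I" "y \<in> I" "u \<in> I" "v \<in> I"
    "z = 2 * (2 * x + \<alpha> * y) + \<beta> * (2 * u + \<alpha> * v)" by (auto simp: two_mult_def)
  have "z = 2 * (2 * x + \<alpha> * y + \<beta> * u) + (\<alpha> * \<beta>) * v" using h(5) by (simp add: algebra_simps)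
  also have "\<dots> = 2 * (2 * x + \<alpha> * y + \<beta> * u + of_int t * v)" unfolding a(4) by (simp add: algebra_simps)
  finally have z: "z = 2 * (2 * x + \<alpha> * y + \<beta> * u + of_int t * v)" .
  have "2 * x + \<alpha> * y + \<beta> * u + of_int t * v \<in> I"
    by (intro idealD(3)[OF I] idealD(4)[OF I] two_OK a OK_of_int h)
  thus "z \<in> (\<lambda>x. 2 * x) ` I" using z by blast
next
  fix z assume "z \<in> (\<lambda>x. 2 * x) ` I"
  then obtain x where x: "x \<in> I" "z = 2 * x" by blast
  have z: "z = 2 * (2 * 0 + \<alpha> * x) + \<beta> * (2 * x + \<alpha> * 0)"
    using x(2) a(3) by (simp add: algebra_simps) (metis distrib_right mult_1)
  show "z \<in> two_mult \<beta> (two_mult \<alpha> I)" unfolding z by (intro two_multI x idealD(2)[OF I])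
qed

lemma T'_T: "ideal I R \<Longrightarrow> T' (T I) = (\<lambda>x. 2 * x) ` I"
  by (rule \<theta>_mult) (rule T_inverse_aux[OF _ \<theta>_OK \<theta>_add])

lemma T_T': "ideal I R \<Longrightarrow> T (T' I) = (\<lambda>x. 2 * x) ` I"
proof (rule \<theta>_mult)
  fix t assume "ideal I R" "\<theta> * \<theta>' = 2 * of_int t"
  thus ?thesis using T_inverse_aux[OF _ \<theta>_OK(2,1), of I t] \<theta>_add by (simp add: add.commute mult.commute)
qed

lemma funpow_nonzero_ideal:
  assumes "\<alpha> \<in> OK" "I \<in> nonzero_ideals R"
  shows "(two_mult \<alpha> ^^ j) I \<in> nonzero_ideals R"
  by (induction j) (use assms two_mult_nonzero_ideal in auto)

lemma funpow_inverse_aux: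
  assumes a: "\<alpha> \<in> OK" "\<beta> \<in> OK" "\<And>I. ideal I R \<Longrightarrow> two_mult \<beta> (two_mult \<alpha> I) = (\<lambda>x. 2 * x) ` I"
    and I: "I \<in> nonzero_ideals R"
  shows "(two_mult \<beta> ^^ j) ((two_mult \<alpha> ^^ j) I) = (\<lambda>x. 2 ^ j * x) ` I"
proof (induction j)
  case (Suc j)
  have "(two_mult \<beta> ^^ Suc j) ((two_mult \<alpha> ^^ Suc j) I)
      = (two_mult \<beta> ^^ j) (two_mult \<beta> (two_mult \<alpha> ((two_mult \<alpha> ^^ j) I)))"
    by (simp only: funpow_Suc_right funpow.simps(2) comp_apply funpow_swap1)
  also have "two_mult \<beta> (two_mult \<alpha> ((two_mult \<alpha> ^^ j) I)) = (\<lambda>x. 2 * x) ` (two_mult \<alpha> ^^ j) I"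
    using funpow_nonzero_ideal[OF a(1) I] by (intro a(3)) (simp add: nonzero_ideals_R)
  also have "(two_mult \<beta> ^^ j) \<dots> = (\<lambda>x. 2 * x) ` (two_mult \<beta> ^^ j) ((two_mult \<alpha> ^^ j) I)"
    by (rule two_mult_funpow_scale)
  also have "\<dots> = (\<lambda>x. 2 ^ Suc j * x) ` I" unfolding Suc by (simp add: image_image mult.assoc)
  finally show ?case .
qed simp

lemma T'_T_funpow:
  assumes "I \<in> nonzero_ideals R"
  shows "(T' ^^ j) ((T ^^ j) I) = (\<lambda>x. 2 ^ j * x) ` I"
  by (rule funpow_inverse_aux[OF \<theta>_OK _ assms]) (rule T'_T)

lemma T_T'_funpow:
  assumes "I \<in> nonzero_ideals R"
  shows "(T ^^ j) ((T' ^^ j) I) = (\<lambda>x. 2 ^ j * x) ` I"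
  by (rule funpow_inverse_aux[OF \<theta>_OK(2,1) _ assms]) (rule T_T')

lemma funpow_mult: "u \<in> (two_mult \<alpha> ^^ j) OK \<Longrightarrow> i \<in> I \<Longrightarrow> ideal I R \<Longrightarrow> u * i \<in> (two_mult \<alpha> ^^ j) I"
proof (induction j arbitrary: u)
  case 0
  thus ?case using idealD(4) by simp
next
  case (Suc j)
  have "u \<in> two_mult \<alpha> ((two_mult \<alpha> ^^ j) OK)" using Suc.prems(1) by simp
  then obtain v w where h: "v \<in> (two_mult \<alpha> ^^ j) OK" "w \<in> (two_mult \<alpha> ^^ j) OK" "u = 2 * v + \<alpha> * w"
    by (rule two_multE)
  have ui: "u * i = 2 * (v * i) + \<alpha> * (w * i)" using h(3) by (simp add: algebra_simps)
  show ?case unfolding ui funpow.simps comp_apply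
    by (intro two_multI Suc.IH h Suc.prems)
qed

lemma funpow_conj: "qel x y \<in> (T ^^ j) OK \<Longrightarrow> qel x (- y) \<in> (T' ^^ j) OK"
  and funpow_conj': "qel x y \<in> (T' ^^ j) OK \<Longrightarrow> qel x (- y) \<in> (T ^^ j) OK"
proof -
  \<comment> \<open>A general generator \<open>qel a b\<close> lets one induction serve both
    directions.\<close>
  have aux: "qel x (- y) \<in> (two_mult (qel a (- b)) ^^ j) OK"
    if "qel x y \<in> (two_mult (qel a b) ^^ j) OK" "qel a b \<in> OK" for x y a b j
    using that(1)
  proof (induction j arbitrary: x y)
    case 0
    thus ?case using OK_conj by simp
  next
    case (Suc j)
    have "qel x y \<in> two_mult (qel a b) ((two_mult (qel a b) ^^ j) OK)" using Suc.prems by simp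
    then obtain v w where h: "v \<in> (two_mult (qel a b) ^^ j) OK" "w \<in> (two_mult (qel a b) ^^ j) OK"
        "qel x y = 2 * v + qel a b * w"
      by (rule two_multE)
    have "(two_mult (qel a b) ^^ j) OK \<subseteq> OK"
      using funpow_nonzero_ideal[OF that(2) OK_nonzero_ideal] idealD(1) nonzero_ideals_R by blast
    then obtain v1 v2 w1 w2 where vw: "v = qel v1 v2" "w = qel w1 w2"
      using h(1,2) OK_cases by (metis (no_types, lifting) subsetD)
    have two: "2 = qel 2 0" by (simp add: qel_def)
    have "x = 2 * v1 + (a * w1 + of_int d * b * w2)" "y = 2 * v2 + (a * w2 + b * w1)"
      using h(3) by (simp_all add: vw two qel_mult qel_add qel_eq_iff)
    hence eq: "qel x (- y) = 2 * qel v1 (- v2) + qel a (- b) * qel w1 (- w2)"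
      by (simp add: two qel_mult qel_add qel_eq_iff)
    have "qel v1 (- v2) \<in> (two_mult (qel a (- b)) ^^ j) OK"
      "qel w1 (- w2) \<in> (two_mult (qel a (- b)) ^^ j) OK"
      using Suc.IH h vw by blast+
    thus ?case unfolding eq funpow.simps comp_apply by (rule two_multI)
  qed
  show "qel x y \<in> (T ^^ j) OK \<Longrightarrow> qel x (- y) \<in> (T' ^^ j) OK"
    using aux[where a = "1 / 2" and b = "1 / 2"] \<theta>_OK by (simp add: \<theta>_def \<theta>'_def)
  show "qel x y \<in> (T' ^^ j) OK \<Longrightarrow> qel x (- y) \<in> (T ^^ j) OK"
    using aux[where a = "1 / 2" and b = "- 1 / 2"] \<theta>_OK by (simp add: \<theta>_def \<theta>'_def)
qed

lemma field_divide:
  assumes "u = qel a b" "v = qel a' b'"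
  shows "\<exists>x y. u / v = qel x y"
proof (cases "v = 0")
  case True
  thus ?thesis by (intro exI[of _ 0]) (simp add: qel_def)
next
  case False
  hence n: "nrm a' b' \<noteq> 0" using nrm_0_iff assms by simp
  define r where "r = inverse (nrm a' b')"
  have "v * (qel a' (- b') * qel r 0) = qel (nrm a' b' * r) 0"
    unfolding assms mult.assoc[symmetric] qel_conj by (simp add: qel_mult)
  also have "\<dots> = 1" using n by (simp add: r_def qel_def)
  finally have "u / v = u * (qel a' (- b') * qel r 0)" using False by (simp add: field_simps)
  thus ?thesis unfolding assms qel_mult by blast
qed

text \<open>Cancels \<open>I\<close> from \<open>(T ^^ j) I = \<rho> * I\<close> through
  multipliers: for \<open>u\<close> in \<open>(T ^^ j) OK\<close> the quotient
  \<open>u / \<rho>\<close> maps \<open>I\<close> into itself, so it is integral. For the other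
  inclusion, \<open>v * \<rho> / 2 ^ j\<close> does so for \<open>v\<close> in
  \<open>(T' ^^ j) OK\<close>; applying \<open>T ^^ j\<close> to the resulting inclusion of ideals
  puts \<rho> into \<open>(T ^^ j) OK\<close>.\<close>

lemma principal_power:
  assumes I: "I \<in> nonzero_ideals R" and rel: "((T ^^ j) I, I) \<in> ideal_class_rel R"
  obtains \<rho> where "\<rho> \<in> (T ^^ j) OK" "\<rho> \<noteq> 0" "(T ^^ j) OK = (\<lambda>x. \<rho> * x) ` OK"
proof -
  have id: "ideal I R" "I \<noteq> {0}" using I by (simp_all add: nonzero_ideals_R)
  obtain \<alpha> \<beta> where ab: "\<alpha> \<in> OK" "\<alpha> \<noteq> 0" "\<beta> \<in> OK" "\<beta> \<noteq> 0" "(\<lambda>x. \<alpha> * x) ` (T ^^ j) I = (\<lambda>x. \<beta> * x) ` I"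
    using rel by (rule relE)
  obtain a1 a2 where a12: "\<alpha> = qel a1 a2" using ab(1) by (rule OK_cases)
  obtain b1 b2 where b12: "\<beta> = qel b1 b2" using ab(3) by (rule OK_cases)
  define \<rho> where "\<rho> = \<beta> / \<alpha>"
  obtain r1 r2 where r12: "\<rho> = qel r1 r2" using field_divide[OF b12 a12] unfolding \<rho>_def by blast
  have \<rho>0: "\<rho> \<noteq> 0" using ab by (simp add: \<rho>_def)
  have TI: "(T ^^ j) I = (\<lambda>x. \<rho> * x) ` I"
  proof -
    have "(T ^^ j) I = (\<lambda>x. x / \<alpha>) ` (\<lambda>x. \<alpha> * x) ` (T ^^ j) I" using ab(2) by (simp add: image_image)
    also have "\<dots> = (\<lambda>x. \<rho> * x) ` I" unfolding ab(5) by (simp add: image_image \<rho>_def)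
    finally show ?thesis .
  qed
  have sub: "u / \<rho> \<in> OK" if u: "u \<in> (T ^^ j) OK" for u
  proof -
    have "u \<in> OK" using u funpow_nonzero_ideal[OF \<theta>_OK(1) OK_nonzero_ideal] idealD(1) nonzero_ideals_R by blast
    then obtain u1 u2 where u12: "u = qel u1 u2" by (rule OK_cases)
    obtain x y where xy: "u / \<rho> = qel x y" using field_divide[OF u12 r12] by blast
    show ?thesis
    proof (rule ideal_stabilizer_subset_OK[OF id xy])
      fix i assume i: "i \<in> I"
      have "u * i \<in> (\<lambda>x. \<rho> * x) ` I" using funpow_mult[OF u i id(1)] TI by simp
      then obtain i' where "i' \<in> I" "u * i = \<rho> * i'" by blast
      thus "u / \<rho> * i \<in> I" using \<rho>0 by (simp add: field_simps)
    qed
  qed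
  have sub': "v * \<rho> / 2 ^ j \<in> OK" if v: "v \<in> (T' ^^ j) OK" for v
  proof -
    have "v \<in> OK" using v funpow_nonzero_ideal[OF \<theta>_OK(2) OK_nonzero_ideal] idealD(1) nonzero_ideals_R by blast
    then obtain v1 v2 where v12: "v = qel v1 v2" by (rule OK_cases)
    have "v * \<rho> = qel (v1 * r1 + of_int d * v2 * r2) (v1 * r2 + v2 * r1)"
      by (simp add: v12 r12 qel_mult)
    moreover have "2 ^ j = qel (2 ^ j) 0" by (simp add: qel_def of_rat_power)
    ultimately obtain x y where xy: "v * \<rho> / 2 ^ j = qel x y" using field_divide by metis
    show ?thesis
    proof (rule ideal_stabilizer_subset_OK[OF id xy])
      fix i assume i: "i \<in> I"
      have "\<rho> * i \<in> (T ^^ j) I" using i TI by blast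
      moreover have "ideal ((T ^^ j) I) R"
        using funpow_nonzero_ideal[OF \<theta>_OK(1) I] by (simp add: nonzero_ideals_R)
      ultimately have "v * (\<rho> * i) \<in> (T' ^^ j) ((T ^^ j) I)" using funpow_mult[OF v] by blast
      hence "v * (\<rho> * i) \<in> (\<lambda>x. 2 ^ j * x) ` I" unfolding T'_T_funpow[OF I] .
      then obtain i' where "i' \<in> I" "v * (\<rho> * i) = 2 ^ j * i'" by blast
      thus "v * \<rho> / 2 ^ j * i \<in> I" by (simp add: field_simps)
    qed
  qed
  have "(\<lambda>x. \<rho> * x) ` (T' ^^ j) OK \<subseteq> (\<lambda>x. 2 ^ j * x) ` OK"
  proof
    fix z assume "z \<in> (\<lambda>x. \<rho> * x) ` (T' ^^ j) OK"
    then obtain v where v: "v \<in> (T' ^^ j) OK" "z = \<rho> * v" by blast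
    have "z = 2 ^ j * (v * \<rho> / 2 ^ j)" using v(2) by simp
    thus "z \<in> (\<lambda>x. 2 ^ j * x) ` OK" using sub'[OF v(1)] by blast
  qed
  from two_mult_funpow_mono[OF this, of j \<theta>]
  have "(\<lambda>x. \<rho> * x) ` (\<lambda>x. 2 ^ j * x) ` OK \<subseteq> (\<lambda>x. 2 ^ j * x) ` (T ^^ j) OK"
    unfolding two_mult_funpow_scale T_T'_funpow[OF OK_nonzero_ideal] .
  hence "\<rho> * (2 ^ j * 1) \<in> (\<lambda>x. 2 ^ j * x) ` (T ^^ j) OK" using OK_01(2) by blast
  then obtain z where z: "z \<in> (T ^^ j) OK" "\<rho> * (2 ^ j * 1) = 2 ^ j * z" by blast
  hence \<rho>: "\<rho> \<in> (T ^^ j) OK" by simp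
  have "(T ^^ j) OK = (\<lambda>x. \<rho> * x) ` OK"
  proof (intro equalityI subsetI)
    fix u assume u: "u \<in> (T ^^ j) OK"
    have "u = \<rho> * (u / \<rho>)" using \<rho>0 by simp
    thus "u \<in> (\<lambda>x. \<rho> * x) ` OK" using sub[OF u] by blast
  next
    fix u assume "u \<in> (\<lambda>x. \<rho> * x) ` OK"
    then obtain x where x: "x \<in> OK" "u = x * \<rho>" by (auto simp: mult.commute)
    have "ideal ((T ^^ j) OK) R"
      using funpow_nonzero_ideal[OF \<theta>_OK(1) OK_nonzero_ideal] nonzero_ideals_R by blast
    from idealD(4)[OF this x(1) \<rho>] show "u \<in> (T ^^ j) OK" unfolding x(2) .
  qed
  thus ?thesis using that \<rho> \<rho>0 by blast
qed

text \<open>Modulo 2, \<theta> is idempotent, as \<open>\<theta> * \<theta>'\<close> is even and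
  \<open>\<theta>' = 1 - \<theta>\<close>.\<close>

lemma \<theta>_power: "j > 0 \<Longrightarrow> \<exists>z\<in>OK. \<theta> ^ j = \<theta> + 2 * z"
proof (induction j rule: nat_induct_non_zero)
  case 1
  thus ?case using OK_01(1) by (intro bexI[of _ 0]) simp_all
next
  case (Suc j)
  then obtain z where z: "z \<in> OK" "\<theta> ^ j = \<theta> + 2 * z" by blast
  obtain t where t: "\<theta> * \<theta>' = 2 * of_int t" by (rule \<theta>_mult)
  have "\<theta> * \<theta> = \<theta> - \<theta> * \<theta>'" using \<theta>_add by (metis add_diff_cancel_right' distrib_left mult.right_neutral)
  hence "\<theta> ^ Suc j = \<theta> + 2 * (\<theta> * z - of_int t)" using z(2) t by (simp add: algebra_simps)
  thus ?case using OK_diff[OF OK_mult[OF \<theta>_OK(1) z(1)] OK_of_int] by blast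
qed

lemma \<theta>_power_mem: "\<theta> ^ j \<in> (T ^^ j) OK"
proof (induction j)
  case 0
  thus ?case using OK_01(2) by simp
next
  case (Suc j)
  have "ideal ((T ^^ j) OK) R"
    using funpow_nonzero_ideal[OF \<theta>_OK(1) OK_nonzero_ideal] nonzero_ideals_R by blast
  from two_multI[OF idealD(2)[OF this] Suc, of \<theta>] show ?case by simp
qed

text \<open>A generator of the \<open>j\<close>-th power of the prime yields \<open>x\<close> as its
  trace and \<open>y\<close> as twice its coefficient at sqrt \<open>d\<close>; the equation is four
  times its norm.\<close>

lemma norm_2_power:
  assumes I: "I \<in> nonzero_ideals R" and rel: "((T ^^ j) I, I) \<in> ideal_class_rel R" and j: "j > 0"
  obtains x s :: int and y :: rat where "odd x" "s = 1 \<or> s = - 1"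
    "(of_int x)\<^sup>2 - of_int d * y\<^sup>2 = of_int (s * 2 ^ (j + 2))"
proof -
  obtain \<rho> where \<rho>: "\<rho> \<in> (T ^^ j) OK" "\<rho> \<noteq> 0" "(T ^^ j) OK = (\<lambda>x. \<rho> * x) ` OK"
    using principal_power[OF I rel] by blast
  have TOK: "ideal ((T ^^ j) OK) R" "ideal ((T' ^^ j) OK) R" for j
    using funpow_nonzero_ideal[OF \<theta>_OK(1) OK_nonzero_ideal] funpow_nonzero_ideal[OF \<theta>_OK(2) OK_nonzero_ideal]
      nonzero_ideals_R by blast+
  have \<rho>OK: "\<rho> \<in> OK" using idealD(1)[OF TOK(1) \<rho>(1)] .
  then obtain r1 r2 where r: "\<rho> = qel r1 r2" "2 * r1 \<in> \<int>" "r1\<^sup>2 - of_int d * r2\<^sup>2 \<in> \<int>" by (rule OK_cases)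
  obtain x where x: "2 * r1 = of_int x" using r(2) by (rule Ints_cases)
  obtain N where N: "nrm r1 r2 = of_int N" using r(3) unfolding nrm_def by (rule Ints_cases)
  define \<rho>' where "\<rho>' = qel r1 (- r2)"
  have \<rho>': "\<rho>' \<in> (T' ^^ j) OK" unfolding \<rho>'_def using \<rho>(1) unfolding r(1) by (rule funpow_conj)
  have TT: "(\<lambda>x. \<rho> * x) ` (T' ^^ j) OK = (\<lambda>x. 2 ^ j * x) ` OK"
    using T'_T_funpow[OF OK_nonzero_ideal, of j] unfolding \<rho>(3) two_mult_funpow_scale .
  have int_dvd: "2 ^ j dvd k" if "(of_int k :: complex) = 2 ^ j * \<kappa>" "\<kappa> \<in> OK" for k \<kappa>
  proof -
    have "\<kappa> = qel (of_int k / 2 ^ j) 0"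
      using that(1) by (simp add: qel_def of_rat_divide of_rat_power field_simps)
    hence "of_int k / 2 ^ j \<in> (\<int> :: rat set)" using that(2) OK_rat by simp
    then obtain l where "of_int k / 2 ^ j = (of_int l :: rat)" by (rule Ints_cases)
    hence "of_int k = (of_int (2 ^ j * l) :: rat)" by (simp add: field_simps)
    hence "k = 2 ^ j * l" by (simp only: of_int_eq_iff)
    thus ?thesis by simp
  qed
  have NN: "\<rho> * \<rho>' = of_int N" unfolding r(1) \<rho>'_def qel_conj N of_int_qel[symmetric] ..
  have "\<rho> * \<rho>' \<in> (\<lambda>x. 2 ^ j * x) ` OK" using \<rho>' TT by blast
  then obtain \<kappa> where "\<kappa> \<in> OK" "of_int N = 2 ^ j * \<kappa>" unfolding NN by blast
  hence "2 ^ j dvd N" using int_dvd by blast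
  then obtain A where A: "N = 2 ^ j * A" by blast
  have "2 ^ j * 1 \<in> (\<lambda>x. \<rho> * x) ` (T' ^^ j) OK" unfolding TT using OK_01(2) by blast
  \<comment> \<open>The cofactor \<open>2 ^ j / \<rho>\<close> lies in the power of the conjugate
    prime, so its norm is also a multiple of \<open>2 ^ j\<close>. The two norms multiply to
    \<open>4 ^ j\<close>, which leaves only a sign in each.\<close>
  then obtain \<sigma> where \<sigma>: "\<sigma> \<in> (T' ^^ j) OK" "2 ^ j = \<rho> * \<sigma>" by auto
  have "\<sigma> \<in> OK" using idealD(1)[OF TOK(2) \<sigma>(1)] .
  then obtain s1 s2 where s: "\<sigma> = qel s1 s2" "s1\<^sup>2 - of_int d * s2\<^sup>2 \<in> \<int>" by (rule OK_cases)
  obtain M where M: "nrm s1 s2 = of_int M" using s(2) unfolding nrm_def by (rule Ints_cases)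
  have "qel s1 (- s2) \<in> (T ^^ j) OK" using \<sigma>(1) unfolding s(1) by (rule funpow_conj')
  then obtain \<kappa>' where \<kappa>': "\<kappa>' \<in> OK" "qel s1 (- s2) = \<rho> * \<kappa>'" unfolding \<rho>(3) by blast
  have "of_int M = \<sigma> * qel s1 (- s2)" unfolding s(1) qel_conj M of_int_qel[symmetric] ..
  also have "\<dots> = 2 ^ j * \<kappa>'" using \<sigma>(2) \<kappa>'(2) by (simp add: mult_ac)
  finally have "2 ^ j dvd M" using int_dvd \<kappa>'(1) by blast
  then obtain B where B: "M = 2 ^ j * B" by blast
  have "qel (2 ^ j) 0 = \<rho> * \<sigma>" using \<sigma>(2) by (simp add: qel_def of_rat_power)
  hence "2 ^ j = r1 * s1 + of_int d * r2 * s2" "0 = r1 * s2 + r2 * s1"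
    unfolding r(1) s(1) qel_mult qel_eq_iff by auto
  hence "nrm (2 ^ j) 0 = nrm r1 r2 * nrm s1 s2" using nrm_mult[of r1 s1 r2 s2] by simp
  hence "(of_int (2 ^ j * 2 ^ j) :: rat) = of_int (N * M)"
    unfolding N M by (simp add: nrm_def power2_eq_square)
  hence "2 ^ j * 2 ^ j = N * M" by (simp only: of_int_eq_iff)
  hence "A * B = 1" unfolding A B by (simp add: mult_ac)
  hence A1: "A = 1 \<or> A = - 1" by (rule pos_zmult_eq_1_iff_lemma)
  \<comment> \<open>With an even trace, \<rho> would be in both primes above 2, hence in
    \<open>2 * OK\<close>. Then \<open>\<theta> ^ j\<close>, a multiple of \<rho>, would be
    divisible by 2, although it is \<theta> modulo 2.\<close>
  have "odd x"
  proof
    assume "even x"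
    then obtain x' where "x = 2 * x'" by blast
    hence r1: "r1 = of_int x'" using x by simp
    obtain j' where j': "j = Suc j'" using j by (cases j) auto
    have sub: "(T ^^ j) OK \<subseteq> T OK" "(T' ^^ j) OK \<subseteq> T' OK"
      unfolding j' funpow.simps comp_apply
      by (intro two_mult_mono subsetI idealD(1)[OF TOK(1)] idealD(1)[OF TOK(2)]; assumption)+
    have sum: "\<rho> = 2 * of_int x' + \<theta>' * 0 - \<rho>'"
      by (simp add: r(1) \<rho>'_def r1 qel_def of_rat_minus)
    have idT: "ideal (T OK) R" "ideal (T' OK) R" using TOK[of 1] by simp_all
    have "2 * of_int x' + \<theta>' * 0 \<in> T' OK" using OK_of_int OK_01(1) by (rule two_multI)
    hence "\<rho> \<in> T' OK" unfolding sum using \<rho>' sub(2) by (intro ideal_diff[OF idT(2)]) auto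
    moreover have "\<rho> \<in> T OK" using \<rho>(1) sub by blast
    ultimately obtain a b a' b' where ab: "a \<in> OK" "b \<in> OK" "\<rho> = 2 * a + \<theta> * b"
      "a' \<in> OK" "b' \<in> OK" "\<rho> = 2 * a' + \<theta>' * b'" by (elim two_multE)
    obtain t where t: "\<theta> * \<theta>' = 2 * of_int t" by (rule \<theta>_mult)
    \<comment> \<open>The relation \<open>\<theta> + \<theta>' = 1\<close> shows that the two primes
      meet in multiples of 2.\<close>
    have "\<rho> = \<theta>' * \<rho> + \<theta> * \<rho>" using \<theta>_add by (metis add.commute distrib_right mult_1)
    also have "\<dots> = \<theta>' * (2 * a + \<theta> * b) + \<theta> * (2 * a' + \<theta>' * b')" using ab(3,6) by simp
    also have "\<dots> = 2 * (\<theta>' * a + \<theta> * a') + (\<theta> * \<theta>') * (b + b')" by (simp add: algebra_simps)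
    also have "\<dots> = 2 * (\<theta>' * a + \<theta> * a' + of_int t * (b + b'))" unfolding t by (simp add: algebra_simps)
    finally have \<rho>2: "\<rho> = 2 * (\<theta>' * a + \<theta> * a' + of_int t * (b + b'))" .
    have mem: "\<theta>' * a + \<theta> * a' + of_int t * (b + b') \<in> OK"
      by (intro OK_add OK_mult OK_of_int \<theta>_OK ab)
    obtain z where z: "z \<in> OK" "\<theta> ^ j = \<theta> + 2 * z" using \<theta>_power[OF j] by blast
    obtain w where w: "w \<in> OK" "\<theta> ^ j = \<rho> * w" using \<theta>_power_mem[of j] unfolding \<rho>(3) by blast
    define \<kappa> where "\<kappa> = (\<theta>' * a + \<theta> * a' + of_int t * (b + b')) * w - z"
    have \<kappa>: "\<kappa> \<in> OK" unfolding \<kappa>_def by (intro OK_diff OK_mult mem w z)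
    have "\<theta> = \<rho> * w - 2 * z" using z(2) w(2) by (metis add_diff_cancel_right')
    also have "\<dots> = 2 * \<kappa>" unfolding \<kappa>_def by (subst \<rho>2) (simp add: algebra_simps)
    finally have "\<theta> = 2 * \<kappa>" .
    moreover have "2 * qel (1 / 4) (1 / 4) = \<theta>"
    proof -
      have "2 * qel (1 / 4) (1 / 4) = qel 2 0 * qel (1 / 4) (1 / 4)" by (simp add: qel_def)
      thus ?thesis by (simp add: \<theta>_def qel_mult)
    qed
    ultimately have "\<kappa> = qel (1 / 4) (1 / 4)" by simp
    with \<kappa> have "qel (1 / 4) (1 / 4) \<in> OK" by simp
    hence "2 * (1 / 4) \<in> (\<int> :: rat set)" unfolding OK_iff by blast
    then obtain l where "2 * (1 / 4 :: rat) = of_int l" by (rule Ints_cases)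
    hence "(of_int 1 :: rat) = of_int (2 * l)" by simp
    hence "1 = 2 * l" by (simp only: of_int_eq_iff)
    thus False by presburger
  qed
  moreover have "(of_int x)\<^sup>2 - of_int d * (2 * r2)\<^sup>2 = of_int (A * 2 ^ (j + 2))"
  proof -
    have "(of_int x)\<^sup>2 - of_int d * (2 * r2)\<^sup>2 = 4 * nrm r1 r2"
      unfolding x[symmetric] nrm_def by (simp add: power2_eq_square algebra_simps)
    also have "\<dots> = of_int (A * 2 ^ (j + 2))" by (simp add: N A)
    finally show ?thesis .
  qed
  ultimately show ?thesis using that A1 by blast
qed

text \<open>\<open>T\<close> respects equivalence of ideals, and it is injective on classes because
  \<open>T'\<close> after \<open>T\<close> is scaling by 2. The premise mentions only integers and
  rationals, which hands the rest over to the cubic symbol.\<close>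

theorem dvd_class_number:
  assumes "\<And>(x::int) s y j. odd x \<Longrightarrow> s = 1 \<or> s = - 1 \<Longrightarrow>
    (of_int x)\<^sup>2 - of_int d * y\<^sup>2 = (of_int (s * 2 ^ (j + 2)) :: rat) \<Longrightarrow> m dvd j"
  shows "m dvd class_number (quadratic_field d)"
proof -
  define C where "C I = ideal_class_rel R `` {I}" for I
  define S where "S = C ` nonzero_ideals R"
  have S: "carrier (class_group R) = S"
    by (auto simp: class_group_def S_def C_def quotient_def)
  define \<tau> where "\<tau> A = ideal_class_rel R `` (T ` A)" for A
  have sy: "sym (ideal_class_rel R)" and tr: "trans (ideal_class_rel R)"
    using equiv_rel by (simp_all add: equiv_def)
  note eq = eq_equiv_class_iff[OF equiv_rel, folded C_def]
  have TI: "T I \<in> nonzero_ideals R" if "I \<in> nonzero_ideals R" for I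
    using that by (rule two_mult_nonzero_ideal[OF \<theta>_OK(1)])
  have \<tau>: "\<tau> (C I) = C (T I)" if I: "I \<in> nonzero_ideals R" for I
  proof (intro equalityI subsetI)
    fix K assume "K \<in> \<tau> (C I)"
    then obtain J where J: "(I, J) \<in> ideal_class_rel R" "(T J, K) \<in> ideal_class_rel R"
      by (auto simp: \<tau>_def C_def)
    from transD[OF tr two_mult_rel[OF \<theta>_OK(1) J(1)] J(2)] show "K \<in> C (T I)"
      by (simp add: C_def)
  next
    fix K assume "K \<in> C (T I)"
    moreover have "I \<in> C I" unfolding C_def using equiv_class_self[OF equiv_rel I] .
    ultimately show "K \<in> \<tau> (C I)" by (auto simp: \<tau>_def C_def)
  qed
  have \<tau>_pow: "(\<tau> ^^ j) (C I) = C ((T ^^ j) I)" if I: "I \<in> nonzero_ideals R" for I j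
    by (induction j) (use \<tau> funpow_nonzero_ideal[OF \<theta>_OK(1) I] in auto)
  have T'T: "(T' (T I), I) \<in> ideal_class_rel R" if I: "I \<in> nonzero_ideals R" for I
  proof -
    have "T' (T I) = (\<lambda>x. 2 * x) ` I" using I by (intro T'_T) (simp add: nonzero_ideals_R)
    moreover have "T' (T I) \<in> nonzero_ideals R"
      using I \<theta>_OK by (intro two_mult_nonzero_ideal)
    ultimately show ?thesis using I two_OK scale_nonzero_ideal_rel[of I 2] by simp
  qed
  have "m dvd card S"
  proof (rule dvd_card_if_cycle_lengths_dvd)
    show "finite S" using finite_class_group S by simp
    show "\<tau> ` S \<subseteq> S" using \<tau> TI by (auto simp: S_def)
    show "inj_on \<tau> S"
    proof (rule inj_onI)
      fix A B assume "A \<in> S" "B \<in> S" "\<tau> A = \<tau> B"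
      then obtain I J where IJ: "I \<in> nonzero_ideals R" "J \<in> nonzero_ideals R" "A = C I" "B = C J"
        by (auto simp: S_def)
      have "C (T I) = C (T J)" using \<open>\<tau> A = \<tau> B\<close> IJ \<tau> by simp
      hence "(T I, T J) \<in> ideal_class_rel R" using eq TI IJ by blast
      hence "(T' (T I), T' (T J)) \<in> ideal_class_rel R" by (rule two_mult_rel[OF \<theta>_OK(2)])
      hence "(I, J) \<in> ideal_class_rel R"
        using transD[OF tr transD[OF tr symD[OF sy T'T[OF IJ(1)]]] T'T[OF IJ(2)]] by blast
      thus "A = B" using eq IJ by blast
    qed
    fix A j assume A: "A \<in> S" "(j::nat) > 0" "(\<tau> ^^ j) A = A"
    then obtain I where I: "I \<in> nonzero_ideals R" "A = C I" by (auto simp: S_def)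
    hence "((T ^^ j) I, I) \<in> ideal_class_rel R"
      using A(3) \<tau>_pow eq funpow_nonzero_ideal[OF \<theta>_OK(1) I(1)] by simp
    from norm_2_power[OF I(1) this A(2)] show "m dvd j" using assms by metis
  qed
  thus ?thesis by (simp add: class_number_def Coset.order_def S)
qed

end

theorem theorem2p5:
  fixes a b :: int and n :: nat
  assumes "n > 1"
    and "gcd a b = 1"
    and "odd a" and "[a = 1] (mod 3)"
    and "odd b" and "[b = 0] (mod 3)"
  shows "3 dvd class_number (quadratic_field (3 * (4 * a ^ (3 * n) - b ^ (2 * n))))"
proof -
  define A B where "A = a ^ n" and "B = b ^ n"
  define D where "D = 3 * (4 * A ^ 3 - B\<^sup>2)"
  have D_eq: "3 * (4 * a ^ (3 * n) - b ^ (2 * n)) = D"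
    by (simp add: D_def A_def B_def mult.commute flip: power_mult)
  have three: "prime (3 :: int)" by simp
  have oddAB: "odd A" "odd B" using assms(3,5) by (simp_all add: A_def B_def)
  have "[A = 1] (mod 3)" unfolding A_def using cong_pow[OF assms(4), of n] by simp
  hence "A mod 3 = 1" by (simp add: cong_def)
  hence A3: "\<not> 3 dvd A" by presburger
  have "3 dvd b" using assms(6) by (simp add: cong_0_iff)
  hence "3 ^ n dvd B" unfolding B_def by (rule dvd_power_same)
  moreover have "(3::int) ^ 2 dvd 3 ^ n" using assms(1) by (intro le_imp_power_dvd) simp
  ultimately have B9: "9 dvd B" using dvd_trans by fastforce
  hence B3: "3 dvd B" using dvd_trans[of 3 9 B] by simp
  have AB: "coprime A B" using assms(2) by (simp add: A_def B_def coprime_iff_gcd_eq_1)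
  have oddD: "odd D" using oddAB by (simp add: D_def)
  \<comment> \<open>A single factor 3 in \<open>D\<close> keeps 3 from dividing the denominator
    \<open>m\<close> below.\<close>
  have D9: "\<not> 9 dvd D"
  proof
    assume "9 dvd D"
    hence "3 dvd 4 * A ^ 3 - B\<^sup>2" unfolding D_def by presburger
    moreover have "3 dvd B\<^sup>2" using B3 by (simp add: power2_eq_square)
    ultimately have "3 dvd 4 * A ^ 3" by (simp add: dvd_diff_left_iff)
    hence "3 dvd A ^ 3" by presburger
    thus False using A3 prime_dvd_power[OF three] by blast
  qed
  interpret nonsquare D
    using radicand_nonsquare[OF assms(1,4,6)] unfolding D_eq .
  interpret nonsquare_1_mod_8 D
  proof
    have sq: "8 dvd x\<^sup>2 - 1" if "odd x" for x :: int
    proof -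
      obtain y where y: "x = 2 * y + 1" using \<open>odd x\<close> by (rule oddE)
      have "x\<^sup>2 - 1 = 4 * (y * (y + 1))" by (simp add: y power2_eq_square algebra_simps)
      moreover obtain z where "y * (y + 1) = 2 * z" by (metis dvd_def even_mult_iff even_plus_one_iff)
      ultimately show ?thesis by simp
    qed
    obtain k where k: "A ^ 3 = 2 * k + 1" using oddAB(1) by (metis even_power oddE)
    have "D - 1 = 8 * (3 * k + 1) - 3 * (B\<^sup>2 - 1)" unfolding D_def k by simp
    also have "8 dvd \<dots>" by (rule dvd_diff[OF dvd_triv_left dvd_mult[OF sq[OF oddAB(2)]]])
    finally show "8 dvd D - 1" .
  qed
  have "3 dvd class_number (quadratic_field D)"
  proof (rule dvd_class_number)
    fix x s :: int and y :: rat and j :: nat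
    assume x: "odd x" and s: "s = 1 \<or> s = - 1"
      and eq: "(of_int x)\<^sup>2 - of_int D * y\<^sup>2 = (of_int (s * 2 ^ (j + 2)) :: rat)"
    \<comment> \<open>A denominator can occur as \<open>D\<close> may have square factors; the
      equation forces \<open>m\<^sup>2\<close> to divide \<open>D\<close>.\<close>
    obtain u m where m0: "m > 0" and um: "coprime u m" and y: "y = of_int u / of_int m" by (rule rat_cases)
    have "(of_int (m\<^sup>2 * x\<^sup>2 - D * u\<^sup>2) :: rat) = of_int m ^ 2 * ((of_int x)\<^sup>2 - of_int D * y\<^sup>2)"
      using m0 by (simp add: y power_divide right_diff_distrib)
    also have "\<dots> = of_int (s * 2 ^ (j + 2) * m\<^sup>2)" unfolding eq by simp
    finally have eqi: "m\<^sup>2 * x\<^sup>2 - D * u\<^sup>2 = s * 2 ^ (j + 2) * m\<^sup>2"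
      by (simp only: of_int_eq_iff)
    hence Du: "D * u\<^sup>2 = m\<^sup>2 * (x\<^sup>2 - s * 2 ^ (j + 2))" by (simp add: algebra_simps)
    hence "m\<^sup>2 dvd D * u\<^sup>2" by simp
    moreover have "coprime (m\<^sup>2) (u\<^sup>2)" using um by (simp add: coprime_commute)
    ultimately have m2D: "m\<^sup>2 dvd D" by (simp add: coprime_dvd_mult_left_iff)
    hence mD: "m dvd D" using dvd_trans[of m "m\<^sup>2" D] by (simp add: power2_eq_square)
    hence "odd m" using oddD dvd_trans[of 2 m D] by blast
    have "\<not> 3 dvd m"
    proof
      assume "3 dvd m"
      hence "3\<^sup>2 dvd m\<^sup>2" by (rule dvd_power_same)
      thus False using m2D D9 dvd_trans[of "3\<^sup>2" "m\<^sup>2" D] by simp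
    qed
    have "odd (D * u\<^sup>2)" unfolding Du using \<open>odd m\<close> x by simp
    hence "odd u" by simp
    show "3 dvd j"
      by (rule three_dvd_exponent_of_norm_2_power[of A B x m u s j])
         (use oddAB A3 B9 AB x \<open>odd m\<close> \<open>\<not> 3 dvd m\<close> \<open>odd u\<close> um mD s eqi in \<open>simp_all add: D_def\<close>)
  qed
  thus ?thesis unfolding D_eq .
qed

end
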